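(* Let $N\ge 1$ and let $W\in C^2_{\mathrm{loc}}(\mathbb{R}^N)$ satisfy hypotheses (h) and (h* ) described in the context. Then there exists a pair $(U,c)\in [C^2(\mathbb{R})]^N\times(0,+\infty)$ solving \[ U_{xx}-\nabla W(U)=-c\,U_x \ \text{ on } \mathbb{R},\qquad U(-\infty)=a^-,\quad U(+\infty)=a^+ . \] Moreover the speed $c$ equals the constant \[ c^*:=\sup\Big\{c>0\ :\ \text{there exists } L\ge 1 \text{ with } \inf_{V\in\mathcal{X}_L}E_c(V)<0\Big\}, \] and $E_{c^*}(U)=0$.
   Context: $W^-=\max\{-W,0\}$, $W^+=\max\{W,0\}$. Hypothesis (h* ): $a^\pm$ are minima of $W$, $W(a^-)<0=W(a^+)$ and $\min_{\mathbb{R}^N}W=W(a^-)$; there is $\alpha_0>0$ such that for every $\alpha\in(0,\alpha_0]$, $W^{-1}(\{\alpha\})=\partial\mathcal{C}^-_\alpha\cup\partial\mathcal{C}^+_\alpha$ and $\{u:W(u)\le\alpha\}=\mathcal{C}^-_\alpha\cup\mathcal{C}^+_\alpha$, where $\mathcal{C}^\pm_\alpha$ are disjoint compact convex sets with $C^2$ boundaries containing $a^\pm$ respectively; writing $\mathcal{C}^-_0$ for the component of $\{W\le 0\}$ containing $a^-$ and $n$ for its outward unit normal, $\nabla W\cdot n\ge c_0>0$ and $D^2W\ge c_0 I$ on $\partial\mathcal{C}^-_0$; and for every unit vector $\xi$, the map $r\mapsto W(a^-+r\xi)$ has strictly positive derivative for $r>0$ as long as $a^-+r\xi\in\mathcal{C}^-_{\alpha_0}$.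 Hypothesis (h): there is $R_0>0$ such that for every unit $\xi\in\mathbb{R}^N$ the maps $r\mapsto W(a^\pm+r\xi)$ have strictly positive derivative for $r\in(0,R_0)$. Fix $r_0\in(0,R_0)$ such that $W(u)\ge0$ for $|u-a^+|\le r_0$ and $W(u)<0$ for $|u-a^-|\le r_0$. For $c>0$ and $U\in[H^1_{\mathrm{loc}}(\mathbb{R})]^N$, $E_c(U):=\int_{\mathbb{R}}\big(\tfrac12|U_x|^2+W(U)\big)e^{cx}\,dx$. For $L>0$, $\mathcal{X}_L:=\{U\in[H^1_{\mathrm{loc}}(\mathbb{R})]^N: |U(x)-a^+|\le r_0 \text{ for } x\ge L,\ |U(x)-a^-|\le r_0 \text{ for } x\le -L\}$. *)

theory Defs
  imports "HOL-Analysis.Analysis"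
begin

definition C2_with :: "(real^'n::finite) set \<Rightarrow> (real^'n \<Rightarrow> real) \<Rightarrow> (real^'n \<Rightarrow> real^'n)
                        \<Rightarrow> (real^'n \<Rightarrow> real^'n^'n) \<Rightarrow> bool" where
  "C2_with U phi g H \<longleftrightarrow>
     (\<forall>x\<in>U. (phi has_derivative (\<lambda>h. g x \<bullet> h)) (at x)
           \<and> (g has_derivative (\<lambda>h. H x *v h)) (at x))
     \<and> continuous_on U H"

definition C2_on :: "(real^'n::finite) set \<Rightarrow> (real^'n \<Rightarrow> real) \<Rightarrow> bool" where
  "C2_on U phi \<longleftrightarrow> (\<exists>g H. C2_with U phi g H)"

definition C2_boundary :: "(real^'n::finite) set \<Rightarrow> bool" where
  "C2_boundary C \<longleftrightarrow>
     (\<forall>p\<in>frontier C. \<exists>U phi g H. open U \<and> p \<in> U \<and> C2_with U phi g H \<and> g p \<noteq> 0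
        \<and> C \<inter> U = {x\<in>U. phi x \<le> 0})"

definition outward_unit_normal :: "(real^'n::finite) set \<Rightarrow> real^'n \<Rightarrow> real^'n \<Rightarrow> bool" where
  "outward_unit_normal C p nu \<longleftrightarrow>
     p \<in> frontier C \<and>
     (\<exists>U phi g. open U \<and> p \<in> U \<and> (\<forall>x\<in>U. (phi has_derivative (\<lambda>h. g x \<bullet> h)) (at x))
        \<and> continuous_on U g \<and> g p \<noteq> 0
        \<and> C \<inter> U = {x\<in>U. phi x \<le> 0} \<and> nu = (1 / norm (g p)) *\<^sub>R g p)"

(* V \<in> [H^1_loc(R)]^N with weak derivative V': V' is locally (absolutely) integrable,
   V is its indefinite integral, and V' is locally square integrable *)
definition H1loc :: "(real \<Rightarrow> real^'n::finite) \<Rightarrow> (real \<Rightarrow> real^'n) \<Rightarrow> bool" where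
  "H1loc V V' \<longleftrightarrow>
     (\<forall>a b. a \<le> b \<longrightarrow> V' absolutely_integrable_on {a..b}
                   \<and> (V' has_integral (V b - V a)) {a..b}
                   \<and> (\<lambda>x. (norm (V' x))^2) integrable_on {a..b})"

definition Wplus :: "(real^'n::finite \<Rightarrow> real) \<Rightarrow> real^'n \<Rightarrow> real" where
  "Wplus W u = max (W u) 0"

definition Wminus :: "(real^'n::finite \<Rightarrow> real) \<Rightarrow> real^'n \<Rightarrow> real" where
  "Wminus W u = max (- W u) 0"

(* E_c(V) = \<integral> (|V'|^2/2 + W(V)) e^{cx} dx, as an extended real:
   positive part minus negative part *)
definition Ec :: "(real^'n::finite \<Rightarrow> real) \<Rightarrow> real \<Rightarrow> (real \<Rightarrow> real^'n) \<Rightarrow> (real \<Rightarrow> real^'n) \<Rightarrow> ereal" where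
  "Ec W c V V' =
     enn2ereal (\<integral>\<^sup>+ x. ennreal (((norm (V' x))^2 / 2 + Wplus W (V x)) * exp (c * x)) \<partial>lborel)
     - enn2ereal (\<integral>\<^sup>+ x. ennreal (Wminus W (V x) * exp (c * x)) \<partial>lborel)"

definition XL :: "real^'n::finite \<Rightarrow> real^'n \<Rightarrow> real \<Rightarrow> real \<Rightarrow> ((real \<Rightarrow> real^'n) \<times> (real \<Rightarrow> real^'n)) set" where
  "XL am ap r0 L = {(V, V'). H1loc V V'
       \<and> (\<forall>x\<ge>L. norm (V x - ap) \<le> r0) \<and> (\<forall>x\<le>-L. norm (V x - am) \<le> r0)}"

definition cstar :: "(real^'n::finite \<Rightarrow> real) \<Rightarrow> real^'n \<Rightarrow> real^'n \<Rightarrow> real \<Rightarrow> ereal" where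
  "cstar W am ap r0 = Sup {ereal c | c. c > 0 \<and>
       (\<exists>L\<ge>1. (INF p\<in>XL am ap r0 L. Ec W c (fst p) (snd p)) < 0)}"

end

theory Submission
  imports Defs "HOL-Complex_Analysis.Great_Picard"
begin

text \<open>Idea. After the rescaling \<open>x \<mapsto> c x\<close> the energy becomes
  \<open>c^2 A + B\<close> (up to a factor) with \<open>A = (1/2) \<integral> norm (V')^2 exp x\<close> and
  \<open>B = \<integral> W (V) exp x\<close>, both independent of \<open>c\<close>, so that the square of the critical speed is
  the supremum of the translation invariant quotient \<open>- B / A\<close>. Finite \<open>A\<close> gives
  \<open>norm (V x - ap)^2 \<le> 2 A exp (- x)\<close>, which confines the negative part of \<open>W (V)\<close> to a half line and
  makes the supremum finite and attained without any constraint on the curve. Minimality forces the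
  maximiser to stay, to the left of some point, in the convex core \<open>K\<close> of the nonpositive set around
  \<open>am\<close> (an excursion is beaten by the chord), and there the radial monotonicity of \<open>W\<close> drives it
  to \<open>am\<close>.\<close>

section \<open>Curves with finite weighted kinetic energy\<close>

text \<open>The constraints in \<open>XL\<close> would spoil the Euler-Lagrange equation wherever
  they are active, so they are not imposed. The unknown is the derivative \<open>G\<close>; the
  curve is recovered by integrating from +infinity, where the weight exp x is large and fixes the
  limit \<open>ap\<close>. Nothing is asked at -infinity: the weight is integrable there, and the
  limit \<open>am\<close> is proved afterwards from the equation. If kinetic energy is lost along a
  maximising sequence, minimality still forces the limit to be optimal. The return to
  \<open>cstar\<close> has two halves. A curve in \<open>XL\<close> with negative energy at speed l,
  once rescaled, shows that l^2 is at most the critical value M; there the strict positivity of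
  \<open>W\<close> around \<open>ap\<close> identifies its limit at +infinity. Conversely the
  optimal curve, run at a speed l below sqrt M, has energy of the sign of l^2 - M, hence negative,
  and lies in some \<open>XL\<close> because both of its limits are known.\<close>

lemma exp_neg_atLeast:
  "set_integrable lborel {a..} (\<lambda>x::real. exp (- x))"
  "(LINT x:{a..}|lborel. exp (- x)) = exp (- a)"
proof -
  have "(\<integral>\<^sup>+x. ennreal (exp (-x)) * indicator {a..} x \<partial>lborel) = ennreal (0 - (- exp (- a)))"
  proof (rule nn_integral_FTC_atLeast)
    show "((\<lambda>x::real. - exp (- x)) \<longlongrightarrow> 0) at_top"
      using tendsto_minus[OF filterlim_compose[OF exp_at_bot filterlim_uminus_at_bot_at_top]] by simp
  qed (auto intro!: derivative_eq_intros)
  then have nn: "(\<integral>\<^sup>+x. ennreal (indicator {a..} x * exp (-x)) \<partial>lborel) = ennreal (exp (- a))"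
    by (simp add: ennreal_mult' ennreal_indicator mult.commute)
  show "set_integrable lborel {a..} (\<lambda>x::real. exp (- x))"
    unfolding set_integrable_def by (rule integrableI_nonneg) (auto simp: nn)
  show "(LINT x:{a..}|lborel. exp (- x)) = exp (- a)"
    unfolding set_lebesgue_integral_def
    by (subst integral_eq_nn_integral) (auto simp: nn)
qed

lemma exp_atMost:
  "set_integrable lborel {..a} (\<lambda>x::real. exp x)"
  "(LINT x:{..a}|lborel. exp x) = exp a"
proof -
  have e: "(\<lambda>x. indicat_real {..a} (0 + -1 * x) *\<^sub>R exp (0 + -1 * x)) = (\<lambda>x. indicat_real {-a..} x *\<^sub>R exp (-x))"
    by (auto simp: fun_eq_iff indicator_def)
  show "set_integrable lborel {..a} (\<lambda>x::real. exp x)"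
    using exp_neg_atLeast(1)[of "-a"] unfolding set_integrable_def
    by (subst lborel_integrable_real_affine_iff[of "-1" _ 0, symmetric]) (simp_all only: e)
  show "(LINT x:{..a}|lborel. exp x) = exp a"
    using exp_neg_atLeast(2)[of "-a"] unfolding set_lebesgue_integral_def
    by (subst lborel_integral_real_affine[of "-1" _ 0]) (simp_all only: e, simp)
qed

lemma exp_neg_Icc:
  assumes "a \<le> b"
  shows "set_integrable lborel {a..b} (\<lambda>x::real. exp (- x))"
    and "(LINT x:{a..b}|lborel. exp (- x)) = exp (- a) - exp (- b)"
proof -
  have "has_bochner_integral lborel (\<lambda>x. indicator {a..b} x *\<^sub>R exp (- x)) (- exp (- b) - (- exp (- a)))"
    using assms by (intro has_bochner_integral_FTC_Icc)
      (auto intro!: derivative_eq_intros continuous_intros simp: has_real_derivative_iff_has_vector_derivative[symmetric])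
  then show "set_integrable lborel {a..b} (\<lambda>x::real. exp (- x))"
    "(LINT x:{a..b}|lborel. exp (- x)) = exp (- a) - exp (- b)"
    by (auto simp: set_integrable_def set_lebesgue_integral_def has_bochner_integral_iff)
qed

section \<open>Weighted square-integrable derivatives and the quadratic kinetic energy\<close>

definition weighted_L2 :: "(real \<Rightarrow> 'a::euclidean_space) \<Rightarrow> bool" where
  "weighted_L2 G \<longleftrightarrow> G \<in> borel_measurable borel \<and> integrable lborel (\<lambda>x. (norm (G x))^2 * exp x)"

text \<open>The factor 1/2 of the energy is kept outside, in coefficients such as
  \<open>M / 2\<close>, so that squares of speeds appear undivided as \<open>M\<close>.\<close>

definition kinetic :: "(real \<Rightarrow> 'a::euclidean_space) \<Rightarrow> real" where
  "kinetic G = (LINT x|lborel. (norm (G x))^2 * exp x)"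

lemma weighted_L2_measurable [measurable_dest]: "weighted_L2 G \<Longrightarrow> G \<in> borel_measurable borel"
  by (simp add: weighted_L2_def)

lemma kinetic_nonneg: "kinetic G \<ge> 0"
  unfolding kinetic_def by (intro Bochner_Integration.integral_nonneg) auto

lemma norm_add_sq_le: "norm (x + y :: 'a::real_inner)^2 \<le> 2 * norm x^2 + 2 * norm y^2"
  using zero_le_power2[of "norm (x - y)"] by (simp add: power2_norm_eq_inner inner_simps inner_commute)

lemma weighted_L2_scaleR:
  assumes "weighted_L2 G" shows "weighted_L2 (\<lambda>x. t *\<^sub>R G x)" "kinetic (\<lambda>x. t *\<^sub>R G x) = t^2 * kinetic G"
  using assms by (auto simp: weighted_L2_def kinetic_def power_mult_distrib mult.assoc)

lemma weighted_L2_add: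
  assumes "weighted_L2 F" "weighted_L2 G" shows "weighted_L2 (\<lambda>x. F x + G x)"
  unfolding weighted_L2_def
proof
  note [measurable] = assms[THEN weighted_L2_measurable]
  show "(\<lambda>x. F x + G x) \<in> borel_measurable borel" by measurable
  have "integrable lborel (\<lambda>x. 2 * ((norm (F x))^2 * exp x) + 2 * ((norm (G x))^2 * exp x))"
    using assms by (auto simp: weighted_L2_def)
  then show "integrable lborel (\<lambda>x. (norm (F x + G x))\<^sup>2 * exp x)"
  proof (rule Bochner_Integration.integrable_bound)
    show "AE x in lborel. norm ((norm (F x + G x))\<^sup>2 * exp x) \<le> norm (2 * ((norm (F x))^2 * exp x) + 2 * ((norm (G x))^2 * exp x))"
    proof (intro AE_I2)
      fix x
      show "norm ((norm (F x + G x))\<^sup>2 * exp x) \<le> norm (2 * ((norm (F x))^2 * exp x) + 2 * ((norm (G x))^2 * exp x))"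
        using mult_right_mono[OF norm_add_sq_le[of "F x" "G x"], of "exp x"] by (simp add: algebra_simps)
    qed
  qed measurable
qed

lemma weighted_L2_diff:
  assumes "weighted_L2 F" "weighted_L2 G" shows "weighted_L2 (\<lambda>x. F x - G x)"
  using weighted_L2_add[OF assms(1) weighted_L2_scaleR(1)[OF assms(2), of "-1"]] by simp

text \<open>Uniform convexity of the weighted norm. It makes a midpoint no more expensive than the
  worse endpoint, and it turns nearly minimal elements of a family closed under midpoints into a
  Cauchy sequence.\<close>

lemma kinetic_parallelogram:
  assumes "weighted_L2 F" "weighted_L2 G"
  shows "kinetic (\<lambda>x. F x - G x) + 4 * kinetic (\<lambda>x. (1/2) *\<^sub>R (F x + G x)) = 2 * kinetic F + 2 * kinetic G"
proof -
  have i: "integrable lborel (\<lambda>x. (norm (F x + G x))\<^sup>2 * exp x)" "integrable lborel (\<lambda>x. (norm (F x - G x))\<^sup>2 * exp x)"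
    "integrable lborel (\<lambda>x. (norm (F x))\<^sup>2 * exp x)" "integrable lborel (\<lambda>x. (norm (G x))\<^sup>2 * exp x)"
    using weighted_L2_add[OF assms] weighted_L2_diff[OF assms] assms by (auto simp: weighted_L2_def)
  have "kinetic (\<lambda>x. F x - G x) + kinetic (\<lambda>x. F x + G x) = (LINT x|lborel. (norm (F x - G x))\<^sup>2 * exp x + (norm (F x + G x))\<^sup>2 * exp x)"
    using i by (simp add: kinetic_def)
  also have "\<dots> = (LINT x|lborel. 2 * ((norm (F x))\<^sup>2 * exp x) + 2 * ((norm (G x))\<^sup>2 * exp x))"
    by (intro Bochner_Integration.integral_cong) (auto simp: power2_norm_eq_inner inner_simps inner_commute algebra_simps)
  also have "\<dots> = 2 * kinetic F + 2 * kinetic G" using i by (simp add: kinetic_def)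
  finally show ?thesis using weighted_L2_scaleR(2)[OF weighted_L2_add[OF assms], of "1/2"] by (simp add: power2_eq_square)
qed

lemma weighted_L2_indicator:
  assumes "weighted_L2 G" "S \<in> sets borel" shows "weighted_L2 (\<lambda>x. indicator S x *\<^sub>R G x)"
    and "kinetic (\<lambda>x. indicator S x *\<^sub>R G x) = (LINT x:S|lborel. norm (G x)^2 * exp x)"
    and "set_integrable lborel S (\<lambda>x. norm (G x)^2 * exp x)"
proof -
  note [measurable] = assms(1)[THEN weighted_L2_measurable] assms(2)
  have e: "(norm (indicat_real S x *\<^sub>R G x))^2 * exp x = indicat_real S x *\<^sub>R (norm (G x)^2 * exp x)" for x
    by (auto simp: indicator_def)
  have i: "integrable lborel (\<lambda>x. indicat_real S x *\<^sub>R (norm (G x)^2 * exp x))"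
    by (rule integrable_mult_indicator) (use assms in \<open>auto simp: weighted_L2_def\<close>)
  then show "weighted_L2 (\<lambda>x. indicator S x *\<^sub>R G x)" "set_integrable lborel S (\<lambda>x. norm (G x)^2 * exp x)"
    by (simp_all only: weighted_L2_def e set_integrable_def) (simp_all add: borel_measurable_indicator)
  show "kinetic (\<lambda>x. indicator S x *\<^sub>R G x) = (LINT x:S|lborel. norm (G x)^2 * exp x)"
    by (simp only: kinetic_def e set_lebesgue_integral_def)
qed

text \<open>Factor |G| as (|G| exp (x/2)) exp (-x/2). The integral of (t |G| exp (x/2) - exp
  (-x/2))^2 is a nonnegative quadratic in t, and its discriminant is the inequality; the case t = 1,
  read pointwise, already dominates |G| and gives integrability.\<close>

lemma weighted_cauchy_schwarz:
  assumes G: "weighted_L2 G" and S: "S \<in> sets borel" and e: "set_integrable lborel S (\<lambda>x. exp (- x))"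
  shows "set_integrable lborel S G"
    and "(LINT x:S|lborel. norm (G x))^2 \<le> (LINT x:S|lborel. norm (G x)^2 * exp x) * (LINT x:S|lborel. exp (- x))"
    and "norm (LINT x:S|lborel. G x)^2 \<le> (LINT x:S|lborel. norm (G x)^2 * exp x) * (LINT x:S|lborel. exp (- x))"
proof -
  note [measurable] = G[THEN weighted_L2_measurable] S
  note i2 = weighted_L2_indicator(3)[OF G S]
  have pt: "norm (G x) \<le> norm (G x)^2 * exp x + exp (- x)" for x
  proof -
    have "0 \<le> (norm (G x) * exp (x/2) - exp (-x/2))^2" by simp
    also have "\<dots> = norm (G x)^2 * (exp (x/2) * exp (x/2)) + exp (-x/2) * exp (-x/2) - 2 * norm (G x) * (exp (x/2) * exp (-x/2))"
      by (simp add: power2_eq_square algebra_simps)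
    also have "\<dots> = norm (G x)^2 * exp x + exp (-x) - 2 * norm (G x)" by (simp add: exp_add[symmetric])
    finally show ?thesis using norm_ge_zero[of "G x"] by linarith
  qed
  show si: "set_integrable lborel S G"
  proof (rule set_integrable_bound[OF set_integral_add(1)[OF i2 e]])
    show "set_borel_measurable lborel S G" unfolding set_borel_measurable_def by measurable
    show "AE x in lborel. x \<in> S \<longrightarrow> norm (G x) \<le> norm ((norm (G x))\<^sup>2 * exp x + exp (- x))"
      using pt by (auto simp: abs_of_nonneg)
  qed
  have sn: "set_integrable lborel S (\<lambda>x. norm (G x))" using set_integrable_norm[OF si] .
  define a where "a = (LINT x:S|lborel. norm (G x)^2 * exp x)"
  define b where "b = (LINT x:S|lborel. exp (- x))"
  define n where "n = (LINT x:S|lborel. norm (G x))"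
  have nn: "a \<ge> 0" "b \<ge> 0" "n \<ge> 0"
    by (auto simp: a_def b_def n_def set_lebesgue_integral_def intro!: Bochner_Integration.integral_nonneg)
  have q: "0 \<le> t^2 * a + b - 2 * t * n" for t
  proof -
    have "0 \<le> (LINT x:S|lborel. (t * norm (G x) * exp (x/2) - exp (-x/2))^2)"
      unfolding set_lebesgue_integral_def by (intro Bochner_Integration.integral_nonneg) auto
    also have "\<dots> = (LINT x:S|lborel. t^2 * (norm (G x)^2 * exp x) + exp (-x) - 2 * t * norm (G x))"
    proof (intro set_lebesgue_integral_cong)
      show "\<forall>x. x \<in> S \<longrightarrow> (t * norm (G x) * exp (x/2) - exp (-x/2))^2 = t^2 * (norm (G x)^2 * exp x) + exp (-x) - 2 * t * norm (G x)"
      proof (intro allI impI)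
        fix x
        have "(t * norm (G x) * exp (x/2) - exp (-x/2))^2 = t^2 * (norm (G x)^2 * (exp (x/2) * exp (x/2))) + exp (-x/2) * exp (-x/2) - 2 * t * norm (G x) * (exp (x/2) * exp (-x/2))"
          by (simp add: power2_eq_square algebra_simps)
        then show "(t * norm (G x) * exp (x/2) - exp (-x/2))^2 = t^2 * (norm (G x)^2 * exp x) + exp (-x) - 2 * t * norm (G x)"
          by (simp add: exp_add[symmetric])
      qed
    qed simp
    also have "\<dots> = t^2 * a + b - 2 * t * n"
      using i2 e sn by (simp add: a_def b_def n_def)
    finally show ?thesis .
  qed
  have le: "n^2 \<le> a * b"
  proof (cases "a = 0")
    case True
    have "n = 0"
    proof (rule ccontr)
      \<comment> \<open>With a = 0 the quadratic degenerates to b - 2 t n, and the t used here would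
        give it the value -1.\<close>
      assume "n \<noteq> 0"
      then have "2 * ((b + 1) / (2*n)) * n = b + 1" by (simp add: field_simps)
      with q[of "(b+1)/(2*n)"] True show False by simp
    qed
    then show ?thesis using True by simp
  next
    case False
    then have "(n/a)^2 * a = n^2/a" "2 * (n/a) * n = 2 * (n^2/a)" by (simp_all add: power2_eq_square)
    with q[of "n/a"] have "n^2/a \<le> b" by linarith
    then show ?thesis using False nn by (simp add: field_simps)
  qed
  then show "(LINT x:S|lborel. norm (G x))\<^sup>2 \<le> (LINT x:S|lborel. (norm (G x))\<^sup>2 * exp x) * (LINT x:S|lborel. exp (- x))"
    by (simp add: a_def b_def n_def)
  have "norm (LINT x:S|lborel. G x) \<le> n" using set_integral_norm_bound[OF si] by (simp add: n_def)
  then have "norm (LINT x:S|lborel. G x)^2 \<le> n^2" by (intro power_mono) auto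
  then show "norm (LINT x:S|lborel. G x)^2 \<le> (LINT x:S|lborel. norm (G x)^2 * exp x) * (LINT x:S|lborel. exp (- x))"
    using le by (simp add: a_def b_def)
qed

lemma weighted_set_le_kinetic:
  assumes "weighted_L2 G" "S \<in> sets borel" shows "(LINT x:S|lborel. norm (G x)^2 * exp x) \<le> kinetic G"
  unfolding kinetic_def set_lebesgue_integral_def
  using weighted_L2_indicator(3)[OF assms] assms(1)
  by (intro Bochner_Integration.integral_mono) (auto simp: weighted_L2_def set_integrable_def indicator_def)

text \<open>Integrating backwards from +infinity builds the limit \<open>p\<close> there into the
  encoding and leaves the other end free. With \<open>p = 0\<close> the same map turns derivatives
  into perturbations of a curve.\<close>

definition profile :: "'a::euclidean_space \<Rightarrow> (real \<Rightarrow> 'a) \<Rightarrow> real \<Rightarrow> 'a" where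
  "profile p G x = p - (LINT y:{x..}|lborel. G y)"

lemma weighted_L2_set_integrable:
  assumes "weighted_L2 G"
  shows "set_integrable lborel {a..} G" "set_integrable lborel {a..b} G"
  using weighted_cauchy_schwarz(1)[OF assms _ exp_neg_atLeast(1)[of a]]
  by (auto intro: set_integrable_subset)

lemma profile_diff:
  assumes "weighted_L2 G" "a \<le> b"
  shows "profile p G b - profile p G a = (LINT x:{a..b}|lborel. G x)"
proof -
  have "(LINT x:{a..}|lborel. G x) = (LINT x:{a..b}\<union>{b..}|lborel. G x)"
    by (rule arg_cong[where f="\<lambda>S. set_lebesgue_integral lborel S G"]) (use assms(2) in auto)
  also have "\<dots> = (LINT x:{a..b}|lborel. G x) + (LINT x:{b..}|lborel. G x)"
  proof (rule set_integral_Un_AE)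
    have "AE x in lborel. x \<noteq> b" by (rule AE_lborel_singleton)
    then show "AE x in lborel. \<not> (x \<in> {a..b} \<and> x \<in> {b..})" by eventually_elim auto
  qed (use weighted_L2_set_integrable[OF assms(1)] in auto)
  finally show ?thesis by (simp add: profile_def)
qed

text \<open>Cauchy-Schwarz on {x..}, where exp (-y) has integral exp (-x). This rate decides from
  which x on the curve lies in the ball around \<open>p\<close> where \<open>W\<close> is
  nonnegative.\<close>

lemma profile_bound:
  assumes "weighted_L2 G" shows "norm (profile p G x - p)^2 \<le> kinetic G * exp (- x)"
proof -
  have "norm (profile p G x - p)^2 = norm (LINT y:{x..}|lborel. G y)^2" by (simp add: profile_def)
  also have "\<dots> \<le> (LINT y:{x..}|lborel. norm (G y)^2 * exp y) * exp (- x)"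
    using weighted_cauchy_schwarz(3)[OF assms _ exp_neg_atLeast(1)[of x]] by (simp add: exp_neg_atLeast)
  also have "\<dots> \<le> kinetic G * exp (- x)" by (intro mult_right_mono weighted_set_le_kinetic assms) auto
  finally show ?thesis .
qed

lemma profile_diff_bound:
  assumes "weighted_L2 G" "a \<le> b"
  shows "norm (profile p G b - profile p G a)^2 \<le> (LINT x:{a..b}|lborel. norm (G x)^2 * exp x) * (exp (-a) - exp (-b))"
  using weighted_cauchy_schwarz(3)[OF assms(1) _ exp_neg_Icc(1)[OF assms(2)]]
  by (simp add: profile_diff[OF assms] exp_neg_Icc[OF assms(2)])

text \<open>The modulus depends on \<open>G\<close> only through its kinetic energy, so curves of
  bounded kinetic energy are equicontinuous at each point; the compactness argument rests on
  this.\<close>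

lemma profile_modulus:
  assumes "weighted_L2 G"
  shows "norm (profile p G b - profile p G a)^2 \<le> kinetic G * \<bar>exp (-a) - exp (-b)\<bar>"
proof -
  have *: "norm (profile p G b - profile p G a)^2 \<le> kinetic G * \<bar>exp (-a) - exp (-b)\<bar>" if "a \<le> b" for a b
  proof -
    have "(LINT x:{a..b}|lborel. norm (G x)^2 * exp x) * (exp (-a) - exp (-b)) \<le> kinetic G * (exp (-a) - exp (-b))"
      using that by (intro mult_right_mono weighted_set_le_kinetic assms) auto
    then show ?thesis using profile_diff_bound[OF assms that, of p] that by simp
  qed
  show ?thesis
  proof (cases "a \<le> b")
    case False
    then show ?thesis using *[of b a] by (simp add: norm_minus_commute abs_minus_commute)
  qed (rule *)
qed

lemma tendsto_norm_sq:
  assumes "((\<lambda>x. norm (f x)^2) \<longlongrightarrow> 0) F" shows "((\<lambda>x. norm (f x)) \<longlongrightarrow> 0) F"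
  using tendsto_real_sqrt[OF assms] by (simp only: real_sqrt_abs abs_norm_cancel real_sqrt_zero)

lemma profile_continuous:
  assumes "weighted_L2 G" shows "continuous_on UNIV (profile p G)"
proof (rule continuous_at_imp_continuous_on, rule ballI)
  fix a
  have "((\<lambda>b. kinetic G * \<bar>exp (-a) - exp (-b)\<bar>) \<longlongrightarrow> kinetic G * \<bar>exp (-a) - exp (-a)\<bar>) (at a)"
    by (intro tendsto_intros)
  then have l: "((\<lambda>b. kinetic G * \<bar>exp (-a) - exp (-b)\<bar>) \<longlongrightarrow> 0) (at a)" by simp
  have "((\<lambda>b. norm (profile p G b - profile p G a)^2) \<longlongrightarrow> 0) (at a)"
  proof (rule Lim_null_comparison[OF _ l], rule always_eventually, rule allI)
    show "norm (norm (profile p G b - profile p G a)^2) \<le> kinetic G * \<bar>exp (-a) - exp (-b)\<bar>" for b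
      using profile_modulus[OF assms, of p b a] by simp
  qed
  then have "((\<lambda>b. norm (profile p G b - profile p G a)) \<longlongrightarrow> 0) (at a)"
    by (rule tendsto_norm_sq)
  then show "isCont (profile p G) a"
    unfolding continuous_at by (rule Lim_null[THEN iffD2, OF tendsto_norm_zero_cancel])
qed

lemma profile_tendsto:
  assumes "weighted_L2 G" shows "(profile p G \<longlongrightarrow> p) at_top"
proof -
  have "((\<lambda>x. kinetic G * exp (-x)) \<longlongrightarrow> kinetic G * 0) at_top"
    by (intro tendsto_intros filterlim_compose[OF exp_at_bot filterlim_uminus_at_bot_at_top])
  then have l: "((\<lambda>x. kinetic G * exp (-x)) \<longlongrightarrow> 0) at_top" by simp
  have "((\<lambda>x. norm (profile p G x - p)^2) \<longlongrightarrow> 0) at_top"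
  proof (rule Lim_null_comparison[OF _ l], rule always_eventually, rule allI)
    show "norm (norm (profile p G x - p)^2) \<le> kinetic G * exp (-x)" for x
      using profile_bound[OF assms, of p x] by simp
  qed
  then have "((\<lambda>x. norm (profile p G x - p)) \<longlongrightarrow> 0) at_top"
    by (rule tendsto_norm_sq)
  then show ?thesis by (rule Lim_null[THEN iffD2, OF tendsto_norm_zero_cancel])
qed

section \<open>Compactness\<close>

text \<open>Fatou's lemma for the nonnegative functions f n + D. It is applied to kinetic densities
  with D = 0, and to potential densities with D an integrable bound for the negative part of W (V)
  exp x.\<close>

lemma fatou_upper_bound:
  fixes f :: "nat \<Rightarrow> 'a \<Rightarrow> real"
  assumes f: "\<And>n. integrable M (f n)" and D: "integrable M D" and g[measurable]: "g \<in> borel_measurable M"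
    and lower: "\<And>n x. x \<in> space M \<Longrightarrow> - D x \<le> f n x"
    and lim: "AE x in M. (\<lambda>n. f n x) \<longlonglongrightarrow> g x"
    and c: "\<And>n. integral\<^sup>L M (f n) \<le> c n" "c \<longlonglongrightarrow> C"
  shows "integrable M g" and "integral\<^sup>L M g \<le> C"
proof -
  note [measurable] = f[THEN borel_measurable_integrable] D[THEN borel_measurable_integrable]
  have nn: "AE x in M. 0 \<le> g x + D x"
    using lim AE_space
  proof eventually_elim
    case (elim x)
    have "- D x \<le> g x" by (rule LIMSEQ_le_const[OF elim(1)]) (use lower elim(2) in auto)
    then show ?case by simp
  qed
  have intn: "(\<integral>\<^sup>+x. ennreal (f n x + D x) \<partial>M) = ennreal (integral\<^sup>L M (f n) + integral\<^sup>L M D)" for n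
    by (subst nn_integral_eq_integral) (use f D lower[of _ n] in \<open>auto intro!: AE_I2 simp: field_simps\<close>, smt (verit) lower)
  have ge: "0 \<le> integral\<^sup>L M (f n) + integral\<^sup>L M D" for n
  proof -
    have "0 \<le> integral\<^sup>L M (\<lambda>x. f n x + D x)"
      by (rule integral_nonneg_AE) (use lower[of _ n] in \<open>auto intro!: AE_I2\<close>, smt (verit) lower)
    then show ?thesis using f D by simp
  qed
  have "(\<integral>\<^sup>+x. ennreal (g x + D x) \<partial>M) = (\<integral>\<^sup>+x. liminf (\<lambda>n. ennreal (f n x + D x)) \<partial>M)"
  proof (rule nn_integral_cong_AE)
    show "AE x in M. ennreal (g x + D x) = liminf (\<lambda>n. ennreal (f n x + D x))"
      using lim
    proof eventually_elim
      case (elim x)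
      have "(\<lambda>n. ennreal (f n x + D x)) \<longlonglongrightarrow> ennreal (g x + D x)"
        by (intro tendsto_ennrealI tendsto_intros elim)
      then show ?case by (rule lim_imp_Liminf[OF sequentially_bot, symmetric])
    qed
  qed
  also have "\<dots> \<le> liminf (\<lambda>n. \<integral>\<^sup>+x. ennreal (f n x + D x) \<partial>M)"
    by (rule nn_integral_liminf) measurable
  also have "\<dots> \<le> liminf (\<lambda>n. ennreal (c n + integral\<^sup>L M D))"
    by (rule Liminf_mono) (use c(1) in \<open>auto simp: intn intro!: ennreal_leI always_eventually\<close>)
  also have "\<dots> = ennreal (C + integral\<^sup>L M D)"
    by (rule lim_imp_Liminf[OF sequentially_bot]) (intro tendsto_ennrealI tendsto_intros c(2))
  finally have le: "(\<integral>\<^sup>+x. ennreal (g x + D x) \<partial>M) \<le> ennreal (C + integral\<^sup>L M D)" .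
  have i: "integrable M (\<lambda>x. g x + D x)"
  proof (rule integrableI_nonneg)
    show "(\<integral>\<^sup>+x. ennreal (g x + D x) \<partial>M) < \<infinity>" using le by (auto simp: less_top[symmetric] top_unique)
  qed (use nn in auto)
  then show gi: "integrable M g" using Bochner_Integration.integrable_diff[OF i D] by simp
  have Cn: "0 \<le> C + integral\<^sup>L M D"
  proof (rule LIMSEQ_le_const)
    show "(\<lambda>n. c n + integral\<^sup>L M D) \<longlonglongrightarrow> C + integral\<^sup>L M D" by (intro tendsto_intros c(2))
    show "\<exists>N. \<forall>n\<ge>N. 0 \<le> c n + integral\<^sup>L M D" using ge c(1) by (metis add_right_mono order_trans)
  qed
  have "ennreal (integral\<^sup>L M (\<lambda>x. g x + D x)) \<le> ennreal (C + integral\<^sup>L M D)"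
    using le nn by (subst nn_integral_eq_integral[symmetric]) (auto simp: i)
  then show "integral\<^sup>L M g \<le> C" using Cn gi D by (simp add: ennreal_le_iff)
qed

text \<open>A weak limit in the weighted L2 space is produced as a strong limit of convex
  combinations of tails, as in Mazur's lemma. Repeated midpoints suffice because the parallelogram
  law only sees midpoints; \<open>k\<close> marks the tail, so that pointwise limits of profiles are
  inherited.\<close>

inductive_set midhull :: "(nat \<Rightarrow> real \<Rightarrow> 'a::euclidean_space) \<Rightarrow> nat \<Rightarrow> (real \<Rightarrow> 'a) set"
  for F k where
    base: "k \<le> n \<Longrightarrow> F n \<in> midhull F k"
  | mid: "G \<in> midhull F k \<Longrightarrow> H \<in> midhull F k \<Longrightarrow> (\<lambda>x. (1/2) *\<^sub>R (G x + H x)) \<in> midhull F k"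

lemma midhull_antimono:
  assumes "k \<le> j" "G \<in> midhull F j" shows "G \<in> midhull F k"
  using assms(2) by induction (use assms(1) in \<open>auto intro: midhull.intros\<close>)

lemma midhull_weighted_L2:
  assumes "G \<in> midhull F k" "\<And>n. weighted_L2 (F n)" "\<And>n. kinetic (F n) \<le> C"
  shows "weighted_L2 G \<and> kinetic G \<le> C"
  using assms(1)
proof induction
  case (base n)
  then show ?case using assms by auto
next
  case (mid G H)
  then have w: "weighted_L2 G" "weighted_L2 H" by auto
  have "4 * kinetic (\<lambda>x. (1/2) *\<^sub>R (G x + H x)) \<le> 2 * C + 2 * C"
    using kinetic_parallelogram[OF w] kinetic_nonneg[of "\<lambda>x. G x - H x"] mid.IH by linarith
  then show ?case using weighted_L2_scaleR(1)[OF weighted_L2_add[OF w]] by simp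
qed

lemma profile_midpoint:
  assumes "weighted_L2 G" "weighted_L2 H"
  shows "profile p (\<lambda>x. (1/2) *\<^sub>R (G x + H x)) x = (1/2) *\<^sub>R (profile p G x + profile p H x)"
proof -
  have "p = (1/2) *\<^sub>R p + (1/2) *\<^sub>R p" by (simp add: scaleR_left_distrib[symmetric])
  then show ?thesis
    using assms[THEN weighted_L2_set_integrable(1)] by (simp add: profile_def set_integral_add algebra_simps)
qed

text \<open>Closed balls are convex and the profile is affine in its derivative, so closeness to l
  passes from the tail to every repeated midpoint.\<close>

lemma midhull_profile:
  assumes "G \<in> midhull F k" "\<And>n. weighted_L2 (F n)" "\<And>n. kinetic (F n) \<le> C"
    and "\<And>n. k \<le> n \<Longrightarrow> dist (profile p (F n) x) l \<le> \<epsilon>"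
  shows "dist (profile p G x) l \<le> \<epsilon>"
  using assms(1)
proof induction
  case (base n)
  then show ?case using assms by auto
next
  case (mid G H)
  have w: "weighted_L2 G" "weighted_L2 H" using midhull_weighted_L2[OF _ assms(2,3)] mid.hyps by auto
  have "profile p G x \<in> cball l \<epsilon>" "profile p H x \<in> cball l \<epsilon>" using mid.IH by (auto simp: dist_commute)
  then have "(1/2) *\<^sub>R profile p G x + (1/2) *\<^sub>R profile p H x \<in> cball l \<epsilon>"
    by (intro convexD[OF convex_cball]) auto
  then show ?case by (subst profile_midpoint[OF w]) (simp only: scaleR_right_distrib mem_cball dist_commute)
qed

text \<open>The Riesz-Fischer argument for the weighted norm: a telescoping series gives an almost
  everywhere limit, Fatou bounds its kinetic energy, and termwise integration gives convergence of
  the profiles. In the rate, one factor 4^-i pays for the weight 4^i used below, the other makes the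
  series converge.\<close>

lemma kinetic_cauchy_limit:
  fixes F :: "nat \<Rightarrow> real \<Rightarrow> 'a::euclidean_space"
  assumes F: "\<And>n. weighted_L2 (F n)" and C: "\<And>n. kinetic (F n) \<le> C"
    and D: "\<And>i. kinetic (\<lambda>x. F (Suc i) x - F i x) \<le> (1/4)^i / 4^i"
  obtains G where "weighted_L2 G" "kinetic G \<le> C" "\<And>x. (\<lambda>n. profile p (F n) x) \<longlonglongrightarrow> profile p G x"
proof -
  note [measurable] = F[THEN weighted_L2_measurable]
  define d where "d = (\<lambda>i x. F (Suc i) x - F i x)"
  have dw: "weighted_L2 (d i)" for i unfolding d_def by (intro weighted_L2_diff F)
  note [measurable] = dw[THEN weighted_L2_measurable]
  have di: "integrable lborel (\<lambda>x. norm (d i x)^2 * exp x)" for i using dw by (simp add: weighted_L2_def)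
  have kd: "kinetic (d i) \<le> (1/4)^i / 4^i" for i using D by (simp add: d_def)
  have "(\<integral>\<^sup>+x. (\<Sum>i. ennreal (4^i * (norm (d i x)^2 * exp x))) \<partial>lborel) = (\<Sum>i. \<integral>\<^sup>+x. ennreal (4^i * (norm (d i x)^2 * exp x)) \<partial>lborel)"
    by (rule nn_integral_suminf) measurable
  also have "\<dots> = (\<Sum>i. ennreal (4^i * kinetic (d i)))"
    by (subst nn_integral_eq_integral) (auto simp: di kinetic_def)
  also have "\<dots> \<le> (\<Sum>i. ennreal ((1/4)^i))"
  proof (intro suminf_le ennreal_leI)
    show "4^i * kinetic (d i) \<le> (1/4)^i" for i
      using mult_left_mono[OF kd[of i], of "4^i"] by simp
  qed auto
  also have "\<dots> = ennreal (\<Sum>i. (1/4)^i)"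
    by (rule suminf_ennreal2) (auto intro: summable_geometric)
  finally have fin: "(\<integral>\<^sup>+x. (\<Sum>i. ennreal (4^i * (norm (d i x)^2 * exp x))) \<partial>lborel) \<noteq> \<infinity>"
    by (auto simp: top_unique)
  have "AE x in lborel. (\<Sum>i. ennreal (4^i * (norm (d i x)^2 * exp x))) \<noteq> \<infinity>"
    by (rule nn_integral_PInf_AE[OF _ fin]) measurable
  then have sumd: "AE x in lborel. summable (\<lambda>i. norm (d i x))"
  proof eventually_elim
    case (elim x)
    have s: "summable (\<lambda>i. 4^i * (norm (d i x)^2 * exp x))"
      by (rule summable_suminf_not_top) (use elim in auto)
    have "summable (\<lambda>i. exp (-x) * (4^i * (norm (d i x)^2 * exp x)) + (1/4)^i)"
      by (intro summable_add summable_mult s summable_geometric) auto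
    then show "summable (\<lambda>i. norm (d i x))"
    proof (rule summable_comparison_test'[of _ 0])
      fix i
      \<comment> \<open>Arithmetic-geometric mean of 2^i |d i x| and 2^-i: square summability with
        weight 4^i yields absolute summability.\<close>
      have "0 \<le> (2^i * norm (d i x) - (1/2)^i)^2" by simp
      also have "\<dots> = 4^i * norm (d i x)^2 + (1/4)^i - 2 * norm (d i x) * (2^i * (1/2)^i)"
        by (simp add: power2_eq_square algebra_simps power_mult_distrib[symmetric])
      also have "(2::real)^i * (1/2)^i = 1" by (simp add: power_mult_distrib[symmetric])
      finally have "2 * norm (d i x) \<le> 4^i * norm (d i x)^2 + (1/4)^i" by simp
      moreover have "exp (-x) * (4^i * (norm (d i x)^2 * exp x)) = 4^i * norm (d i x)^2"
        by (simp add: exp_minus)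
      ultimately show "norm (norm (d i x)) \<le> exp (-x) * (4^i * (norm (d i x)^2 * exp x)) + (1/4)^i"
        using norm_ge_zero[of "d i x"] by (simp only: real_norm_def abs_norm_cancel)
    qed
  qed
  define G where "G x = F 0 x + (\<Sum>i. d i x)" for x
  have Gm[measurable]: "G \<in> borel_measurable borel" unfolding G_def by measurable
  have tele: "F n x = F 0 x + (\<Sum>i<n. d i x)" for n x
    by (induction n) (auto simp: d_def)
  have lim: "AE x in lborel. (\<lambda>n. F n x) \<longlonglongrightarrow> G x"
    using sumd
  proof eventually_elim
    case (elim x)
    have "(\<lambda>n. F 0 x + (\<Sum>i<n. d i x)) \<longlonglongrightarrow> F 0 x + (\<Sum>i. d i x)"
      by (intro tendsto_intros summable_LIMSEQ summable_norm_cancel[OF elim])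
    then show ?case by (simp only: tele[symmetric] G_def)
  qed
  have lim2: "AE x in lborel. (\<lambda>n. (norm (F n x))\<^sup>2 * exp x) \<longlonglongrightarrow> (norm (G x))\<^sup>2 * exp x"
    using lim by eventually_elim (intro tendsto_intros)
  have Fi: "integrable lborel (\<lambda>x. norm (F n x)^2 * exp x)" for n using F by (simp add: weighted_L2_def)
  have FC: "(LINT x|lborel. norm (F n x)^2 * exp x) \<le> C" for n using C by (simp add: kinetic_def)
  note kin = fatou_upper_bound[of lborel "\<lambda>n x. norm (F n x)^2 * exp x" "\<lambda>x. 0", OF Fi _ _ _ lim2 FC tendsto_const, simplified]
  have Gw: "weighted_L2 G" using kin(1) Gm by (simp add: weighted_L2_def)
  have "(\<lambda>n. profile p (F n) a) \<longlonglongrightarrow> profile p G a" for a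
  proof -
    have si: "integrable lborel (\<lambda>x. indicator {a..} x *\<^sub>R d i x)" for i
      using weighted_L2_set_integrable(1)[OF dw] by (simp add: set_integrable_def)
    have "(\<lambda>i. LINT x|lborel. indicator {a..} x *\<^sub>R d i x) sums (LINT x|lborel. (\<Sum>i. indicator {a..} x *\<^sub>R d i x))"
    proof (rule sums_integral[OF si])
      show "AE x in lborel. summable (\<lambda>i. norm (indicat_real {a..} x *\<^sub>R d i x))"
        using sumd by eventually_elim (auto simp: summable_mult)
      have "summable (\<lambda>i. exp (-a/2) * (1/2)^i)" by (intro summable_mult summable_geometric) auto
      then show "summable (\<lambda>i. LINT x|lborel. norm (indicat_real {a..} x *\<^sub>R d i x))"
      proof (rule summable_comparison_test'[of _ 0])
        fix i
        have "(LINT x:{a..}|lborel. norm (d i x))^2 \<le> (LINT x:{a..}|lborel. norm (d i x)^2 * exp x) * exp (-a)"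
          using weighted_cauchy_schwarz(2)[OF dw _ exp_neg_atLeast(1)[of a]] by (simp add: exp_neg_atLeast)
        also have "\<dots> \<le> (1/4)^i / 4^i * exp (-a)"
          by (intro mult_right_mono order_trans[OF weighted_set_le_kinetic[OF dw] kd]) auto
        \<comment> \<open>The spare factor 4^-i is discarded; what remains is the square of a
          geometric term, so the L1 norms on {a..} are summable.\<close>
        also have "\<dots> \<le> (1/4)^i * exp (-a)"
          by (intro mult_right_mono) (auto simp: divide_le_eq)
        also have "\<dots> = (exp (-a/2) * (1/2)^i)^2"
          by (simp add: power_mult_distrib power_mult[symmetric] exp_double[symmetric] power_divide)
             (simp add: power_mult mult.commute[of i])
        finally have "(LINT x:{a..}|lborel. norm (d i x)) \<le> exp (-a/2) * (1/2)^i"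
          by (rule power2_le_imp_le) auto
        moreover have "(LINT x|lborel. norm (indicat_real {a..} x *\<^sub>R d i x)) = (LINT x:{a..}|lborel. norm (d i x))"
          by (simp add: set_lebesgue_integral_def)
        moreover have "0 \<le> (LINT x:{a..}|lborel. norm (d i x))"
          unfolding set_lebesgue_integral_def by (rule Bochner_Integration.integral_nonneg) simp
        ultimately show "norm (LINT x|lborel. norm (indicat_real {a..} x *\<^sub>R d i x)) \<le> exp (-a/2) * (1/2)^i"
          by (simp only: real_norm_def abs_of_nonneg)
      qed
    qed
    also have "(LINT x|lborel. (\<Sum>i. indicator {a..} x *\<^sub>R d i x)) = (LINT x:{a..}|lborel. G x - F 0 x)"
      unfolding set_lebesgue_integral_def by (rule Bochner_Integration.integral_cong) (auto simp: indicator_def G_def)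
    also have "\<dots> = (LINT x:{a..}|lborel. G x) - (LINT x:{a..}|lborel. F 0 x)"
      by (intro set_integral_diff(2) weighted_L2_set_integrable Gw F)
    finally have s: "(\<lambda>n. \<Sum>i<n. LINT x:{a..}|lborel. d i x) \<longlonglongrightarrow> (LINT x:{a..}|lborel. G x) - (LINT x:{a..}|lborel. F 0 x)"
      by (simp add: sums_def set_lebesgue_integral_def)
    have "(\<Sum>i<n. LINT x:{a..}|lborel. d i x) = (LINT x:{a..}|lborel. F n x) - (LINT x:{a..}|lborel. F 0 x)" for n
      by (induction n) (auto simp: d_def set_integral_diff weighted_L2_set_integrable F)
    then have "(\<lambda>n. p - (LINT x:{a..}|lborel. F 0 x) - (\<Sum>i<n. LINT x:{a..}|lborel. d i x)) = (\<lambda>n. profile p (F n) a)"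
      by (simp add: profile_def)
    moreover have "(\<lambda>n. p - (LINT x:{a..}|lborel. F 0 x) - (\<Sum>i<n. LINT x:{a..}|lborel. d i x)) \<longlonglongrightarrow>
        p - (LINT x:{a..}|lborel. F 0 x) - ((LINT x:{a..}|lborel. G x) - (LINT x:{a..}|lborel. F 0 x))"
      by (intro tendsto_intros s)
    ultimately show ?thesis by (simp add: profile_def)
  qed
  with that Gw kin(2) show thesis by (auto simp: kinetic_def)
qed

text \<open>Lower semicontinuity, together with the existence of a derivative for the pointwise
  limit \<open>V\<close>. The infima m k over the hulls of tails increase and stay below C; nearly
  minimal elements H k are therefore Cauchy by the parallelogram law, and the limit of a subsequence
  has profile \<open>V\<close>.\<close>

lemma kinetic_weak_limit:
  fixes F :: "nat \<Rightarrow> real \<Rightarrow> 'a::euclidean_space"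
  assumes F: "\<And>n. weighted_L2 (F n)" and C: "\<And>n. kinetic (F n) \<le> C"
    and V: "\<And>x. (\<lambda>n. profile p (F n) x) \<longlonglongrightarrow> V x"
  obtains G where "weighted_L2 G" "kinetic G \<le> C" "\<And>x. profile p G x = V x"
proof -
  note hull = midhull_weighted_L2[OF _ F C]
  define m where "m k = (INF G\<in>midhull F k. kinetic G)" for k
  have ne: "midhull F k \<noteq> {}" for k using midhull.base[of k k F] by blast
  have bdd: "bdd_below (kinetic ` midhull F k)" for k by (rule bdd_belowI2[of _ 0]) (rule kinetic_nonneg)
  have m_le: "m k \<le> kinetic G" if "G \<in> midhull F k" for G k
    unfolding m_def by (rule cINF_lower[OF bdd that])
  have "incseq m"
    unfolding incseq_def m_def
    by (intro allI impI cINF_superset_mono ne bdd) (auto intro: midhull_antimono)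
  moreover have "m k \<le> C" for k using m_le[OF midhull.base[of k k F]] C[of k] by simp
  ultimately obtain l where l: "m \<longlonglongrightarrow> l" "\<And>k. m k \<le> l" using incseq_convergent by metis
  have "\<exists>G\<in>midhull F k. kinetic G < m k + 1 / real (Suc k)" for k
  proof -
    have "(INF G\<in>midhull F k. kinetic G) < m k + 1 / real (Suc k)" by (simp add: m_def)
    then show ?thesis by (subst (asm) cINF_less_iff[OF ne bdd])
  qed
  then obtain H where H: "\<And>k. H k \<in> midhull F k" "\<And>k. kinetic (H k) < m k + 1 / real (Suc k)"
    by metis
  have Hw: "weighted_L2 (H k)" "kinetic (H k) \<le> C" for k using hull[OF H(1)] by auto
  have diff: "kinetic (\<lambda>x. H j x - H k x) \<le> 2 * (l - m k) + 4 / real (Suc k)" if "k \<le> j" for k j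
  proof -
    \<comment> \<open>The midpoint of H j and H k is still in the hull of tail k, so its energy is
      at least m k; in the parallelogram law this leaves little room for the difference.\<close>
    have "(\<lambda>x. (1/2) *\<^sub>R (H j x + H k x)) \<in> midhull F k"
      by (intro midhull.mid H midhull_antimono[OF that])
    then have "4 * m k \<le> 4 * kinetic (\<lambda>x. (1/2) *\<^sub>R (H j x + H k x))" using m_le by simp
    moreover have "1 / real (Suc j) \<le> 1 / real (Suc k)" using that by (simp add: frac_le)
    ultimately show ?thesis
      using kinetic_parallelogram[OF Hw(1)[of j] Hw(1)[of k]] H(2)[of j] H(2)[of k] l(2)[of j]
      by simp
  qed
  have "(\<lambda>k. 2 * (l - m k) + 4 * (1 / real (Suc k))) \<longlonglongrightarrow> 2 * (l - l) + 4 * 0"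
    by (intro tendsto_intros l LIMSEQ_Suc[OF lim_1_over_n])
  then have small: "(\<lambda>k. 2 * (l - m k) + 4 / real (Suc k)) \<longlonglongrightarrow> 0" by simp
  have "\<exists>N. \<forall>k\<ge>N. \<forall>j\<ge>k. kinetic (\<lambda>x. H j x - H k x) \<le> (1/4)^i / 4^i" for i :: nat
  proof -
    have "eventually (\<lambda>k. 2 * (l - m k) + 4 / real (Suc k) < (1/4)^i / 4^i) sequentially"
      by (rule order_tendstoD(2)[OF small]) simp
    then show ?thesis using diff unfolding eventually_sequentially by (meson less_imp_le order_trans)
  qed
  then obtain N where N: "\<And>i k j. N i \<le> k \<Longrightarrow> k \<le> j \<Longrightarrow> kinetic (\<lambda>x. H j x - H k x) \<le> (1/4)^i / 4^i"
    by metis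
  \<comment> \<open>Partial sums make the indices nondecreasing and at least N i; the added 1 also
    forces s i \<ge> i, which sends the tails to infinity.\<close>
  define s where "s i = (\<Sum>j\<le>i. N j + 1)" for i :: nat
  have sN: "N i \<le> s i" "i \<le> s i" for i
  proof -
    show "N i \<le> s i" unfolding s_def by (rule order_trans[OF _ member_le_sum[of i]]) auto
    show "i \<le> s i" by (induction i) (auto simp: s_def)
  qed
  have smono: "s i \<le> s (Suc i)" for i by (simp add: s_def)
  obtain G where G: "weighted_L2 G" "kinetic G \<le> C" "\<And>x. (\<lambda>n. profile p (H (s n)) x) \<longlonglongrightarrow> profile p G x"
    by (rule kinetic_cauchy_limit[of "\<lambda>n. H (s n)" C p]) (use Hw N sN smono in auto)
  have "profile p G x = V x" for x
  proof (rule LIMSEQ_unique[OF G(3)])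
    show "(\<lambda>n. profile p (H (s n)) x) \<longlonglongrightarrow> V x"
    proof (rule metric_LIMSEQ_I)
      fix r :: real assume "0 < r"
      then obtain N0 where N0: "\<And>n. n \<ge> N0 \<Longrightarrow> dist (profile p (F n) x) (V x) < r/2"
        using metric_LIMSEQ_D[OF V, of "r/2" x] by auto
      have "dist (profile p (H (s n)) x) (V x) \<le> r/2" if "n \<ge> N0" for n
        by (rule midhull_profile[OF H(1) F C]) (use N0 sN(2)[of n] that in \<open>auto intro!: less_imp_le\<close>)
      then show "\<exists>N. \<forall>n\<ge>N. dist (profile p (H (s n)) x) (V x) < r" using \<open>0 < r\<close> by (intro exI[of _ N0]) fastforce
    qed
  qed
  with G that show thesis by blast
qed

text \<open>An Arzela-Ascoli argument: a diagonal subsequence converges at all rationals, and the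
  common modulus of continuity carries this to every real point.\<close>

lemma profile_convergent_subsequence:
  fixes F :: "nat \<Rightarrow> real \<Rightarrow> 'a::euclidean_space"
  assumes F: "\<And>n. weighted_L2 (F n)" and C: "\<And>n. kinetic (F n) \<le> 1"
  obtains k V where "strict_mono (k::nat\<Rightarrow>nat)" "\<And>x. (\<lambda>n. profile p (F (k n)) x) \<longlonglongrightarrow> V x"
proof -
  have bound: "norm (profile p (F n) x - p) \<le> exp (- x / 2)" for n x
  proof (rule power2_le_imp_le)
    have "norm (profile p (F n) x - p)^2 \<le> kinetic (F n) * exp (-x)" by (rule profile_bound[OF F])
    also have "\<dots> \<le> 1 * exp (-x)" by (intro mult_right_mono C) auto
    also have "\<dots> = (exp (-x/2))^2" by (simp add: power2_eq_square exp_add[symmetric])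
    finally show "norm (profile p (F n) x - p)^2 \<le> (exp (-x/2))^2" .
  qed simp
  \<comment> \<open>The factor exp (x/2) cancels the bound exp (-x/2) and gives one bound for all
    points, as the diagonal argument wants; it is divided out again below.\<close>
  have "norm (exp (x / 2) *\<^sub>R (profile p (F n) x - p)) \<le> 1" for n x
    using mult_left_mono[OF bound[of n x], of "exp (x/2)"] by (simp add: exp_add[symmetric])
  then obtain k where k: "strict_mono (k::nat\<Rightarrow>nat)"
    "\<And>x. x \<in> \<rat> \<Longrightarrow> \<exists>l. (\<lambda>n. exp (x / 2) *\<^sub>R (profile p (F (k n)) x - p)) \<longlonglongrightarrow> l"
    by (rule function_convergent_subsequence[OF countable_rat, of "\<lambda>n x. exp (x / 2) *\<^sub>R (profile p (F n) x - p)" 1]) blast+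
  have "convergent (\<lambda>n. profile p (F (k n)) x)" if xq: "x \<in> \<rat>" for x
  proof -
    obtain l where "(\<lambda>n. exp (x / 2) *\<^sub>R (profile p (F (k n)) x - p)) \<longlonglongrightarrow> l" using k(2)[OF xq] by auto
    then have "(\<lambda>n. exp (- x / 2) *\<^sub>R (exp (x / 2) *\<^sub>R (profile p (F (k n)) x - p)) + p) \<longlonglongrightarrow> exp (- x / 2) *\<^sub>R l + p"
      by (intro tendsto_intros)
    then show ?thesis by (auto simp: convergent_def exp_add[symmetric] simp del: scaleR_right_diff_distrib)
  qed
  then have rc: "Cauchy (\<lambda>n. profile p (F (k n)) x)" if "x \<in> \<rat>" for x
    using that by (simp add: Cauchy_convergent_iff)
  have "convergent (\<lambda>n. profile p (F (k n)) x)" for x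
  proof -
    have "Cauchy (\<lambda>n. profile p (F (k n)) x)"
    proof (rule metric_CauchyI)
      fix r :: real assume r: "0 < r"
      have "((\<lambda>y. \<bar>exp (-x) - exp (-y)\<bar>) \<longlongrightarrow> \<bar>exp (-x) - exp (-x)\<bar>) (at x)" by (intro tendsto_intros)
      then have "eventually (\<lambda>y. \<bar>exp (-x) - exp (-y)\<bar> < (r/3)^2) (at x)"
        using order_tendstoD(2)[of _ 0 "at x" "(r/3)^2"] r by simp
      then obtain d where d: "d > 0" "\<And>y. y \<noteq> x \<Longrightarrow> dist y x < d \<Longrightarrow> \<bar>exp (-x) - exp (-y)\<bar> < (r/3)^2"
        unfolding eventually_at by auto
      \<comment> \<open>A rational q so close to x that |exp (-x) - exp (-q)|, and with it the
        distance of the values at q and x, is small uniformly in n.\<close>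
      obtain q where q: "q \<in> \<rat>" "x < q" "q < x + d" using Rats_dense_in_real[of x "x+d"] d(1) by auto
      have near: "dist (profile p (F n) q) (profile p (F n) x) < r/3" for n
      proof -
        have "norm (profile p (F n) q - profile p (F n) x)^2 \<le> kinetic (F n) * \<bar>exp (-x) - exp (-q)\<bar>"
          by (rule profile_modulus[OF F])
        also have "\<dots> \<le> 1 * \<bar>exp (-x) - exp (-q)\<bar>" by (intro mult_right_mono C) auto
        also have "\<dots> < (r/3)^2" using d(2)[of q] q by (simp add: dist_real_def)
        finally show ?thesis unfolding dist_norm by (rule power_less_imp_less_base) (use r in simp)
      qed
      obtain M where M: "\<And>m n. m \<ge> M \<Longrightarrow> n \<ge> M \<Longrightarrow> dist (profile p (F (k m)) q) (profile p (F (k n)) q) < r/3"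
        using metric_CauchyD[OF rc[OF q(1)], of "r/3"] r by auto
      have "dist (profile p (F (k m)) x) (profile p (F (k n)) x) < r" if "m \<ge> M" "n \<ge> M" for m n
      proof -
        have "dist (profile p (F (k m)) x) (profile p (F (k n)) x) \<le>
          dist (profile p (F (k m)) q) (profile p (F (k m)) x) + dist (profile p (F (k m)) q) (profile p (F (k n)) q)
          + dist (profile p (F (k n)) q) (profile p (F (k n)) x)" by metric
        then show ?thesis using near[of "k m"] near[of "k n"] M[OF that] by linarith
      qed
      then show "\<exists>M. \<forall>m\<ge>M. \<forall>n\<ge>M. dist (profile p (F (k m)) x) (profile p (F (k n)) x) < r" by blast
    qed
    then show ?thesis by (simp add: Cauchy_convergent_iff)
  qed
  then have "(\<lambda>n. profile p (F (k n)) x) \<longlonglongrightarrow> lim (\<lambda>n. profile p (F (k n)) x)" for x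
    by (simp add: convergent_LIMSEQ_iff)
  then show thesis by (rule that[OF k(1)])
qed

section \<open>Existence of a minimiser\<close>

lemma weighted_L2_translate:
  assumes "weighted_L2 G"
  shows "weighted_L2 (\<lambda>x. G (s + x))" "kinetic (\<lambda>x. G (s + x)) = exp (- s) * kinetic G"
    "profile p (\<lambda>x. G (s + x)) x = profile p G (s + x)"
proof -
  note [measurable] = weighted_L2_measurable[OF assms]
  have e: "norm (G (s + x))^2 * exp x = exp (-s) * (norm (G (s + 1 * x))^2 * exp (s + 1 * x))" for x
    by (simp add: exp_add[symmetric] exp_minus field_simps)
  have i: "integrable lborel (\<lambda>x. norm (G (s + 1 * x))^2 * exp (s + 1 * x))"
    using assms by (subst lborel_integrable_real_affine_iff[of 1]) (auto simp: weighted_L2_def)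
  show "weighted_L2 (\<lambda>x. G (s + x))"
    unfolding weighted_L2_def e using i by (intro conjI integrable_mult_right) measurable
  show "kinetic (\<lambda>x. G (s + x)) = exp (- s) * kinetic G"
    unfolding kinetic_def e using lborel_integral_real_affine[of 1 "\<lambda>x. norm (G x)^2 * exp x" s] by simp
  have "(LINT y|lborel. indicator {s + x..} y *\<^sub>R G y) = (LINT y|lborel. indicator {s + x..} (s + y) *\<^sub>R G (s + y))"
    using lborel_integral_real_affine[of 1 "\<lambda>y. indicator {s + x..} y *\<^sub>R G y" s] by simp
  also have "\<dots> = (LINT y|lborel. indicator {x..} y *\<^sub>R G (s + y))"
    by (rule Bochner_Integration.integral_cong) (auto simp: indicator_def)
  finally show "profile p (\<lambda>x. G (s + x)) x = profile p G (s + x)"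
    by (simp add: profile_def set_lebesgue_integral_def)
qed

text \<open>\<open>q\<close> and \<open>p\<close> stand for a^- and a^+, and \<open>r\<close> for
  r_0. The sign condition on the ball around \<open>p\<close> is what bounds the potential energy
  from below in terms of the kinetic energy.\<close>

locale well_potential =
  fixes W :: "'a::euclidean_space \<Rightarrow> real" and p q :: 'a and r :: real
  assumes W_cont: "continuous_on UNIV W"
    and W_min: "\<And>u. W q \<le> W u"
    and W_q: "W q < 0" and W_p: "W p = 0"
    and r_pos: "0 < r" and W_near: "\<And>u. norm (u - p) \<le> r \<Longrightarrow> 0 \<le> W u"
begin

definition potential :: "(real \<Rightarrow> 'a) \<Rightarrow> real" where
  "potential G = (LINT x|lborel. W (profile p G x) * exp x)"

definition admissible :: "(real \<Rightarrow> 'a) \<Rightarrow> bool" where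
  "admissible G \<longleftrightarrow> weighted_L2 G \<and> integrable lborel (\<lambda>x. W (profile p G x) * exp x)"

lemma W_measurable [measurable]: "W \<in> borel_measurable borel"
  using W_cont by (rule borel_measurable_continuous_onI)

lemma profile_measurable [measurable]: "weighted_L2 G \<Longrightarrow> profile p G \<in> borel_measurable borel"
  by (intro borel_measurable_continuous_onI profile_continuous)

text \<open>ln (K / r^2) is the point from which K exp (-x) \<le> r^2: beyond it the curve lies
  where \<open>W\<close> is nonnegative, before it only the minimum of \<open>W\<close> is
  available.\<close>

lemma potential_density_lower:
  assumes "weighted_L2 G" "kinetic G \<le> K" "0 < K"
  shows "W q * (indicator {..ln (K / r^2)} x * exp x) \<le> W (profile p G x) * exp x"
proof (cases "x \<le> ln (K / r^2)")
  case True
  then show ?thesis using W_min by (simp add: mult_right_mono)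
next
  case False
  have "norm (profile p G x - p)^2 \<le> K * exp (-x)"
    by (rule order_trans[OF profile_bound[OF assms(1)] mult_right_mono[OF assms(2)]]) simp
  also have "\<dots> \<le> r^2"
  proof -
    have "K / r^2 = exp (ln (K / r^2))" using assms(3) r_pos by simp
    also have "\<dots> \<le> exp x" using False by simp
    finally show ?thesis using r_pos by (simp add: exp_minus field_simps)
  qed
  finally have "norm (profile p G x - p) \<le> r" using r_pos by (rule power2_le_imp_le[OF _ less_imp_le])
  then show ?thesis using W_near False by simp
qed

lemma exp_below_integrable:
  "integrable lborel (\<lambda>x. indicat_real {..a} x * exp x)" "(LINT x|lborel. indicat_real {..a} x * exp x) = exp a"
  using exp_atMost[of a] by (simp_all add: set_integrable_def set_lebesgue_integral_def)

text \<open>The integral of exp over {..ln (K / r^2)} is K / r^2. The bound is linear in K, like the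
  kinetic energy itself, which is why the quotient of the two energies is bounded.\<close>

lemma potential_lower:
  assumes "admissible G" "kinetic G \<le> K" "0 < K"
  shows "W q * (K / r^2) \<le> potential G"
proof -
  have "(LINT x|lborel. W q * (indicator {..ln (K / r^2)} x * exp x)) \<le> potential G"
    unfolding potential_def
    by (intro Bochner_Integration.integral_mono integrable_mult_right exp_below_integrable potential_density_lower)
      (use assms in \<open>auto simp: admissible_def\<close>)
  then show ?thesis using assms(3) r_pos by (simp add: exp_below_integrable)
qed

lemma kinetic_pos:
  assumes "admissible G" "potential G < 0" shows "0 < kinetic G"
proof (rule ccontr)
  assume "\<not> 0 < kinetic G"
  \<comment> \<open>If the kinetic energy were 0, every K > 0 could be used in
    \<open>potential_lower\<close>; this one turns its left side into half of the potential
    energy.\<close>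
  define K where "K = - potential G * r^2 / (2 * - W q)"
  have K: "0 < K" unfolding K_def using assms W_q r_pos by (intro divide_pos_pos mult_pos_pos) auto
  have "W q * (K / r^2) \<le> potential G"
    by (rule potential_lower[OF assms(1) _ K]) (use \<open>\<not> 0 < kinetic G\<close> K in auto)
  moreover have "W q * (K / r^2) = potential G / 2" using W_q r_pos by (simp add: K_def field_simps)
  ultimately have "potential G / 2 \<le> potential G" by (simp only:)
  then show False using assms(2) by simp
qed

lemma potential_translate:
  assumes "admissible G"
  shows "admissible (\<lambda>x. G (s + x))" "potential (\<lambda>x. G (s + x)) = exp (- s) * potential G"
proof -
  have w: "weighted_L2 G" using assms by (simp add: admissible_def)
  have e: "W (profile p (\<lambda>x. G (s + x)) x) * exp x = exp (-s) * (W (profile p G (s + 1 * x)) * exp (s + 1 * x))" for x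
    by (simp add: weighted_L2_translate[OF w] exp_add exp_minus)
  have i: "integrable lborel (\<lambda>x. W (profile p G (s + 1 * x)) * exp (s + 1 * x))"
    using assms by (subst lborel_integrable_real_affine_iff[of 1]) (auto simp: admissible_def)
  show "admissible (\<lambda>x. G (s + x))"
    unfolding admissible_def e using i by (intro conjI integrable_mult_right weighted_L2_translate w)
  show "potential (\<lambda>x. G (s + x)) = exp (- s) * potential G"
    unfolding potential_def e using lborel_integral_real_affine[of 1 "\<lambda>x. W (profile p G x) * exp x" s] by simp
qed

lemma ramp:
  assumes \<epsilon>: "0 < \<epsilon>"
  defines "G \<equiv> \<lambda>x. indicator {0..\<epsilon>} x *\<^sub>R ((1/\<epsilon>) *\<^sub>R (p - q))"
  shows "weighted_L2 G" and "x \<le> 0 \<Longrightarrow> profile p G x = q" and "\<epsilon> < x \<Longrightarrow> profile p G x = p"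
    and "profile p G x \<in> closed_segment q p"
proof -
  show w: "weighted_L2 G"
    unfolding weighted_L2_def
  proof
    have "integrable lborel (\<lambda>x. indicator {0..\<epsilon>} x *\<^sub>R ((norm ((1/\<epsilon>) *\<^sub>R (p - q)))^2 * exp x))"
      by (rule borel_integrable_atLeastAtMost'[unfolded set_integrable_def]) (intro continuous_intros)
    moreover have "indicator {0..\<epsilon>} x *\<^sub>R ((norm ((1/\<epsilon>) *\<^sub>R (p - q)))^2 * exp x) = (norm (G x))\<^sup>2 * exp x" for x
      by (simp add: G_def indicator_def)
    ultimately show "integrable lborel (\<lambda>x. (norm (G x))\<^sup>2 * exp x)" by (simp only:)
  qed (simp add: G_def)
  have P: "profile p G x = p - ((\<epsilon> - min \<epsilon> (max 0 x)) / \<epsilon>) *\<^sub>R (p - q)" for x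
  proof -
    have "(LINT y:{x..}|lborel. G y) = (LINT y|lborel. indicator {max 0 x..\<epsilon>} y *\<^sub>R ((1/\<epsilon>) *\<^sub>R (p - q)))"
      unfolding set_lebesgue_integral_def G_def
      by (rule Bochner_Integration.integral_cong) (auto simp: indicator_def)
    also have "\<dots> = measure lborel {max 0 x..\<epsilon>} *\<^sub>R ((1/\<epsilon>) *\<^sub>R (p - q))"
      by (subst integral_scaleR_left) (auto simp: emeasure_lborel_Icc_eq integrable_indicator_iff)
    also have "measure lborel {max 0 x..\<epsilon>} = \<epsilon> - min \<epsilon> (max 0 x)"
      by (cases "max 0 x \<le> \<epsilon>") auto
    finally show ?thesis by (simp add: profile_def)
  qed
  show "x \<le> 0 \<Longrightarrow> profile p G x = q" "\<epsilon> < x \<Longrightarrow> profile p G x = p"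
    using \<epsilon> by (simp_all add: P)
  define t where "t = min \<epsilon> (max 0 x) / \<epsilon>"
  have "profile p G x = (1 - t) *\<^sub>R q + t *\<^sub>R p" "0 \<le> t" "t \<le> 1"
    using \<epsilon> by (simp_all add: P t_def algebra_simps diff_divide_distrib)
  then show "profile p G x \<in> closed_segment q p" by (auto simp: in_segment)
qed

text \<open>The curve waits at \<open>q\<close> on the whole left half line, which contributes W q,
  and then crosses to \<open>p\<close> along a segment in time \<epsilon>, which costs at most a
  multiple of \<epsilon>.\<close>

lemma admissible_negative: "\<exists>G. admissible G \<and> potential G < 0"
proof -
  have "compact (W ` closed_segment q p)"
    by (intro compact_continuous_image continuous_on_subset[OF W_cont]) auto
  then obtain K where K: "0 < K" "\<And>u. u \<in> closed_segment q p \<Longrightarrow> norm (W u) \<le> K"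
    using compact_imp_bounded[THEN bounded_pos[THEN iffD1]] by (metis imageI)
  \<comment> \<open>The crossing costs at most K exp 1 per unit of x, because \<epsilon> \<le> 1;
    the second entry of the minimum keeps the total cost at or below half of the gain - W q.\<close>
  define \<epsilon> where "\<epsilon> = min 1 (- W q / (2 * K * exp 1))"
  have \<epsilon>: "0 < \<epsilon>" "\<epsilon> \<le> 1" "K * exp 1 * \<epsilon> \<le> - W q / 2"
  proof -
    show "0 < \<epsilon>" "\<epsilon> \<le> 1" using K(1) W_q by (simp_all add: \<epsilon>_def field_simps)
    have "\<epsilon> \<le> - W q / (2 * K * exp 1)" by (simp add: \<epsilon>_def)
    then have "K * exp 1 * \<epsilon> \<le> K * exp 1 * (- W q / (2 * K * exp 1))" using K by (intro mult_left_mono) auto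
    also have "\<dots> = - W q / 2" using K by (simp add: field_simps)
    finally show "K * exp 1 * \<epsilon> \<le> - W q / 2" .
  qed
  define G where "G = (\<lambda>x. indicator {0..\<epsilon>} x *\<^sub>R ((1/\<epsilon>) *\<^sub>R (p - q)))"
  note R = ramp[OF \<epsilon>(1), folded G_def]
  note [measurable] = profile_measurable[OF R(1)]
  have sgm: "\<bar>W (profile p G x)\<bar> * exp x \<le> K * exp 1" if "x \<le> \<epsilon>" for x
    using K(2)[OF R(4)[of x]] that \<epsilon> K(1) by (intro mult_mono) auto
  have sgm': "W (profile p G x) * exp x \<le> K * exp 1" if "x \<le> \<epsilon>" for x
    by (rule order_trans[OF mult_right_mono[OF abs_ge_self] sgm[OF that]]) simp
  define U where "U = (\<lambda>x. W q * (indicator {..0} x * exp x) + K * exp 1 * indicator {0..\<epsilon>} x)"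
  have iI: "integrable lborel (\<lambda>x. indicat_real {0..\<epsilon>} x)"
    by (rule integrable_real_indicator) (auto simp: emeasure_lborel_Icc_eq)
  have Ui: "integrable lborel U" unfolding U_def by (intro Bochner_Integration.integrable_add integrable_mult_right exp_below_integrable iI)
  have upper: "W (profile p G x) * exp x \<le> U x" for x
  proof -
    consider "x < 0" | "x = 0" | "0 < x" "x \<le> \<epsilon>" | "\<epsilon> < x" by linarith
    then show ?thesis using sgm'[of x] R(2,3)[of x] W_p \<epsilon> K(1) by cases (auto simp: U_def)
  qed
  have U2: "integrable lborel (\<lambda>x. - W q * (indicator {..0} x * exp x) + K * exp 1 * indicator {0..\<epsilon>} x)"
    by (intro Bochner_Integration.integrable_add integrable_mult_right exp_below_integrable iI)
  have i: "integrable lborel (\<lambda>x. W (profile p G x) * exp x)"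
  proof (rule Bochner_Integration.integrable_bound[OF U2])
    show "AE x in lborel. norm (W (profile p G x) * exp x) \<le> norm (- W q * (indicator {..0} x * exp x) + K * exp 1 * indicator {0..\<epsilon>} x)"
    proof (rule AE_I2)
      fix x :: real
      consider "x < 0" | "x = 0" | "0 < x" "x \<le> \<epsilon>" | "\<epsilon> < x" by linarith
      then show "norm (W (profile p G x) * exp x) \<le> norm (- W q * (indicator {..0} x * exp x) + K * exp 1 * indicator {0..\<epsilon>} x)"
        using sgm[of x] R(2,3)[of x] W_p W_q \<epsilon> K by cases (auto simp: abs_mult abs_of_nonneg)
    qed
  qed measurable
  have "potential G \<le> integral\<^sup>L lborel U"
    unfolding potential_def by (rule Bochner_Integration.integral_mono[OF i Ui upper])
  also have "\<dots> = W q + K * exp 1 * \<epsilon>"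
    unfolding U_def using \<epsilon>
    by (subst Bochner_Integration.integral_add) (auto intro!: integrable_mult_right exp_below_integrable iI simp: exp_below_integrable)
  also have "\<dots> < 0" using \<epsilon> W_q by simp
  finally show ?thesis using R(1) i by (auto simp: admissible_def)
qed

text \<open>\<open>m\<close> is the square of a speed: a positive m qualifies as soon as it lies
  below the quotient - 2 potential G / kinetic G of some admissible curve.\<close>

definition critical_values :: "real set" where
  "critical_values = {m. 0 < m \<and> (\<exists>G. admissible G \<and> m / 2 * kinetic G + potential G < 0)}"

lemma critical_values_nonempty: "critical_values \<noteq> {}"
proof -
  obtain G where G: "admissible G" "potential G < 0" using admissible_negative by blast
  have k: "0 < kinetic G" by (rule kinetic_pos[OF G])
  have "- potential G / kinetic G \<in> critical_values"
    unfolding critical_values_def using G k by (auto intro!: exI[of _ G] divide_neg_pos)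
  then show ?thesis by blast
qed

text \<open>\<open>potential_lower\<close> at K = kinetic G bounds that quotient by - 2 W q /
  r^2.\<close>

lemma critical_values_bounded: "bdd_above critical_values"
proof (rule bdd_aboveI)
  fix m assume "m \<in> critical_values"
  then obtain G where G: "0 < m" "admissible G" "m / 2 * kinetic G + potential G < 0" by (auto simp: critical_values_def)
  have "potential G < 0" using G mult_nonneg_nonneg[of "m / 2", OF _ kinetic_nonneg[of G]] by simp
  from kinetic_pos[OF G(2) this] have k: "0 < kinetic G" .
  have "W q * (kinetic G / r^2) \<le> potential G" by (rule potential_lower[OF G(2) order_refl k])
  then have "(m / 2 + W q / r^2) * kinetic G < 0" using G(3) by (simp add: algebra_simps)
  then show "m \<le> - 2 * W q / r^2" using k by (simp add: mult_less_0_iff)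
qed

text \<open>Translation by \<open>s\<close> multiplies both energies by \<open>exp (- s)\<close>, so the ratio that is maximised is
  translation invariant and a maximising sequence may be normalised to have kinetic energy 1.\<close>

theorem minimiser_exists:
  obtains M G where "0 < M" "Sup critical_values = M" "admissible G" "potential G < 0" "M / 2 * kinetic G + potential G = 0"
    and "\<And>H. admissible H \<Longrightarrow> 0 \<le> M / 2 * kinetic H + potential H"
proof -
  define M where "M = Sup critical_values"
  have upper: "m \<le> M" if "m \<in> critical_values" for m
    unfolding M_def by (rule cSup_upper[OF that critical_values_bounded])
  have M: "0 < M" using critical_values_nonempty upper by (fastforce simp: critical_values_def)
  have minimal: "0 \<le> M / 2 * kinetic H + potential H" if "admissible H" for H
  proof (rule ccontr)
    assume neg: "\<not> 0 \<le> M / 2 * kinetic H + potential H"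
    \<comment> \<open>Were the functional negative at H, raising M by this d would keep it negative,
      against the choice of M as a supremum; the 1 in the denominator covers a vanishing kinetic
      energy.\<close>
    define d where "d = - (M / 2 * kinetic H + potential H) / (kinetic H + 1)"
    have kp: "0 < kinetic H + 1" using kinetic_nonneg[of H] by linarith
    have d: "0 < d" using neg kp by (simp add: d_def)
    have "d * (kinetic H + 1) = - (M / 2 * kinetic H + potential H)" using kp by (simp add: d_def)
    then have "d / 2 * kinetic H + d = - (M / 2 * kinetic H + potential H) - d / 2 * kinetic H" by (simp add: algebra_simps)
    moreover have "0 \<le> d / 2 * kinetic H" using d kinetic_nonneg[of H] by simp
    ultimately have "(M + d) / 2 * kinetic H + potential H < 0" using d by (simp add: algebra_simps add_divide_distrib)
    then have "M + d \<in> critical_values" using M d that by (auto simp: critical_values_def)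
    then show False using upper[of "M + d"] d by simp
  qed
  have "\<exists>G. admissible G \<and> kinetic G = 1 \<and> potential G \<le> - (M - 1 / real (Suc n)) / 2" for n
  proof -
    obtain m where m: "m \<in> critical_values" "M - 1 / real (Suc n) < m"
      using less_cSup_iff[OF critical_values_nonempty critical_values_bounded, of "M - 1 / real (Suc n)"] by (auto simp: M_def)
    then obtain H where H: "0 < m" "admissible H" "m / 2 * kinetic H + potential H < 0" by (auto simp: critical_values_def)
    have "potential H < 0" using H mult_nonneg_nonneg[of "m / 2", OF _ kinetic_nonneg[of H]] by simp
    from kinetic_pos[OF H(2) this] have k: "0 < kinetic H" .
    define s where "s = ln (kinetic H)"
    have es: "exp (- s) = 1 / kinetic H" using k by (simp add: s_def exp_minus inverse_eq_divide)
    have "kinetic (\<lambda>x. H (s + x)) = 1" "potential (\<lambda>x. H (s + x)) = potential H / kinetic H"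
      using k H(2) by (simp_all add: weighted_L2_translate potential_translate admissible_def es)
    moreover have "potential H / kinetic H \<le> - m / 2" using H(3) k by (simp add: field_simps)
    moreover have "- m / 2 \<le> - (M - 1 / real (Suc n)) / 2" using m(2) by simp
    ultimately show ?thesis using potential_translate(1)[OF H(2), of s] by (intro exI[of _ "\<lambda>x. H (s + x)"]) (simp only: simp_thms order_trans)
  qed
  then obtain F where F: "\<And>n. admissible (F n)" "\<And>n. kinetic (F n) = 1" "\<And>n. potential (F n) \<le> - (M - 1 / real (Suc n)) / 2"
    by metis
  have Fw: "weighted_L2 (F n)" for n using F(1) by (simp add: admissible_def)
  obtain k V where k: "strict_mono (k::nat\<Rightarrow>nat)" and V: "\<And>x. (\<lambda>n. profile p (F (k n)) x) \<longlonglongrightarrow> V x"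
    by (rule profile_convergent_subsequence[of F p]) (use Fw F(2) in auto)
  obtain G where G: "weighted_L2 G" "kinetic G \<le> 1" "\<And>x. profile p G x = V x"
    by (rule kinetic_weak_limit[of "\<lambda>n. F (k n)" 1 p V]) (use Fw F(2) V in auto)
  note [measurable] = profile_measurable[OF G(1)]
  have Wlim: "(\<lambda>n. W (profile p (F (k n)) x) * exp x) \<longlonglongrightarrow> W (profile p G x) * exp x" for x
    unfolding G(3) using W_cont by (intro tendsto_intros continuous_on_tendsto_compose[OF W_cont V]) auto
  have clim: "(\<lambda>n. - (M - 1 / real (Suc (k n))) / 2) \<longlonglongrightarrow> - (M - 0) / 2"
    using LIMSEQ_subseq_LIMSEQ[OF LIMSEQ_Suc[OF lim_1_over_n] k] by (intro tendsto_intros) (simp_all add: o_def)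
  have Fi: "integrable lborel (\<lambda>x. W (profile p (F (k n)) x) * exp x)" for n using F(1) by (simp add: admissible_def)
  have Di: "integrable lborel (\<lambda>x. - W q * (indicator {..ln (1 / r^2)} x * exp x))"
    by (intro integrable_mult_right exp_below_integrable)
  have lower: "- (- W q * (indicator {..ln (1 / r^2)} x * exp x)) \<le> W (profile p (F (k n)) x) * exp x" for n x
    using potential_density_lower[OF Fw, of "k n" 1 x] F(2) by simp
  have up: "(LINT x|lborel. W (profile p (F (k n)) x) * exp x) \<le> - (M - 1 / real (Suc (k n))) / 2" for n
    using F(3) by (simp add: potential_def)
  have gm: "(\<lambda>x. W (profile p G x) * exp x) \<in> borel_measurable lborel" by measurable
  note fat = fatou_upper_bound[OF Fi Di gm lower AE_I2[OF Wlim] up clim]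
  have adm: "admissible G" using G(1) fat(1) by (simp add: admissible_def)
  have pot: "potential G \<le> - M / 2" using fat(2) by (simp add: potential_def)
  \<comment> \<open>The limit may have lost kinetic energy. That only lowers the functional, whose
    value is then at most M / 2 - M / 2, while minimality bounds it below by 0.\<close>
  have "M / 2 * kinetic G \<le> M / 2 * 1" using M G(2) by (intro mult_left_mono) auto
  then have "M / 2 * kinetic G + potential G = 0" using pot minimal[OF adm] by simp
  then show thesis using that[OF M _ adm] M_def pot M minimal by simp
qed

end

section \<open>Polarisation, compactly supported perturbations and integration by parts\<close>

lemma weighted_inner_integrable:
  assumes "weighted_L2 F" "weighted_L2 G"
  shows "integrable lborel (\<lambda>x. (F x \<bullet> G x) * exp x)"
proof -
  have "integrable lborel (\<lambda>x. (1/2) * (norm (F x + G x)^2 * exp x - norm (F x)^2 * exp x - norm (G x)^2 * exp x))"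
    using weighted_L2_add[OF assms] assms
    by (intro integrable_mult_right Bochner_Integration.integrable_diff) (auto simp: weighted_L2_def)
  moreover have "(1/2) * (norm (F x + G x)^2 * exp x - norm (F x)^2 * exp x - norm (G x)^2 * exp x) = (F x \<bullet> G x) * exp x" for x
    by (simp add: power2_norm_eq_inner inner_simps inner_commute algebra_simps)
  ultimately show ?thesis by (simp only:)
qed

lemma kinetic_add_scaled:
  assumes "weighted_L2 F" "weighted_L2 G"
  shows "kinetic (\<lambda>x. F x + t *\<^sub>R G x) = kinetic F + 2 * t * (LINT x|lborel. (F x \<bullet> G x) * exp x) + t^2 * kinetic G"
proof -
  have i: "integrable lborel (\<lambda>x. norm (F x)^2 * exp x)" "integrable lborel (\<lambda>x. norm (G x)^2 * exp x)"
    using assms by (auto simp: weighted_L2_def)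
  have "kinetic (\<lambda>x. F x + t *\<^sub>R G x) = (LINT x|lborel. norm (F x)^2 * exp x + 2 * t * ((F x \<bullet> G x) * exp x) + t^2 * (norm (G x)^2 * exp x))"
    unfolding kinetic_def
  proof (rule Bochner_Integration.integral_cong[OF refl])
    fix x
    have "norm (F x + t *\<^sub>R G x)^2 = norm (F x)^2 + 2 * t * (F x \<bullet> G x) + t^2 * norm (G x)^2"
      unfolding power2_norm_eq_inner by (simp add: inner_simps inner_commute power2_eq_square)
    then show "norm (F x + t *\<^sub>R G x)^2 * exp x = norm (F x)^2 * exp x + 2 * t * ((F x \<bullet> G x) * exp x) + t^2 * (norm (G x)^2 * exp x)"
      by (simp add: algebra_simps)
  qed
  also have "\<dots> = kinetic F + 2 * t * (LINT x|lborel. (F x \<bullet> G x) * exp x) + t^2 * kinetic G"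
    unfolding kinetic_def using i weighted_inner_integrable[OF assms] by simp
  finally show ?thesis .
qed

lemma profile_add_scaled:
  assumes "weighted_L2 F" "weighted_L2 G"
  shows "profile p (\<lambda>x. F x + t *\<^sub>R G x) x = profile p F x + t *\<^sub>R profile 0 G x"
proof -
  have "(LINT y:{x..}|lborel. F y + t *\<^sub>R G y) = (LINT y:{x..}|lborel. F y) + t *\<^sub>R (LINT y:{x..}|lborel. G y)"
    using assms[THEN weighted_L2_set_integrable(1), of x] by (subst set_integral_add) auto
  then show ?thesis by (simp add: profile_def)
qed

text \<open>Compactly supported variations, expressed through their derivatives: mean zero is what
  brings the curve back to 0 at \<open>a\<close>.\<close>

lemma profile_local:
  assumes G: "weighted_L2 G" and ab: "a \<le> b" and out: "\<And>x. x \<notin> {a..b} \<Longrightarrow> G x = 0"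
    and mean: "(LINT x:{a..b}|lborel. G x) = 0"
  shows "x \<notin> {a<..<b} \<Longrightarrow> profile 0 G x = 0"
proof -
  have right: "profile 0 G x = 0" if "b < x" for x
  proof -
    have "(LINT y:{x..}|lborel. G y) = (LINT y:{x..}|lborel. 0)"
      by (rule set_lebesgue_integral_cong) (use that out in auto)
    then show ?thesis by (simp add: profile_def)
  qed
  \<comment> \<open>The hypothesis \<open>out\<close> says nothing about G b, so the value of the
    curve at b is obtained from the right by continuity.\<close>
  have b: "profile 0 G b = 0"
  proof -
    have "(profile 0 G \<longlongrightarrow> profile 0 G b) (at_right b)"
      using profile_continuous[OF G, of 0] by (simp add: continuous_on_eq_continuous_at continuous_at filterlim_at_split)
    moreover have "eventually (\<lambda>x. 0 = profile 0 G x) (at_right b)"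
      using right by (auto simp: eventually_at_filter)
    then have "(profile 0 G \<longlongrightarrow> 0) (at_right b)" by (rule Lim_transform_eventually[OF tendsto_const])
    ultimately show ?thesis by (intro tendsto_unique[of "at_right b"]) auto
  qed
  have left: "profile 0 G x = 0" if "x \<le> a" for x
  proof -
    have "profile 0 G b - profile 0 G x = (LINT y:{x..b}|lborel. G y)"
      using that ab by (intro profile_diff G) auto
    also have "\<dots> = (LINT y:{a..b}|lborel. G y)"
      unfolding set_lebesgue_integral_def
      by (rule Bochner_Integration.integral_cong) (use that out in \<open>auto simp: indicator_def\<close>)
    finally show ?thesis using mean b by simp
  qed
  show "x \<notin> {a<..<b} \<Longrightarrow> profile 0 G x = 0"
    using left right b by (cases "x \<le> a"; cases "x = b") auto
qed

text \<open>\<open>G\<close> is only square integrable, so the product V \<bullet> \<Phi> need not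
  be differentiable everywhere. The defect J of the identity on {a..x} has increments bounded by (y
  - x) times a quantity tending to 0, so its derivative vanishes at every point and J is
  constant.\<close>

lemma profile_integration_by_parts:
  fixes \<Phi> :: "real \<Rightarrow> 'a::euclidean_space"
  assumes G: "weighted_L2 G" and ab: "a \<le> b"
    and \<Phi>: "\<And>x. (\<Phi> has_vector_derivative \<phi> x) (at x)" and \<phi>: "continuous_on UNIV \<phi>"
  shows "(LINT x:{a..b}|lborel. G x \<bullet> \<Phi> x) + (LINT x:{a..b}|lborel. profile p G x \<bullet> \<phi> x)
    = profile p G b \<bullet> \<Phi> b - profile p G a \<bullet> \<Phi> a"
proof -
  let ?V = "profile p G"
  note [measurable] = weighted_L2_measurable[OF G]
  have \<Phi>c: "continuous_on UNIV \<Phi>"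
    using \<Phi> by (meson continuous_at_imp_continuous_on has_vector_derivative_continuous)
  have Vc: "continuous_on UNIV ?V" by (rule profile_continuous[OF G])
  have [measurable]: "\<Phi> \<in> borel_measurable borel" using \<Phi>c by (rule borel_measurable_continuous_onI)
  obtain L where L: "0 < L" "\<And>x. x \<in> {a..b} \<Longrightarrow> norm (\<phi> x) \<le> L" "\<And>x. x \<in> {a..b} \<Longrightarrow> norm (\<Phi> x) \<le> L"
  proof -
    have "bounded (\<phi> ` {a..b} \<union> \<Phi> ` {a..b})"
      using compact_continuous_image[OF continuous_on_subset[OF \<phi>], of "{a..b}"] compact_continuous_image[OF continuous_on_subset[OF \<Phi>c], of "{a..b}"]
      by (simp add: compact_imp_bounded)
    then obtain L where "0 < L" "\<And>y. y \<in> \<phi> ` {a..b} \<union> \<Phi> ` {a..b} \<Longrightarrow> norm y \<le> L" unfolding bounded_pos by blast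
    then show thesis by (intro that[of L]) auto
  qed
  have iG: "set_integrable lborel {x..y} G" for x y by (rule weighted_L2_set_integrable[OF G])
  have iGn: "set_integrable lborel {x..y} (\<lambda>s. norm (G s))" for x y using set_integrable_norm[OF iG] .
  have iGF: "set_integrable lborel {x..y} (\<lambda>s. G s \<bullet> \<Phi> s)" if "a \<le> x" "y \<le> b" for x y
  proof (rule set_integrable_bound[OF set_integrable_mult_right[OF _, of L]])
    show "L \<noteq> 0 \<Longrightarrow> set_integrable lborel {x..y} (\<lambda>s. norm (G s))" by (rule iGn)
    show "set_borel_measurable lborel {x..y} (\<lambda>s. G s \<bullet> \<Phi> s)" unfolding set_borel_measurable_def by measurable
    show "AE s in lborel. s \<in> {x..y} \<longrightarrow> norm (G s \<bullet> \<Phi> s) \<le> norm (L * norm (G s))"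
    proof (intro AE_I2 impI)
      fix s assume "s \<in> {x..y}"
      then have "norm (\<Phi> s) \<le> L" using that L(3) by auto
      then have "norm (G s) * norm (\<Phi> s) \<le> norm (G s) * L" by (intro mult_left_mono) auto
      then show "norm (G s \<bullet> \<Phi> s) \<le> norm (L * norm (G s))"
        using Cauchy_Schwarz_ineq2[of "G s" "\<Phi> s"] L(1) by (simp add: mult.commute abs_mult)
    qed
  qed
  have iVf: "set_integrable lborel {x..y} (\<lambda>s. ?V s \<bullet> \<phi> s)" for x y
    by (intro borel_integrable_atLeastAtMost' continuous_intros continuous_on_subset[OF Vc] continuous_on_subset[OF \<phi>]) auto
  have ivf: "set_integrable lborel {x..y} (\<lambda>s. v \<bullet> \<phi> s)" for x y v
    by (intro borel_integrable_atLeastAtMost' continuous_intros continuous_on_subset[OF \<phi>]) auto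
  define m where "m x y = (LINT s:{x..y}|lborel. norm (G s))" for x y
  have m0: "0 \<le> m x y" for x y unfolding m_def set_lebesgue_integral_def by (rule Bochner_Integration.integral_nonneg) auto
  have mono_m: "norm (?V s - ?V x) \<le> m x y" if "x \<le> s" "s \<le> y" for x s y
  proof -
    have "norm (?V s - ?V x) \<le> (LINT u:{x..s}|lborel. norm (G u))"
      unfolding profile_diff[OF G that(1)] by (rule set_integral_norm_bound[OF iG])
    also have "\<dots> \<le> m x y" unfolding m_def set_lebesgue_integral_def
      using iGn[of x s] iGn[of x y] that
      by (intro Bochner_Integration.integral_mono) (auto simp: set_integrable_def indicator_def)
    finally show ?thesis .
  qed
  define J where "J x = ?V x \<bullet> \<Phi> x - (LINT s:{a..x}|lborel. G s \<bullet> \<Phi> s) - (LINT s:{a..x}|lborel. ?V s \<bullet> \<phi> s)" for x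
  have split: "(LINT s:{a..y}|lborel. f s) = (LINT s:{a..x}|lborel. f s) + (LINT s:{x..y}|lborel. f s)"
    if "a \<le> x" "x \<le> y" "set_integrable lborel {a..x} f" "set_integrable lborel {x..y} f" for f :: "real \<Rightarrow> real" and x y
  proof -
    have "{a..y} = {a..x} \<union> {x..y}" using that by auto
    then have "(LINT s:{a..y}|lborel. f s) = (LINT s:{a..x}\<union>{x..y}|lborel. f s)" by simp
    also have "\<dots> = (LINT s:{a..x}|lborel. f s) + (LINT s:{x..y}|lborel. f s)"
    proof (rule set_integral_Un_AE)
      have "AE s in lborel. s \<noteq> x" by (rule AE_lborel_singleton)
      then show "AE s in lborel. \<not> (s \<in> {a..x} \<and> s \<in> {x..y})" by eventually_elim auto
    qed (use that in auto)
    finally show ?thesis .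
  qed
  have est: "norm (J y - J x) \<le> 2 * L * (y - x) * m x y" if xy: "a \<le> x" "x \<le> y" "y \<le> b" for x y
  proof -
    have ftc: "(LINT s:{x..y}|lborel. \<phi> s) = \<Phi> y - \<Phi> x"
      unfolding set_lebesgue_integral_def
      by (rule integral_FTC_Icc[OF xy(2)]) (auto intro: has_vector_derivative_at_within \<Phi> continuous_on_subset[OF \<phi>])
    have iphi: "set_integrable lborel {x..y} \<phi>"
      by (intro borel_integrable_atLeastAtMost' continuous_on_subset[OF \<phi>]) auto
    have 1: "(LINT s:{x..y}|lborel. G s \<bullet> \<Phi> y) = (?V y - ?V x) \<bullet> \<Phi> y"
      unfolding profile_diff[OF G xy(2)] set_lebesgue_integral_def
      using iG[of x y] by (subst integral_inner_left[symmetric]) (auto simp: set_integrable_def)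
    have 2: "(LINT s:{x..y}|lborel. ?V x \<bullet> \<phi> s) = ?V x \<bullet> (\<Phi> y - \<Phi> x)"
      unfolding ftc[symmetric] set_lebesgue_integral_def
      using iphi by (subst integral_inner_right[symmetric]) (auto simp: set_integrable_def)
    have iGy: "set_integrable lborel {x..y} (\<lambda>s. G s \<bullet> \<Phi> y)"
      using integrable_inner_left[of "\<Phi> y" lborel "\<lambda>s. indicator {x..y} s *\<^sub>R G s"] iG[of x y] by (simp add: set_integrable_def)
    have "J y - J x = (?V y \<bullet> \<Phi> y - ?V x \<bullet> \<Phi> x) - (LINT s:{x..y}|lborel. G s \<bullet> \<Phi> s) - (LINT s:{x..y}|lborel. ?V s \<bullet> \<phi> s)"
      unfolding J_def using split[OF xy(1,2) iGF iGF] split[OF xy(1,2) iVf iVf] xy by simp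
    \<comment> \<open>Freezing \<Phi> at y in one integral and V at x in the other reproduces the
      increment of the product exactly; what remains are two freezing errors, each at most L (y - x)
      m x y.\<close>
    also have "?V y \<bullet> \<Phi> y - ?V x \<bullet> \<Phi> x = (LINT s:{x..y}|lborel. G s \<bullet> \<Phi> y) + (LINT s:{x..y}|lborel. ?V x \<bullet> \<phi> s)"
      unfolding 1 2 by (simp add: inner_diff_left inner_diff_right)
    finally have "J y - J x = (LINT s:{x..y}|lborel. G s \<bullet> \<Phi> y - G s \<bullet> \<Phi> s) + (LINT s:{x..y}|lborel. ?V x \<bullet> \<phi> s - ?V s \<bullet> \<phi> s)"
      using iGy iGF[OF xy(1,3)] ivf iVf by (simp add: set_integral_diff)
    moreover have "norm (LINT s:{x..y}|lborel. G s \<bullet> \<Phi> y - G s \<bullet> \<Phi> s) \<le> L * (y - x) * m x y"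
    proof -
      have "norm (LINT s:{x..y}|lborel. G s \<bullet> \<Phi> y - G s \<bullet> \<Phi> s) \<le> (LINT s:{x..y}|lborel. norm (G s \<bullet> \<Phi> y - G s \<bullet> \<Phi> s))"
        by (rule set_integral_norm_bound) (intro set_integral_diff(1) iGy iGF[OF xy(1,3)])
      also have "\<dots> \<le> (LINT s:{x..y}|lborel. L * (y - x) * norm (G s))"
      proof (rule set_integral_mono)
        show "set_integrable lborel {x..y} (\<lambda>s. norm (G s \<bullet> \<Phi> y - G s \<bullet> \<Phi> s))"
          by (rule set_integrable_norm) (intro set_integral_diff(1) iGy iGF[OF xy(1,3)])
        show "set_integrable lborel {x..y} (\<lambda>s. L * (y - x) * norm (G s))" using iGn by simp
        fix s assume s: "s \<in> {x..y}"
        have "norm (\<Phi> y - \<Phi> s) \<le> L * norm (y - s)"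
        proof (rule differentiable_bound[of "{x..y}" \<Phi> "\<lambda>x h. h *\<^sub>R \<phi> x"])
          show "(\<Phi> has_derivative (\<lambda>h. h *\<^sub>R \<phi> u)) (at u within {x..y})" for u
            using \<Phi> by (auto simp: has_vector_derivative_def intro: has_derivative_at_withinI)
          show "onorm (\<lambda>h. h *\<^sub>R \<phi> u) \<le> L" if "u \<in> {x..y}" for u
          proof (rule onorm_le)
            show "norm (h *\<^sub>R \<phi> u) \<le> L * norm h" for h
              using mult_right_mono[OF L(2)[of u], of "norm h"] that xy by (simp add: mult.commute)
          qed
        qed (use s in auto)
        also have "\<dots> \<le> L * (y - x)" using s L by (intro mult_left_mono) auto
        finally have "norm (G s) * norm (\<Phi> y - \<Phi> s) \<le> norm (G s) * (L * (y - x))" by (intro mult_left_mono) auto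
        then show "norm (G s \<bullet> \<Phi> y - G s \<bullet> \<Phi> s) \<le> L * (y - x) * norm (G s)"
          using Cauchy_Schwarz_ineq2[of "G s" "\<Phi> y - \<Phi> s"] by (simp add: inner_diff_right mult.commute mult.left_commute)
      qed
      also have "\<dots> = L * (y - x) * m x y" by (simp add: m_def)
      finally show ?thesis .
    qed
    moreover have "norm (LINT s:{x..y}|lborel. ?V x \<bullet> \<phi> s - ?V s \<bullet> \<phi> s) \<le> L * (y - x) * m x y"
    proof -
      have "norm (LINT s:{x..y}|lborel. ?V x \<bullet> \<phi> s - ?V s \<bullet> \<phi> s) \<le> (LINT s:{x..y}|lborel. norm (?V x \<bullet> \<phi> s - ?V s \<bullet> \<phi> s))"
        by (rule set_integral_norm_bound) (intro set_integral_diff(1) ivf iVf)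
      also have "\<dots> \<le> (LINT s:{x..y}|lborel. L * m x y)"
      proof (rule set_integral_mono)
        show "set_integrable lborel {x..y} (\<lambda>s. norm (?V x \<bullet> \<phi> s - ?V s \<bullet> \<phi> s))"
          by (rule set_integrable_norm) (intro set_integral_diff(1) ivf iVf)
        show "set_integrable lborel {x..y} (\<lambda>s. L * m x y)" by (intro borel_integrable_atLeastAtMost' continuous_intros)
        fix s assume s: "s \<in> {x..y}"
        have "norm (?V s - ?V x) * norm (\<phi> s) \<le> m x y * L"
          using s xy L(2)[of s] m0 by (intro mult_mono mono_m) auto
        then show "norm (?V x \<bullet> \<phi> s - ?V s \<bullet> \<phi> s) \<le> L * m x y"
          using Cauchy_Schwarz_ineq2[of "?V s - ?V x" "\<phi> s"] by (simp add: inner_diff_left mult.commute abs_minus_commute)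
      qed
      also have "\<dots> = L * (y - x) * m x y" using xy by (simp add: set_integral_const set_lebesgue_integral_def)
      finally show ?thesis .
    qed
    ultimately show ?thesis by (simp only: real_norm_def)
  qed
  \<comment> \<open>Absolute continuity of the integral of |G|, made explicit by
    Cauchy-Schwarz.\<close>
  have m_small: "m x y \<le> sqrt (kinetic G * \<bar>exp (- x) - exp (- y)\<bar>)" if "x \<le> y" for x y
  proof (rule real_le_rsqrt)
    have "(m x y)^2 \<le> (LINT s:{x..y}|lborel. norm (G s)^2 * exp s) * (LINT s:{x..y}|lborel. exp (- s))"
      unfolding m_def by (rule weighted_cauchy_schwarz(2)[OF G _ exp_neg_Icc(1)[OF that]]) simp
    also have "\<dots> \<le> kinetic G * (exp (- x) - exp (- y))"
      unfolding exp_neg_Icc(2)[OF that] using that by (intro mult_right_mono weighted_set_le_kinetic G) auto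
    finally show "(m x y)^2 \<le> kinetic G * \<bar>exp (- x) - exp (- y)\<bar>" using that by simp
  qed
  have est2: "norm (J y - J x) \<le> 2 * L * sqrt (kinetic G * \<bar>exp (- x) - exp (- y)\<bar>) * norm (y - x)"
    if "x \<in> {a..b}" "y \<in> {a..b}" for x y
  proof -
    have *: "norm (J y - J x) \<le> 2 * L * sqrt (kinetic G * \<bar>exp (- x) - exp (- y)\<bar>) * (y - x)"
      if "a \<le> x" "x \<le> y" "y \<le> b" for x y
    proof -
      have "2 * L * (y - x) * m x y \<le> 2 * L * (y - x) * sqrt (kinetic G * \<bar>exp (- x) - exp (- y)\<bar>)"
        using that L by (intro mult_left_mono m_small) auto
      then have "norm (J y - J x) \<le> 2 * L * (y - x) * sqrt (kinetic G * \<bar>exp (- x) - exp (- y)\<bar>)"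
        by (rule order_trans[OF est[OF that]])
      then show ?thesis by (simp only: mult_ac)
    qed
    show ?thesis
    proof (cases "x \<le> y")
      case False
      then show ?thesis using *[of y x] that by (simp add: norm_minus_commute abs_minus_commute)
    qed (use *[of x y] that in auto)
  qed
  have "(J has_derivative (\<lambda>h. 0)) (at x within {a..b})" if x: "x \<in> {a..b}" for x
    unfolding has_derivative_within
  proof
    have "((\<lambda>y. 2 * L * sqrt (kinetic G * \<bar>exp (- x) - exp (- y)\<bar>)) \<longlongrightarrow> 2 * L * sqrt (kinetic G * \<bar>exp (- x) - exp (- x)\<bar>)) (at x within {a..b})"
      by (intro tendsto_intros)
    then have l: "((\<lambda>y. 2 * L * sqrt (kinetic G * \<bar>exp (- x) - exp (- y)\<bar>)) \<longlongrightarrow> 0) (at x within {a..b})" by simp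
    show "((\<lambda>y. (1 / norm (y - x)) *\<^sub>R (J y - (J x + 0))) \<longlongrightarrow> 0) (at x within {a..b})"
    proof (rule Lim_null_comparison[OF _ l])
      show "\<forall>\<^sub>F y in at x within {a..b}. norm ((1 / norm (y - x)) *\<^sub>R (J y - (J x + 0))) \<le> 2 * L * sqrt (kinetic G * \<bar>exp (- x) - exp (- y)\<bar>)"
        unfolding eventually_at_filter
      proof (intro always_eventually allI impI)
        fix y assume y: "y \<noteq> x" "y \<in> {a..b}"
        then show "norm ((1 / norm (y - x)) *\<^sub>R (J y - (J x + 0))) \<le> 2 * L * sqrt (kinetic G * \<bar>exp (- x) - exp (- y)\<bar>)"
          using est2[OF x y(2)] by (simp add: divide_le_eq)
      qed
    qed
  qed auto
  then obtain c where "\<And>x. x \<in> {a..b} \<Longrightarrow> J x = c"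
    using has_derivative_zero_constant[of "{a..b}" J] by auto
  then have "J b = J a" using ab by auto
  moreover have "(LINT s:{a..a}|lborel. f s) = 0" for f :: "real \<Rightarrow> real"
    unfolding set_lebesgue_integral_def
  proof (rule integral_eq_zero_AE)
    show "AE x in lborel. indicat_real {a..a} x *\<^sub>R f x = 0"
      using AE_lborel_singleton[of a] by eventually_elim auto
  qed
  ultimately show ?thesis by (simp add: J_def)
qed

section \<open>The Euler-Lagrange equation\<close>

locale smooth_well = well_potential W p q r
  for W :: "'a::euclidean_space \<Rightarrow> real" and p q :: 'a and r :: real +
  fixes DW :: "'a \<Rightarrow> 'a"
  assumes W_deriv: "\<And>u. (W has_derivative (\<lambda>h. DW u \<bullet> h)) (at u)"
    and DW_cont: "continuous_on UNIV DW"
begin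

text \<open>Zero is the only possible minimum: translations multiply the functional by arbitrary
  positive factors, and the constant curve \<open>p\<close> has energy 0.\<close>

definition minimiser :: "real \<Rightarrow> (real \<Rightarrow> 'a) \<Rightarrow> bool" where
  "minimiser M G \<longleftrightarrow> 0 < M \<and> admissible G \<and> M / 2 * kinetic G + potential G = 0
     \<and> (\<forall>H. admissible H \<longrightarrow> 0 \<le> M / 2 * kinetic H + potential H)"

lemma admissible_local:
  assumes G: "admissible G" and H: "weighted_L2 H"
    and out: "\<And>x. x \<notin> {a..b} \<Longrightarrow> profile p H x = profile p G x"
  shows "admissible H"
    and "potential H = potential G + integral {a..b} (\<lambda>x. (W (profile p H x) - W (profile p G x)) * exp x)"
proof -
  have Gw: "weighted_L2 G" using G by (simp add: admissible_def)
  let ?d = "\<lambda>x. (W (profile p H x) - W (profile p G x)) * exp x"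
  have c: "continuous_on UNIV (\<lambda>x. W (profile p K x))" if "weighted_L2 K" for K
    using continuous_on_compose2[OF W_cont profile_continuous[OF that]] by simp
  have d: "set_integrable lborel {a..b} ?d"
    by (intro borel_integrable_atLeastAtMost' continuous_intros continuous_on_subset[OF c[OF H]] continuous_on_subset[OF c[OF Gw]]) auto
  have e: "W (profile p H x) * exp x = W (profile p G x) * exp x + indicator {a..b} x *\<^sub>R ?d x" for x
    using out[of x] by (auto simp: indicator_def algebra_simps)
  have i: "integrable lborel (\<lambda>x. W (profile p G x) * exp x)" "integrable lborel (\<lambda>x. indicator {a..b} x *\<^sub>R ?d x)"
    using G d by (auto simp: admissible_def set_integrable_def)
  show "admissible H"
    unfolding admissible_def e using H i by (intro conjI Bochner_Integration.integrable_add)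
  have "potential H = potential G + (LINT x|lborel. indicator {a..b} x *\<^sub>R ?d x)"
    unfolding potential_def e using i by (rule Bochner_Integration.integral_add)
  then show "potential H = potential G + integral {a..b} ?d"
    using set_borel_integral_eq_integral(2)[OF d] by (simp add: set_lebesgue_integral_def)
qed

text \<open>t = 0 minimises the functional along G + t \<psi>. The kinetic part is an exact
  quadratic in t, and the potential part changes only on {a..b}, where it may be differentiated
  under the integral sign.\<close>

lemma first_variation:
  assumes min: "minimiser M G" and \<psi>: "weighted_L2 \<psi>" and ab: "a \<le> b"
    and out: "\<And>x. x \<notin> {a..b} \<Longrightarrow> \<psi> x = 0" and mean: "(LINT x:{a..b}|lborel. \<psi> x) = 0"
  shows "M * (LINT x|lborel. (G x \<bullet> \<psi> x) * exp x)
    + integral {a..b} (\<lambda>x. (DW (profile p G x) \<bullet> profile 0 \<psi> x) * exp x) = 0"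
proof -
  let ?U = "profile p G" and ?\<phi> = "profile 0 \<psi>"
  have G: "admissible G" "weighted_L2 G" using min by (auto simp: minimiser_def admissible_def)
  have Uc: "continuous_on UNIV ?U" and \<phi>c: "continuous_on UNIV ?\<phi>" using G(2) \<psi> by (auto intro: profile_continuous)
  have \<phi>0: "?\<phi> x = 0" if "x \<notin> {a<..<b}" for x by (rule profile_local[OF \<psi> ab out mean that])
  define I where "I = (LINT x|lborel. (G x \<bullet> \<psi> x) * exp x)"
  define P where "P t = integral (cbox a b) (\<lambda>x. W (?U x + t *\<^sub>R ?\<phi> x) * exp x)" for t
  have Hw: "weighted_L2 (\<lambda>x. G x + t *\<^sub>R \<psi> x)" for t by (intro weighted_L2_add G weighted_L2_scaleR \<psi>)
  have ci: "(\<lambda>x. W (?U x + t *\<^sub>R ?\<phi> x) * exp x) integrable_on cbox a b" for t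
    by (intro integrable_continuous continuous_intros continuous_on_compose2[OF W_cont] continuous_on_subset[OF Uc] continuous_on_subset[OF \<phi>c]) auto
  have energy: "0 \<le> M / 2 * (2 * t * I + t^2 * kinetic \<psi>) + (P t - P 0)" for t
  proof -
    let ?H = "\<lambda>x. G x + t *\<^sub>R \<psi> x"
    have pr: "profile p ?H x = ?U x + t *\<^sub>R ?\<phi> x" for x by (rule profile_add_scaled[OF G(2) \<psi>])
    have loc: "profile p ?H x = ?U x" if "x \<notin> {a..b}" for x
    proof -
      have "x \<notin> {a<..<b}" using that by auto
      from \<phi>0[OF this] show ?thesis by (simp add: pr)
    qed
    note L = admissible_local[OF G(1) Hw loc]
    have "potential ?H = potential G + integral {a..b} (\<lambda>x. (W (?U x + t *\<^sub>R ?\<phi> x) - W (?U x)) * exp x)"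
      using L(2) by (simp only: pr)
    also have "integral {a..b} (\<lambda>x. (W (?U x + t *\<^sub>R ?\<phi> x) - W (?U x)) * exp x) = P t - P 0"
      unfolding P_def left_diff_distrib using ci[of t] ci[of 0]
      by (subst Henstock_Kurzweil_Integration.integral_diff) simp_all
    finally have pot: "potential ?H = potential G + (P t - P 0)" .
    have "0 \<le> M / 2 * kinetic ?H + potential ?H" and z: "M / 2 * kinetic G + potential G = 0"
      using min L(1) unfolding minimiser_def by blast+
    moreover have "M / 2 * kinetic ?H = M / 2 * kinetic G + M / 2 * (2 * t * I + t^2 * kinetic \<psi>)"
      unfolding kinetic_add_scaled[OF G(2) \<psi>] I_def by (simp add: distrib_left)
    ultimately show ?thesis unfolding pot by linarith
  qed
  have "(P has_field_derivative integral (cbox a b) (\<lambda>x. (DW (?U x + 0 *\<^sub>R ?\<phi> x) \<bullet> ?\<phi> x) * exp x)) (at 0 within UNIV)"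
    unfolding P_def
  proof (rule leibniz_rule_field_derivative)
    show "((\<lambda>t. W (?U x + t *\<^sub>R ?\<phi> x) * exp x) has_field_derivative (DW (?U x + t *\<^sub>R ?\<phi> x) \<bullet> ?\<phi> x) * exp x) (at t within UNIV)" for t x
    proof -
      have "((\<lambda>t. W (?U x + t *\<^sub>R ?\<phi> x)) has_derivative (\<lambda>h. DW (?U x + t *\<^sub>R ?\<phi> x) \<bullet> (h *\<^sub>R ?\<phi> x))) (at t)"
        by (rule has_derivative_compose[OF _ W_deriv]) (auto intro!: derivative_eq_intros)
      then have "((\<lambda>t. W (?U x + t *\<^sub>R ?\<phi> x)) has_field_derivative DW (?U x + t *\<^sub>R ?\<phi> x) \<bullet> ?\<phi> x) (at t)"
        by (simp add: has_field_derivative_def mult_commute_abs mult.commute)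
      then show ?thesis by (rule DERIV_cmult_right)
    qed
    show "continuous_on (UNIV \<times> cbox a b) (\<lambda>(t, x). (DW (?U x + t *\<^sub>R ?\<phi> x) \<bullet> ?\<phi> x) * exp x)"
      unfolding split_beta
      by (intro continuous_intros continuous_on_compose2[OF DW_cont] continuous_on_compose2[OF Uc] continuous_on_compose2[OF \<phi>c]) auto
  qed (use ci in auto)
  then have P': "(P has_field_derivative integral {a..b} (\<lambda>x. (DW (?U x) \<bullet> ?\<phi> x) * exp x)) (at 0)" by simp
  have "((\<lambda>t. M / 2 * (2 * t * I + t^2 * kinetic \<psi>) + (P t - P 0)) has_field_derivative
      M / 2 * (2 * I) + integral {a..b} (\<lambda>x. (DW (?U x) \<bullet> ?\<phi> x) * exp x)) (at 0)"
    by (auto intro!: derivative_eq_intros P')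
  then have "M / 2 * (2 * I) + integral {a..b} (\<lambda>x. (DW (?U x) \<bullet> ?\<phi> x) * exp x) = 0"
    by (rule DERIV_local_min[of _ _ _ 1]) (use energy in auto)
  then show ?thesis by (simp add: I_def)
qed

lemma forcing_continuous: "weighted_L2 G \<Longrightarrow> continuous_on UNIV (\<lambda>x. exp x *\<^sub>R DW (profile p G x))"
  by (intro continuous_intros continuous_on_compose2[OF DW_cont profile_continuous]) auto

text \<open>On \<open>{a..b}\<close> the minimiser is compared with the solution \<open>Z\<close> of \<open>M (exp x Z')' = exp x DW (U)\<close>
  with the same boundary values; the first variation in the direction \<open>U - Z\<close> yields \<open>U = Z\<close>.\<close>

lemma minimiser_on_interval:
  assumes min: "minimiser M G" and ab: "a < b"
    and \<Phi>: "\<And>x. (\<Phi> has_vector_derivative exp x *\<^sub>R DW (profile p G x)) (at x)"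
  obtains \<kappa> where "AE x in lborel. x \<in> {a..b} \<longrightarrow> G x = (exp (- x) / M) *\<^sub>R (\<Phi> x + \<kappa>)"
proof -
  let ?U = "profile p G"
  have M: "0 < M" and G: "admissible G" "weighted_L2 G" using min by (auto simp: minimiser_def admissible_def)
  note [measurable] = weighted_L2_measurable[OF G(2)]
  have \<Phi>c: "continuous_on UNIV \<Phi>"
    using \<Phi> by (meson continuous_at_imp_continuous_on has_vector_derivative_continuous)
  have [measurable]: "\<Phi> \<in> borel_measurable borel" using \<Phi>c by (rule borel_measurable_continuous_onI)
  define e where "e = exp (- a) - exp (- b)"
  have e: "0 < e" using ab by (simp add: e_def)
  \<comment> \<open>The constant of integration for which the comparison curve Z has the increment U
    b - U a over {a..b}; \<kappa> enters that increment with the factor e / M.\<close>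
  define \<kappa> where "\<kappa> = (M / e) *\<^sub>R (?U b - ?U a - (LINT x:{a..b}|lborel. (exp (- x) / M) *\<^sub>R \<Phi> x))"
  define Z' where "Z' = (\<lambda>x. (exp (- x) / M) *\<^sub>R (\<Phi> x + \<kappa>))"
  have Z'c: "continuous_on S Z'" for S
    unfolding Z'_def using M by (intro continuous_intros continuous_on_subset[OF \<Phi>c]) auto
  have [measurable]: "Z' \<in> borel_measurable borel" by (rule borel_measurable_continuous_onI[OF Z'c])
  have Z'w: "weighted_L2 (\<lambda>x. indicator {a..b} x *\<^sub>R Z' x)"
    unfolding weighted_L2_def
  proof
    have "set_integrable lborel {a..b} (\<lambda>x. norm (Z' x)^2 * exp x)"
      by (intro borel_integrable_atLeastAtMost' continuous_intros Z'c)
    moreover have "indicator {a..b} x *\<^sub>R (norm (Z' x)^2 * exp x) = (norm (indicat_real {a..b} x *\<^sub>R Z' x))\<^sup>2 * exp x" for x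
      by (simp add: indicator_def)
    ultimately show "integrable lborel (\<lambda>x. (norm (indicat_real {a..b} x *\<^sub>R Z' x))\<^sup>2 * exp x)"
      unfolding set_integrable_def by (simp only:)
  qed measurable
  \<comment> \<open>The derivative of U - Z, extended by 0. The choice of \<kappa> gives it mean
    zero, so it is a legitimate variation.\<close>
  define \<psi> where "\<psi> = (\<lambda>x. indicator {a..b} x *\<^sub>R G x - indicator {a..b} x *\<^sub>R Z' x)"
  have \<psi>: "weighted_L2 \<psi>" unfolding \<psi>_def by (intro weighted_L2_diff Z'w weighted_L2_indicator(1)[OF G(2)]) auto
  note [measurable] = weighted_L2_measurable[OF \<psi>]
  have \<psi>out: "\<psi> x = 0" if "x \<notin> {a..b}" for x using that by (auto simp: \<psi>_def indicator_def)
  have \<psi>in: "\<psi> x = G x - Z' x" if "x \<in> {a..b}" for x using that by (auto simp: \<psi>_def indicator_def)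
  have \<psi>i: "set_integrable lborel {a..b} \<psi>" by (rule weighted_L2_set_integrable[OF \<psi>])
  have "(LINT x:{a..b}|lborel. Z' x) = (LINT x:{a..b}|lborel. (exp (- x) / M) *\<^sub>R \<Phi> x) + (LINT x:{a..b}|lborel. (exp (- x) / M) *\<^sub>R \<kappa>)"
    unfolding Z'_def scaleR_add_right using M
    by (intro set_integral_add borel_integrable_atLeastAtMost' continuous_intros continuous_on_subset[OF \<Phi>c]) auto
  also have "(LINT x:{a..b}|lborel. (exp (- x) / M) *\<^sub>R \<kappa>) = (e / M) *\<^sub>R \<kappa>"
  proof -
    have "set_integrable lborel {a..b} (\<lambda>x. exp (- x) / M)"
      using M by (intro borel_integrable_atLeastAtMost' continuous_intros) auto
    then have "(LINT x:{a..b}|lborel. (exp (- x) / M) *\<^sub>R \<kappa>) = (LINT x:{a..b}|lborel. exp (- x) / M) *\<^sub>R \<kappa>"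
      using integral_scaleR_left[of \<kappa> lborel "\<lambda>x. indicator {a..b} x *\<^sub>R (exp (- x) / M)"]
      by (simp add: set_integrable_def set_lebesgue_integral_def)
    then show ?thesis using exp_neg_Icc(2)[of a b] ab by (simp add: e_def)
  qed
  also have "\<dots> = ?U b - ?U a - (LINT x:{a..b}|lborel. (exp (- x) / M) *\<^sub>R \<Phi> x)"
    using M e by (simp add: \<kappa>_def)
  finally have "(LINT x:{a..b}|lborel. Z' x) = ?U b - ?U a" by simp
  then have mean: "(LINT x:{a..b}|lborel. \<psi> x) = 0"
  proof -
    have "(LINT x:{a..b}|lborel. \<psi> x) = (LINT x:{a..b}|lborel. G x - Z' x)"
      by (rule set_lebesgue_integral_cong) (auto simp: \<psi>in)
    also have "\<dots> = (LINT x:{a..b}|lborel. G x) - (LINT x:{a..b}|lborel. Z' x)"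
      by (intro set_integral_diff weighted_L2_set_integrable[OF G(2)] borel_integrable_atLeastAtMost' Z'c)
    finally show ?thesis using \<open>(LINT x:{a..b}|lborel. Z' x) = ?U b - ?U a\<close> profile_diff[OF G(2), of a b p] ab by simp
  qed
  have fv: "M * (LINT x|lborel. (G x \<bullet> \<psi> x) * exp x)
      + integral {a..b} (\<lambda>x. (DW (?U x) \<bullet> profile 0 \<psi> x) * exp x) = 0"
    by (rule first_variation[OF min \<psi> less_imp_le[OF ab] \<psi>out mean])
  have loc: "profile 0 \<psi> a = 0" "profile 0 \<psi> b = 0"
    by (rule profile_local[OF \<psi> less_imp_le[OF ab] \<psi>out mean]; simp)+
  have ibp: "(LINT x:{a..b}|lborel. \<psi> x \<bullet> \<Phi> x) + (LINT x:{a..b}|lborel. profile 0 \<psi> x \<bullet> (exp x *\<^sub>R DW (?U x))) = 0"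
    using profile_integration_by_parts[OF \<psi> less_imp_le[OF ab] \<Phi> forcing_continuous[OF G(2)], of 0] loc by simp
  have DWc: "continuous_on {a..b} (\<lambda>x. DW (?U x))"
    by (intro continuous_on_compose2[OF DW_cont] continuous_on_subset[OF profile_continuous[OF G(2)]]) auto
  have "(LINT x:{a..b}|lborel. profile 0 \<psi> x \<bullet> (exp x *\<^sub>R DW (?U x))) = integral {a..b} (\<lambda>x. (DW (?U x) \<bullet> profile 0 \<psi> x) * exp x)"
    by (subst set_borel_integral_eq_integral(2))
      (auto intro!: borel_integrable_atLeastAtMost' continuous_intros continuous_on_subset[OF profile_continuous[OF \<psi>]]
        DWc simp: inner_commute mult.commute)
  with ibp fv have *: "(LINT x:{a..b}|lborel. \<psi> x \<bullet> \<Phi> x) = M * (LINT x|lborel. (G x \<bullet> \<psi> x) * exp x)" by simp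
  have i\<kappa>: "integrable lborel (\<lambda>x. (indicator {a..b} x *\<^sub>R \<psi> x) \<bullet> \<kappa>)"
    using \<psi>i unfolding set_integrable_def by (intro integrable_inner_left)
  have i1: "integrable lborel (\<lambda>x. (G x \<bullet> \<psi> x) * exp x)" "integrable lborel (\<lambda>x. ((indicator {a..b} x *\<^sub>R Z' x) \<bullet> \<psi> x) * exp x)"
    by (intro weighted_inner_integrable G \<psi> Z'w)+
  \<comment> \<open>M exp x Z' = \<Phi> + \<kappa> holds exactly, so testing with \<psi> brings back
    the integral of \<psi> \<bullet> \<Phi>, while the \<kappa> term integrates to 0.\<close>
  have Mz: "M * (((indicator {a..b} x *\<^sub>R Z' x) \<bullet> \<psi> x) * exp x) = indicator {a..b} x *\<^sub>R (\<psi> x \<bullet> \<Phi> x) + (indicator {a..b} x *\<^sub>R \<psi> x) \<bullet> \<kappa>" for x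
  proof -
    have "M * (exp (- x) / M) * exp x = 1" using M by (simp add: exp_minus)
    moreover have "M * ((Z' x \<bullet> \<psi> x) * exp x) = (M * (exp (- x) / M) * exp x) * ((\<Phi> x + \<kappa>) \<bullet> \<psi> x)"
      by (simp add: Z'_def mult_ac)
    ultimately have "M * ((Z' x \<bullet> \<psi> x) * exp x) = \<psi> x \<bullet> \<Phi> x + \<psi> x \<bullet> \<kappa>"
      by (simp add: inner_add_right inner_commute)
    then show ?thesis by (simp add: indicator_def)
  qed
  have i2: "integrable lborel (\<lambda>x. indicator {a..b} x *\<^sub>R (\<psi> x \<bullet> \<Phi> x))"
  proof -
    have "integrable lborel (\<lambda>x. M * (((indicator {a..b} x *\<^sub>R Z' x) \<bullet> \<psi> x) * exp x) - (indicator {a..b} x *\<^sub>R \<psi> x) \<bullet> \<kappa>)"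
      by (intro Bochner_Integration.integrable_diff integrable_mult_right i1 i\<kappa>)
    then show ?thesis by (simp only: Mz add_diff_cancel_right')
  qed
  have "M * (LINT x|lborel. ((indicator {a..b} x *\<^sub>R Z' x) \<bullet> \<psi> x) * exp x) = (LINT x|lborel. M * (((indicator {a..b} x *\<^sub>R Z' x) \<bullet> \<psi> x) * exp x))"
    by simp
  also have "\<dots> = (LINT x:{a..b}|lborel. \<psi> x \<bullet> \<Phi> x) + (LINT x:{a..b}|lborel. \<psi> x) \<bullet> \<kappa>"
    unfolding Mz using i2 i\<kappa> \<psi>i by (simp add: set_lebesgue_integral_def set_integrable_def del: inner_scaleR_left)
  also have "\<dots> = M * (LINT x|lborel. (G x \<bullet> \<psi> x) * exp x)" using mean * by simp
  finally have eq: "(LINT x|lborel. ((indicator {a..b} x *\<^sub>R Z' x) \<bullet> \<psi> x) * exp x) = (LINT x|lborel. (G x \<bullet> \<psi> x) * exp x)"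
    using M by simp
  have "kinetic \<psi> = (LINT x|lborel. (G x \<bullet> \<psi> x) * exp x - ((indicator {a..b} x *\<^sub>R Z' x) \<bullet> \<psi> x) * exp x)"
    unfolding kinetic_def power2_norm_eq_inner
    by (rule Bochner_Integration.integral_cong) (auto simp: \<psi>_def indicator_def inner_diff_left inner_diff_right algebra_simps)
  also have "\<dots> = 0" using i1 eq by simp
  finally have "AE x in lborel. norm (\<psi> x)^2 * exp x = 0"
    using \<psi> integral_nonneg_eq_0_iff_AE[of lborel "\<lambda>x. norm (\<psi> x)^2 * exp x"] by (simp add: kinetic_def weighted_L2_def)
  then have "AE x in lborel. x \<in> {a..b} \<longrightarrow> G x = Z' x" by eventually_elim (auto simp: \<psi>in)
  then show thesis using that by (simp add: Z'_def)
qed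

text \<open>On every bounded interval \<open>G\<close> agrees almost everywhere with a function that
  involves \<open>G\<close> only through the continuous profile and is itself differentiable; this
  gain of regularity makes the curve twice differentiable.\<close>

theorem minimiser_euler_lagrange:
  assumes min: "minimiser M G"
  obtains U' U'' where "\<And>x. (profile p G has_vector_derivative U' x) (at x)"
    "\<And>x. (U' has_vector_derivative U'' x) (at x)"
    "\<And>x. M *\<^sub>R (U'' x + U' x) = DW (profile p G x)" "AE x in lborel. G x = U' x"
proof -
  let ?U = "profile p G"
  have M: "0 < M" and G: "admissible G" "weighted_L2 G" using min by (auto simp: minimiser_def admissible_def)
  obtain \<Phi> where \<Phi>: "\<And>x. (\<Phi> has_vector_derivative exp x *\<^sub>R DW (?U x)) (at x)"
    using einterval_antiderivative[of "-\<infinity>" "\<infinity>" "\<lambda>x. exp x *\<^sub>R DW (?U x)"] forcing_continuous[OF G(2)]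
    by (auto simp: continuous_on_eq_continuous_at)
  have \<Phi>c: "continuous_on UNIV \<Phi>"
    using \<Phi> by (meson continuous_at_imp_continuous_on has_vector_derivative_continuous)
  define D where "D \<kappa> x = (exp (- x) / M) *\<^sub>R (\<Phi> x + \<kappa>)" for \<kappa> x
  have Dc: "continuous_on S (D \<kappa>)" for S \<kappa>
    unfolding D_def using M by (intro continuous_intros continuous_on_subset[OF \<Phi>c]) auto
  have D': "(D \<kappa> has_vector_derivative (1 / M) *\<^sub>R DW (?U x) - D \<kappa> x) (at x)" for \<kappa> x
  proof -
    have "((\<lambda>x. exp (- x) / M) has_field_derivative - (exp (- x) / M)) (at x)"
      using M by (auto intro!: derivative_eq_intros)
    from has_vector_derivative_scaleR[OF this has_vector_derivative_add[OF \<Phi> has_vector_derivative_const]]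
    show ?thesis unfolding D_def using M by (simp add: exp_minus field_simps)
  qed
  \<comment> \<open>\<open>Suc n\<close> avoids a degenerate interval at n = 0.\<close>
  have "\<forall>n. \<exists>\<kappa>. AE x in lborel. x \<in> {- real (Suc n)..real (Suc n)} \<longrightarrow> G x = D \<kappa> x"
  proof
    fix n
    have "- real (Suc n) < real (Suc n)" by simp
    then obtain \<kappa> where "AE x in lborel. x \<in> {- real (Suc n)..real (Suc n)} \<longrightarrow> G x = (exp (- x) / M) *\<^sub>R (\<Phi> x + \<kappa>)"
      by (rule minimiser_on_interval[OF min _ \<Phi>])
    then show "\<exists>\<kappa>. AE x in lborel. x \<in> {- real (Suc n)..real (Suc n)} \<longrightarrow> G x = D \<kappa> x"
      unfolding D_def by blast
  qed
  from choice[OF this] obtain \<kappa>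
    where \<kappa>: "\<And>n. AE x in lborel. x \<in> {- real (Suc n)..real (Suc n)} \<longrightarrow> G x = D (\<kappa> n) x" by blast
  have deriv: "(?U has_vector_derivative D (\<kappa> n) x) (at x)" if x: "x \<in> {- real (Suc n)<..<real (Suc n)}" for n x
  proof -
    let ?a = "- real (Suc n)" and ?b = "real (Suc n)"
    have Ueq: "?U y = ?U ?a + integral {?a..y} (D (\<kappa> n))" if y: "y \<in> {?a..?b}" for y
    proof -
      have "?U y - ?U ?a = (LINT s:{?a..y}|lborel. G s)" by (intro profile_diff G) (use y in auto)
      also have "\<dots> = (LINT s:{?a..y}|lborel. D (\<kappa> n) s)"
      proof (rule set_lebesgue_integral_cong_AE)
        show "AE s\<in>{?a..y} in lborel. G s = D (\<kappa> n) s"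
          using \<kappa>[of n]
        proof (rule eventually_mono)
          fix s assume "s \<in> {?a..?b} \<longrightarrow> G s = D (\<kappa> n) s"
          then show "s \<in> {?a..y} \<longrightarrow> G s = D (\<kappa> n) s"
            using y by (metis atLeastAtMost_iff order_trans)
        qed
        show "G \<in> borel_measurable lborel" using weighted_L2_measurable[OF G(2)] by simp
        show "D (\<kappa> n) \<in> borel_measurable lborel" using borel_measurable_continuous_onI[OF Dc] by simp
      qed simp
      also have "\<dots> = integral {?a..y} (D (\<kappa> n))"
        by (intro set_borel_integral_eq_integral borel_integrable_atLeastAtMost' Dc)
      finally show ?thesis by (simp add: algebra_simps)
    qed
    have "((\<lambda>y. ?U ?a + integral {?a..y} (D (\<kappa> n))) has_vector_derivative 0 + D (\<kappa> n) x) (at x within {?a..?b})"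
      using x by (intro has_vector_derivative_add has_vector_derivative_const integral_has_vector_derivative Dc) auto
    then have "((\<lambda>y. ?U ?a + integral {?a..y} (D (\<kappa> n))) has_vector_derivative D (\<kappa> n) x) (at x)"
      using x by (simp add: at_within_Icc_at)
    then show ?thesis
    proof (rule has_vector_derivative_transform_within_open[of _ _ _ "{?a<..<?b}"])
      show "?U ?a + integral {?a..y} (D (\<kappa> n)) = ?U y" if "y \<in> {?a<..<?b}" for y
        by (rule Ueq[symmetric]) (use that in auto)
    qed (use x in auto)
  qed
  \<comment> \<open>Taking U' as the derivative of the curve makes the local formulas D (\<kappa> n)
    agree on overlaps, so the constants \<kappa> n never have to be compared.\<close>
  define U' where "U' x = vector_derivative ?U (at x)" for x
  have U'D: "U' x = D (\<kappa> n) x" if "x \<in> {- real (Suc n)<..<real (Suc n)}" for n x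
    unfolding U'_def using vector_derivative_at[OF deriv[OF that]] .
  have ex: "\<exists>n. x \<in> {- real (Suc n)<..<real (Suc n)}" for x
  proof -
    obtain n where "\<bar>x\<bar> < real n" using reals_Archimedean2 by blast
    then show ?thesis by (intro exI[of _ n]) auto
  qed
  have 1: "(?U has_vector_derivative U' x) (at x)" for x
    using ex[of x] deriv U'D by metis
  have 2: "(U' has_vector_derivative (1 / M) *\<^sub>R DW (?U x) - U' x) (at x)" for x
  proof -
    obtain n where n: "x \<in> {- real (Suc n)<..<real (Suc n)}" using ex by blast
    have "(U' has_vector_derivative (1 / M) *\<^sub>R DW (?U x) - D (\<kappa> n) x) (at x)"
      by (rule has_vector_derivative_transform_within_open[OF D' _ n]) (auto simp: U'D)
    then show ?thesis using U'D[OF n] by simp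
  qed
  have 3: "AE x in lborel. G x = U' x"
  proof -
    have "AE x in lborel. \<forall>n. x \<in> {- real (Suc n)..real (Suc n)} \<longrightarrow> G x = D (\<kappa> n) x"
      using \<kappa> by (simp add: AE_all_countable)
    then show ?thesis
    proof eventually_elim
      case (elim x)
      obtain n where n: "x \<in> {- real (Suc n)<..<real (Suc n)}" using ex by blast
      then show ?case using elim U'D[OF n] by auto
    qed
  qed
  show thesis by (rule that[OF 1 2 _ 3]) (use M in simp)
qed

end

section \<open>Behaviour at minus infinity\<close>

lemma continuous_integral_zero_imp_zero:
  fixes f :: "real \<Rightarrow> real"
  assumes c: "continuous_on UNIV f" and i: "integrable lborel f" and nn: "\<And>x. 0 \<le> f x" and z: "(LINT x|lborel. f x) \<le> 0"
  shows "f x = 0"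
proof -
  have "(LINT x|lborel. f x) = 0" using z Bochner_Integration.integral_nonneg[of lborel f] nn by (simp add: antisym)
  then have ae: "AE x in lborel. f x = 0"
    using integral_nonneg_eq_0_iff_AE[OF i] nn by simp
  have si: "set_integrable lborel {x..x+1} f"
    by (intro borel_integrable_atLeastAtMost' continuous_on_subset[OF c]) auto
  have "(LINT y:{x..x+1}|lborel. f y) = 0"
    unfolding set_lebesgue_integral_def
  proof (rule integral_eq_zero_AE)
    show "AE y in lborel. indicat_real {x..x+1} y *\<^sub>R f y = 0" using ae by eventually_elim simp
  qed
  then have "(f has_integral 0) (cbox x (x+1))"
    using set_borel_integral_eq_integral[OF si] by (simp add: has_integral_iff)
  then show ?thesis
    by (rule has_integral_0_cbox_imp_0[rotated 2]) (use nn in \<open>auto intro: continuous_on_subset[OF c]\<close>)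
qed

text \<open>\<open>K\<close> plays the role of the component of the nonpositive set around a^-. As
  \<open>p\<close> lies off the closed set \<open>K\<close>, the only other point of the nonpositive
  set is isolated from it, and a curve outside \<open>K\<close> can reach the value 0 only at
  \<open>p\<close>.\<close>

locale star_well = smooth_well W p q r DW
  for W :: "'a::euclidean_space \<Rightarrow> real" and p q :: 'a and r :: real and DW :: "'a \<Rightarrow> 'a" +
  fixes K :: "'a set"
  assumes K_convex: "convex K" and K_compact: "compact K" and p_notin_K: "p \<notin> K"
    and W_on_K: "\<And>u. u \<in> K \<Longrightarrow> W u \<le> 0"
    and W_off_K: "\<And>u. u \<notin> K \<Longrightarrow> u \<noteq> p \<Longrightarrow> 0 < W u"
    and radial_K: "\<And>u. u \<in> K \<Longrightarrow> u \<noteq> q \<Longrightarrow> 0 < DW u \<bullet> (u - q)"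
begin

lemma W_off_K_nonneg: "u \<notin> K \<Longrightarrow> 0 \<le> W u"
  using W_off_K[of u] W_p by (cases "u = p") auto

text \<open>Neither energy of \<open>H\<close> exceeds that of \<open>G\<close>, yet
  \<open>G\<close> is minimal, so the potential integrals agree; for continuous integrands that are
  ordered pointwise this means equality everywhere.\<close>

lemma minimiser_comparison:
  assumes min: "minimiser M G" and H: "admissible H" "kinetic H \<le> kinetic G"
    and le: "\<And>x. W (profile p H x) \<le> W (profile p G x)"
  shows "W (profile p H x) = W (profile p G x)"
proof -
  have M: "0 < M" and G: "admissible G" using min by (auto simp: minimiser_def)
  have w: "weighted_L2 G" "weighted_L2 H" using G H by (auto simp: admissible_def)
  let ?f = "\<lambda>x. W (profile p G x) * exp x - W (profile p H x) * exp x"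
  have i: "integrable lborel (\<lambda>x. W (profile p G x) * exp x)" "integrable lborel (\<lambda>x. W (profile p H x) * exp x)"
    using G H by (auto simp: admissible_def)
  have "?f x = 0"
  proof (rule continuous_integral_zero_imp_zero[of ?f])
    show "continuous_on UNIV ?f"
      by (intro continuous_intros continuous_on_compose2[OF W_cont profile_continuous] w) auto
    show "integrable lborel ?f" using i by simp
    show "0 \<le> ?f y" for y using le[of y] by (simp add: mult_right_mono)
    have "M / 2 * kinetic H \<le> M / 2 * kinetic G" using M H(2) by (intro mult_left_mono) auto
    moreover have "M / 2 * kinetic G + potential G = 0" "0 \<le> M / 2 * kinetic H + potential H"
      using min H by (auto simp: minimiser_def)
    ultimately show "(LINT x|lborel. ?f x) \<le> 0" using i by (simp add: potential_def)
  qed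
  then show ?thesis by (simp add: left_diff_distrib[symmetric])
qed

text \<open>Among curves joining the endpoint values on \<open>{a..b}\<close>, the one running through the chord with
  speed proportional to \<open>exp (- x)\<close> has least weighted kinetic energy.\<close>

lemma chord_competitor:
  assumes G: "admissible G" and ab: "a < b"
  obtains H where "admissible H" "kinetic H \<le> kinetic G"
    "\<And>x. x \<notin> {a<..<b} \<Longrightarrow> profile p H x = profile p G x"
    "\<And>x. x \<in> {a..b} \<Longrightarrow> profile p H x \<in> closed_segment (profile p G a) (profile p G b)"
proof -
  let ?U = "profile p G"
  have w: "weighted_L2 G" using G by (simp add: admissible_def)
  note [measurable] = weighted_L2_measurable[OF w]
  define e where "e = exp (- a) - exp (- b)"
  define v where "v = ?U b - ?U a"
  have e: "0 < e" using ab by (simp add: e_def)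
  define S where "S = (\<lambda>x. indicator {a..b} x *\<^sub>R ((exp (- x) / e) *\<^sub>R v))"
  have Sn: "norm (S x)^2 * exp x = (norm v^2 / e^2) * (indicator {a..b} x *\<^sub>R exp (- x))" for x
  proof -
    have "exp (- x) * exp (- x) * exp x = exp (- x)" by (simp add: exp_add[symmetric])
    then show ?thesis using e by (simp add: S_def indicator_def power2_eq_square field_simps)
  qed
  have iexp: "integrable lborel (\<lambda>x. indicat_real {a..b} x *\<^sub>R exp (- x))"
    using exp_neg_Icc(1)[of a b] ab by (simp add: set_integrable_def)
  have Sw: "weighted_L2 S"
    unfolding weighted_L2_def Sn using iexp by (auto simp: S_def)
  have Sk: "kinetic S = norm v^2 / e"
    unfolding kinetic_def Sn using exp_neg_Icc(2)[of a b] ab e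
    by (simp add: set_lebesgue_integral_def e_def[symmetric] power2_eq_square)
  define Q where "Q = (\<lambda>x. indicator (- {a..b}) x *\<^sub>R G x)"
  have Ow: "weighted_L2 Q" unfolding Q_def by (intro weighted_L2_indicator w) auto
  define H where "H = (\<lambda>x. Q x + S x)"
  have Hw: "weighted_L2 H" unfolding H_def by (intro weighted_L2_add Ow Sw)
  have Hn: "norm (H x)^2 * exp x = norm (Q x)^2 * exp x + norm (S x)^2 * exp x" for x
    by (auto simp: H_def Q_def S_def indicator_def)
  have Gn: "norm (G x)^2 * exp x = norm (Q x)^2 * exp x + indicator {a..b} x *\<^sub>R (norm (G x)^2 * exp x)" for x
    by (auto simp: Q_def indicator_def)
  have "kinetic H = kinetic Q + kinetic S"
    unfolding kinetic_def Hn using Ow Sw by (intro Bochner_Integration.integral_add) (auto simp: weighted_L2_def)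
  moreover have "kinetic G = kinetic Q + (LINT x:{a..b}|lborel. norm (G x)^2 * exp x)"
    unfolding kinetic_def set_lebesgue_integral_def
    using Ow weighted_L2_indicator(3)[OF w, of "{a..b}"]
    by (subst Gn, subst Bochner_Integration.integral_add) (auto simp: weighted_L2_def set_integrable_def)
  \<comment> \<open>\<open>S\<close> realises equality in the weighted Cauchy-Schwarz inequality, so
    \<open>profile_diff_bound\<close> says that no curve with displacement v over {a..b} has less
    energy there.\<close>
  moreover have "norm v^2 / e \<le> (LINT x:{a..b}|lborel. norm (G x)^2 * exp x)"
    using profile_diff_bound[OF w, of a b p] ab e by (simp add: v_def e_def[symmetric] divide_le_eq)
  ultimately have kin: "kinetic H \<le> kinetic G" using Sk by simp
  define \<psi> where "\<psi> = (\<lambda>x. H x - G x)"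
  have \<psi>w: "weighted_L2 \<psi>" unfolding \<psi>_def by (intro weighted_L2_diff Hw w)
  have \<psi>out: "\<psi> x = 0" if "x \<notin> {a..b}" for x using that by (auto simp: \<psi>_def H_def Q_def S_def)
  have Sint: "(LINT y:{a..x}|lborel. H y) = ((exp (- a) - exp (- x)) / e) *\<^sub>R v" if "x \<in> {a..b}" for x
  proof -
    have "(LINT y:{a..x}|lborel. H y) = (LINT y|lborel. (indicat_real {a..x} y *\<^sub>R exp (- y)) *\<^sub>R ((1 / e) *\<^sub>R v))"
      unfolding set_lebesgue_integral_def
      by (rule Bochner_Integration.integral_cong) (use that in \<open>auto simp: H_def Q_def S_def indicator_def\<close>)
    also have "\<dots> = (LINT y|lborel. indicat_real {a..x} y *\<^sub>R exp (- y)) *\<^sub>R ((1 / e) *\<^sub>R v)"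
      by (rule integral_scaleR_left) (use exp_neg_Icc(1)[of a x] that in \<open>simp add: set_integrable_def\<close>)
    also have "\<dots> = (exp (- a) - exp (- x)) *\<^sub>R ((1 / e) *\<^sub>R v)"
      using exp_neg_Icc(2)[of a x] that by (simp add: set_lebesgue_integral_def)
    finally show ?thesis by simp
  qed
  have mean: "(LINT x:{a..b}|lborel. \<psi> x) = 0"
    unfolding \<psi>_def using set_integral_diff(2)[OF weighted_L2_set_integrable(2)[OF Hw] weighted_L2_set_integrable(2)[OF w], of a b]
      Sint[of b] profile_diff[OF w, of a b p] ab e by (simp add: v_def e_def)
  have PH: "profile p H x = ?U x + profile 0 \<psi> x" for x
    using profile_add_scaled[OF w \<psi>w, of p 1 x] by (simp add: \<psi>_def)
  have out: "profile p H x = ?U x" if "x \<notin> {a<..<b}" for x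
    using profile_local[OF \<psi>w less_imp_le[OF ab] \<psi>out mean that] by (simp add: PH)
  have seg: "profile p H x \<in> closed_segment (?U a) (?U b)" if x: "x \<in> {a..b}" for x
  proof -
    define t where "t = (exp (- a) - exp (- x)) / e"
    have "profile p H x - profile p H a = t *\<^sub>R v"
      using profile_diff[OF Hw, of a x p] Sint[OF x] x by (simp add: t_def)
    moreover have "profile p H a = ?U a" by (rule out) simp
    ultimately have "profile p H x = (1 - t) *\<^sub>R ?U a + t *\<^sub>R ?U b" by (simp add: v_def algebra_simps)
    moreover have "0 \<le> t" "t \<le> 1" using x e by (simp_all add: t_def e_def)
    ultimately show ?thesis by (auto simp: in_segment)
  qed
  have "profile p H x = profile p G x" if "x \<notin> {a..b}" for x using out[of x] that by auto
  from admissible_local(1)[OF G Hw this] show thesis using that kin out seg by blast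
qed

text \<open>For a curve that never met \<open>K\<close> before b: waiting at its value at b costs no
  kinetic energy, and the potential energy stays finite because exp is integrable at
  -infinity.\<close>

lemma constant_competitor:
  assumes G: "admissible G"
  obtains H where "admissible H" "kinetic H \<le> kinetic G"
    "\<And>x. b \<le> x \<Longrightarrow> profile p H x = profile p G x" "\<And>x. x \<le> b \<Longrightarrow> profile p H x = profile p G b"
proof -
  let ?U = "profile p G"
  have w: "weighted_L2 G" using G by (simp add: admissible_def)
  note [measurable] = profile_measurable[OF w]
  define H where "H = (\<lambda>x. indicator {b..} x *\<^sub>R G x)"
  have Hw: "weighted_L2 H" unfolding H_def by (intro weighted_L2_indicator w) auto
  have kin: "kinetic H \<le> kinetic G"
    unfolding H_def using weighted_L2_indicator(2)[OF w, of "{b..}"] weighted_set_le_kinetic[OF w, of "{b..}"] by simp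
  have 1: "profile p H x = ?U x" if "b \<le> x" for x
  proof -
    have "(LINT y:{x..}|lborel. H y) = (LINT y:{x..}|lborel. G y)"
      by (rule set_lebesgue_integral_cong) (use that in \<open>auto simp: H_def\<close>)
    then show ?thesis by (simp add: profile_def)
  qed
  have 2: "profile p H x = ?U b" if "x \<le> b" for x
  proof -
    have "(LINT y:{x..}|lborel. H y) = (LINT y:{b..}|lborel. G y)"
      unfolding set_lebesgue_integral_def
      by (rule Bochner_Integration.integral_cong) (use that in \<open>auto simp: H_def indicator_def\<close>)
    then show ?thesis by (simp add: profile_def)
  qed
  have e: "W (profile p H x) * exp x = W (?U b) * (indicator {..b} x * exp x) + indicator {b<..} x *\<^sub>R (W (?U x) * exp x)" for x
    using 1[of x] 2[of x] by (cases "x \<le> b") auto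
  have "integrable lborel (\<lambda>x. indicat_real {b<..} x *\<^sub>R (W (?U x) * exp x))"
    by (rule integrable_mult_indicator) (use G in \<open>auto simp: admissible_def\<close>)
  then have "admissible H"
    unfolding admissible_def e by (intro conjI Hw Bochner_Integration.integrable_add integrable_mult_right exp_below_integrable)
  then show thesis using that kin 1 2 by blast
qed

text \<open>During an excursion W \<ge> 0, while the competitor stays in \<open>K\<close>, where W
  \<le> 0. \<open>minimiser_comparison\<close> then demands equality, but W is strictly positive
  somewhere on the excursion. If the curve was in \<open>K\<close> earlier, convexity puts the chord
  in \<open>K\<close>; otherwise the curve is frozen at its entrance point.\<close>

lemma minimiser_stays_in_K:
  assumes min: "minimiser M G" and x0: "profile p G x0 \<in> K" and le: "x1 \<le> x0"
  shows "profile p G x1 \<in> K"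
proof (rule ccontr)
  let ?U = "profile p G"
  assume out: "?U x1 \<notin> K"
  have G: "admissible G" "weighted_L2 G" using min by (auto simp: minimiser_def admissible_def)
  have Uc: "continuous_on S ?U" for S using profile_continuous[OF G(2)] by (rule continuous_on_subset) simp
  have cl: "closed {x. ?U x \<in> K}"
    using continuous_closed_vimage[OF compact_imp_closed[OF K_compact], of ?U] Uc[of UNIV]
    by (simp add: vimage_def continuous_on_eq_continuous_at)
  define b where "b = Inf {x. x1 \<le> x \<and> ?U x \<in> K}"
  have bS: "b \<in> {x. x1 \<le> x \<and> ?U x \<in> K}"
    unfolding b_def
  proof (rule closed_contains_Inf)
    show "closed {x. x1 \<le> x \<and> ?U x \<in> K}" using closed_Int[OF closed_atLeast[of x1] cl] by (simp add: Int_def)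
    show "{x. x1 \<le> x \<and> ?U x \<in> K} \<noteq> {}" using x0 le by blast
  qed (auto intro: bdd_belowI)
  then have b: "x1 < b" "?U b \<in> K" using out by (auto simp: less_le)
  have off1: "?U x \<notin> K" if "x1 \<le> x" "x < b" for x
  proof
    assume "?U x \<in> K"
    then have "b \<le> x" unfolding b_def using that by (intro cInf_lower) (auto intro: bdd_belowI)
    then show False using that by simp
  qed
  \<comment> \<open>Off \<open>K\<close> the value 0 is still possible at \<open>p\<close>. Just
    before b the curve is close to a point of \<open>K\<close>, hence away from \<open>p\<close>,
    and there W is strictly positive.\<close>
  have near: "\<exists>x. x1 < x \<and> x < b \<and> 0 < W (?U x)"
  proof -
    have "?U b \<noteq> p" using b p_notin_K by auto
    moreover have "isCont ?U b" using Uc[of UNIV] by (simp add: continuous_on_eq_continuous_at)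
    ultimately have "eventually (\<lambda>x. ?U x \<noteq> p) (at b)" by (simp add: tendsto_imp_eventually_ne continuous_at)
    then have "eventually (\<lambda>x. ?U x \<noteq> p) (at_left b)" by (simp add: eventually_at_split)
    moreover have "eventually (\<lambda>x. x \<in> {x1<..<b}) (at_left b)" by (rule eventually_at_left_real[OF b(1)])
    ultimately have "eventually (\<lambda>x. ?U x \<noteq> p \<and> x \<in> {x1<..<b}) (at_left b)" by eventually_elim simp
    then obtain x where "?U x \<noteq> p" "x \<in> {x1<..<b}" using eventually_happens trivial_limit_at_left_real by blast
    then show ?thesis using W_off_K[OF off1[of x]] by auto
  qed
  then obtain x where x: "x1 < x" "x < b" "0 < W (?U x)" by blast
  show False
  proof (cases "\<exists>a\<le>x1. ?U a \<in> K")
    case False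
    obtain H where H: "admissible H" "kinetic H \<le> kinetic G" "\<And>x. b \<le> x \<Longrightarrow> profile p H x = ?U x" "\<And>x. x \<le> b \<Longrightarrow> profile p H x = ?U b"
      using constant_competitor[where b=b, OF G(1)] by blast
    have "W (profile p H y) \<le> W (?U y)" for y
    proof (cases "b \<le> y")
      case nb: False
      then have "?U y \<notin> K" using off1[of y] False by (cases "x1 \<le> y") auto
      then show ?thesis using W_off_K_nonneg[of "?U y"] W_on_K[OF b(2)] H(4)[of y] nb by simp
    qed (simp add: H(3))
    from minimiser_comparison[OF min H(1,2) this, of x] show False using x H(4)[of x] W_on_K[OF b(2)] by simp
  next
    case True
    \<comment> \<open>The last time in \<open>K\<close> up to x1, so that {a<..<b} is one maximal
      excursion.\<close>
    define a where "a = Sup {x. x \<le> x1 \<and> ?U x \<in> K}"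
    have "a \<in> {x. x \<le> x1 \<and> ?U x \<in> K}"
      unfolding a_def
    proof (rule closed_contains_Sup)
      show "closed {x. x \<le> x1 \<and> ?U x \<in> K}" using closed_Int[OF closed_atMost[of x1] cl] by (simp add: Int_def)
      show "{x. x \<le> x1 \<and> ?U x \<in> K} \<noteq> {}" using True by blast
    qed (auto intro: bdd_aboveI)
    then have a: "a \<le> x1" "?U a \<in> K" by auto
    have off2: "?U y \<notin> K" if "a < y" "y < b" for y
    proof (cases "x1 \<le> y")
      case False
      show ?thesis
      proof
        assume "?U y \<in> K"
        then have "y \<le> a" unfolding a_def using False by (intro cSup_upper) (auto intro: bdd_aboveI)
        then show False using that by simp
      qed
    qed (use off1 that in auto)
    have ab: "a < b" using a b by simp
    obtain H where H: "admissible H" "kinetic H \<le> kinetic G" "\<And>x. x \<notin> {a<..<b} \<Longrightarrow> profile p H x = ?U x"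
      "\<And>x. x \<in> {a..b} \<Longrightarrow> profile p H x \<in> closed_segment (?U a) (?U b)"
      using chord_competitor[OF G(1) ab] by blast
    have HK: "profile p H y \<in> K" if "y \<in> {a..b}" for y
      using H(4)[OF that] closed_segment_subset[OF a(2) b(2) K_convex] by blast
    have "W (profile p H y) \<le> W (?U y)" for y
    proof (cases "y \<in> {a<..<b}")
      case True
      then show ?thesis using W_off_K_nonneg[OF off2[of y]] W_on_K[OF HK[of y]] by auto
    qed (simp add: H(3))
    from minimiser_comparison[OF min H(1,2) this, of x] show False using x a W_on_K[OF HK[of x]] by simp
  qed
qed

lemma minimiser_enters_K:
  assumes "potential G < 0" shows "\<exists>x. profile p G x \<in> K"
proof (rule ccontr)
  assume "\<nexists>x. profile p G x \<in> K"
  then have "0 \<le> W (profile p G x)" for x using W_off_K_nonneg by blast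
  then have "0 \<le> potential G" unfolding potential_def by (intro Bochner_Integration.integral_nonneg) simp
  then show False using assms by simp
qed

text \<open>With \<open>\<rho> = norm (U - q)^2\<close> the equation gives
  \<open>(exp x \<rho>')' = 2 exp x (norm U'^2 + DW U \<bullet> (U - q) / M) \<ge> 0\<close> as long as \<open>U\<close> is in \<open>K\<close>;
  boundedness of \<open>\<rho>\<close> at \<open>-\<infinity>\<close> then forces \<open>\<rho>' \<ge> 0\<close>.\<close>

lemma solution_tendsto_q:
  fixes U U' U'' :: "real \<Rightarrow> 'a"
  assumes M: "0 < M" and d1: "\<And>x. (U has_vector_derivative U' x) (at x)"
    and d2: "\<And>x. (U' has_vector_derivative U'' x) (at x)"
    and eq: "\<And>x. M *\<^sub>R (U'' x + U' x) = DW (U x)" and K: "\<And>x. x \<le> x0 \<Longrightarrow> U x \<in> K"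
  shows "(U \<longlongrightarrow> q) at_bot"
proof -
  define \<rho> where "\<rho> x = (U x - q) \<bullet> (U x - q)" for x
  define \<rho>' where "\<rho>' x = 2 * ((U x - q) \<bullet> U' x)" for x
  define \<sigma>' where "\<sigma>' x = 2 * exp x * (U' x \<bullet> U' x + (U x - q) \<bullet> DW (U x) / M)" for x
  have D\<rho>: "(\<rho> has_real_derivative \<rho>' x) (at x)" for x
  proof -
    have "((\<lambda>x. (U x - q) \<bullet> (U x - q)) has_derivative (\<lambda>h. (U x - q) \<bullet> (h *\<^sub>R U' x) + (h *\<^sub>R U' x) \<bullet> (U x - q))) (at x)"
      using d1[of x] unfolding has_vector_derivative_def by (auto intro!: derivative_eq_intros)
    then show ?thesis unfolding has_field_derivative_def \<rho>_def[abs_def] \<rho>'_def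
      by (rule has_derivative_eq_rhs) (auto simp: inner_commute)
  qed
  have D\<sigma>: "((\<lambda>x. exp x * \<rho>' x) has_real_derivative \<sigma>' x) (at x)" for x
  proof -
    have "U'' x + U' x = (1 / M) *\<^sub>R DW (U x)" using eq[of x] M by (metis divideR_right inverse_eq_divide less_irrefl)
    then have DW: "(U x - q) \<bullet> DW (U x) / M = (U x - q) \<bullet> U'' x + (U x - q) \<bullet> U' x"
      by (simp add: inner_add_right[symmetric])
    have "((\<lambda>x. exp x * (2 * ((U x - q) \<bullet> U' x))) has_derivative
        (\<lambda>h. exp x * (2 * ((U x - q) \<bullet> (h *\<^sub>R U'' x) + (h *\<^sub>R U' x) \<bullet> U' x)) + (h * exp x) * (2 * ((U x - q) \<bullet> U' x)))) (at x)"
      using d1[of x] d2[of x] unfolding has_vector_derivative_def by (auto intro!: derivative_eq_intros)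
    then show ?thesis unfolding has_field_derivative_def \<rho>'_def \<sigma>'_def DW
      by (rule has_derivative_eq_rhs) (auto simp: algebra_simps)
  qed
  have radial: "0 \<le> (U x - q) \<bullet> DW (U x)" if "x \<le> x0" for x
    using radial_K[OF K[OF that]] by (cases "U x = q") (auto simp: inner_commute less_imp_le)
  have \<sigma>_mono: "exp x * \<rho>' x \<le> exp y * \<rho>' y" if "x \<le> y" "y \<le> x0" for x y
  proof (rule DERIV_nonneg_imp_nondecreasing[OF that(1)])
    fix z assume "x \<le> z" "z \<le> y"
    then have "0 \<le> \<sigma>' z" unfolding \<sigma>'_def using M radial[of z] that by (intro mult_nonneg_nonneg add_nonneg_nonneg divide_nonneg_pos) auto
    then show "\<exists>d. ((\<lambda>x. exp x * \<rho>' x) has_real_derivative d) (at z) \<and> 0 \<le> d" using D\<sigma> by blast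
  qed
  obtain B where B: "\<And>u. u \<in> K \<Longrightarrow> norm (u - q) \<le> B"
  proof -
    have "bounded ((\<lambda>u. u - q) ` K)" using bounded_translation_minus[OF compact_imp_bounded[OF K_compact], of q] .
    then show thesis using that unfolding bounded_iff by blast
  qed
  have \<rho>B: "\<rho> x \<le> B^2" if "x \<le> x0" for x
    using power_mono[OF B[OF K[OF that]], of 2] by (simp add: \<rho>_def power2_norm_eq_inner)
  have \<rho>0: "0 \<le> \<rho> x" for x by (simp add: \<rho>_def)
  have \<rho>'_nonneg: "0 \<le> \<rho>' x1" if x1: "x1 \<le> x0" for x1
  proof (rule ccontr)
    assume neg: "\<not> 0 \<le> \<rho>' x1"
    define k where "k = - \<rho>' x1"
    have k: "0 < k" using neg by (simp add: k_def)
    \<comment> \<open>exp y \<rho>' y stays below the negative value exp x1 \<rho>' x1; dividing by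
      the smaller weight exp y only makes the slope steeper.\<close>
    have slope: "\<rho>' y \<le> - k" if "y \<le> x1" for y
    proof -
      have "exp y * \<rho>' y \<le> exp x1 * \<rho>' x1" by (rule \<sigma>_mono[OF that x1])
      then have "exp y * \<rho>' y \<le> - (exp x1 * k)" by (simp add: k_def)
      also have "\<dots> \<le> - (exp y * k)" using that k by simp
      finally have "exp y * \<rho>' y \<le> exp y * (- k)" by simp
      then show ?thesis by (rule mult_left_le_imp_le) simp
    qed
    \<comment> \<open>Going back this far raises \<rho> by B^2 + 1, above its bound B^2.\<close>
    define z where "z = x1 - (B^2 + 1) / k"
    have z: "z \<le> x1" using k by (simp add: z_def)
    have "\<rho> z + k * z \<ge> \<rho> x1 + k * x1"
    proof (rule DERIV_nonpos_imp_nonincreasing[OF z])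
      fix y assume "z \<le> y" "y \<le> x1"
      moreover have "((\<lambda>y. \<rho> y + k * y) has_real_derivative \<rho>' y + k) (at y)"
        by (auto intro!: derivative_eq_intros D\<rho>)
      ultimately show "\<exists>d. ((\<lambda>y. \<rho> y + k * y) has_real_derivative d) (at y) \<and> d \<le> 0"
        using slope[of y] by (intro exI[of _ "\<rho>' y + k"]) auto
    qed
    moreover have "k * z = k * x1 - (B^2 + 1)" using k by (simp add: z_def field_simps)
    ultimately show False using \<rho>B[of z] \<rho>0[of x1] z x1 by simp
  qed
  have \<rho>_mono: "\<rho> x \<le> \<rho> y" if "x \<le> y" "y \<le> x0" for x y
  proof (rule DERIV_nonneg_imp_nondecreasing[OF that(1)])
    fix z assume "x \<le> z" "z \<le> y"
    then show "\<exists>d. (\<rho> has_real_derivative d) (at z) \<and> 0 \<le> d" using D\<rho> \<rho>'_nonneg[of z] that by auto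
  qed
  \<comment> \<open>If \<rho> stayed above \<epsilon>, compactness would give the radial term a
    positive minimum, hence \<rho> a fixed positive slope all the way to -infinity, and \<rho> would
    become negative.\<close>
  have small: "\<exists>x\<le>x0. \<rho> x < \<epsilon>" if \<epsilon>: "0 < \<epsilon>" for \<epsilon>
  proof (rule ccontr)
    assume "\<not> (\<exists>x\<le>x0. \<rho> x < \<epsilon>)"
    then have ge: "\<epsilon> \<le> \<rho> x" if "x \<le> x0" for x using that by force
    define A where "A = K \<inter> {u. \<epsilon> \<le> (u - q) \<bullet> (u - q)}"
    have "compact A" unfolding A_def
      by (intro compact_Int_closed K_compact closed_Collect_le continuous_intros)
    moreover have UA: "U x \<in> A" if "x \<le> x0" for x using K[OF that] ge[OF that] by (simp add: A_def \<rho>_def)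
    then have "A \<noteq> {}" by blast
    moreover have "continuous_on A (\<lambda>u. (u - q) \<bullet> DW u)"
      by (intro continuous_intros continuous_on_subset[OF DW_cont]) auto
    ultimately obtain u0 where u0: "u0 \<in> A" "\<And>u. u \<in> A \<Longrightarrow> (u0 - q) \<bullet> DW u0 \<le> (u - q) \<bullet> DW u"
      using continuous_attains_inf[of A] by blast
    define \<delta> where "\<delta> = (u0 - q) \<bullet> DW u0 / M"
    have "u0 \<noteq> q" using u0(1) \<epsilon> by (auto simp: A_def)
    then have \<delta>: "0 < \<delta>" using radial_K[of u0] u0(1) M by (auto simp: \<delta>_def A_def inner_commute)
    have slope: "\<delta> \<le> \<rho>' x" if x: "x \<le> x0" for x
    proof -
      \<comment> \<open>Over a step of length ln 2 the weight exp doubles, so the gain 2 \<delta>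
        (exp x - exp y) equals \<delta> exp x, just what the claimed slope requires.\<close>
      define y where "y = x - ln 2"
      have yx: "y \<le> x" by (simp add: y_def)
      have ey: "exp y = exp x / 2" by (simp add: y_def exp_diff)
      have "exp y * \<rho>' y - 2 * \<delta> * exp y \<le> exp x * \<rho>' x - 2 * \<delta> * exp x"
      proof (rule DERIV_nonneg_imp_nondecreasing[OF yx])
        fix z assume z: "y \<le> z" "z \<le> x"
        have "\<delta> \<le> U' z \<bullet> U' z + (U z - q) \<bullet> DW (U z) / M"
          using divide_right_mono[OF u0(2)[OF UA[of z]], of M] M z x by (simp add: \<delta>_def add_increasing)
        then have "2 * exp z * \<delta> \<le> \<sigma>' z" unfolding \<sigma>'_def by (intro mult_left_mono) auto
        moreover have "((\<lambda>x. exp x * \<rho>' x - 2 * \<delta> * exp x) has_real_derivative \<sigma>' z - 2 * \<delta> * exp z) (at z)"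
          by (intro derivative_intros DERIV_cmult DERIV_exp D\<sigma>)
        ultimately show "\<exists>d. ((\<lambda>x. exp x * \<rho>' x - 2 * \<delta> * exp x) has_real_derivative d) (at z) \<and> 0 \<le> d"
          by (intro exI[of _ "\<sigma>' z - 2 * \<delta> * exp z"]) (auto simp: mult_ac)
      qed
      moreover have "0 \<le> exp y * \<rho>' y" using \<rho>'_nonneg[of y] yx x by simp
      moreover have "2 * \<delta> * exp y = exp x * \<delta>" "2 * \<delta> * exp x = 2 * (exp x * \<delta>)" by (simp_all add: ey)
      ultimately have "exp x * \<delta> \<le> exp x * \<rho>' x" by linarith
      then show ?thesis by (rule mult_left_le_imp_le) simp
    qed
    \<comment> \<open>Going back this far would bring \<rho> down to -1 or below.\<close>
    define z where "z = x0 - (\<rho> x0 + 1) / \<delta>"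
    have z: "z \<le> x0" using \<delta> \<rho>0[of x0] by (simp add: z_def)
    have "\<rho> z - \<delta> * z \<le> \<rho> x0 - \<delta> * x0"
    proof (rule DERIV_nonneg_imp_nondecreasing[OF z])
      fix y assume "z \<le> y" "y \<le> x0"
      moreover have "((\<lambda>y. \<rho> y - \<delta> * y) has_real_derivative \<rho>' y - \<delta>) (at y)"
        by (auto intro!: derivative_eq_intros D\<rho>)
      ultimately show "\<exists>d. ((\<lambda>y. \<rho> y - \<delta> * y) has_real_derivative d) (at y) \<and> 0 \<le> d"
        using slope[of y] by (intro exI[of _ "\<rho>' y - \<delta>"]) auto
    qed
    moreover have "\<delta> * z = \<delta> * x0 - (\<rho> x0 + 1)" using \<delta> by (simp add: z_def field_simps)
    ultimately show False using \<rho>0[of z] by simp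
  qed
  show ?thesis
  proof (rule tendstoI)
    fix \<epsilon> :: real assume \<epsilon>: "0 < \<epsilon>"
    then obtain x where x: "x \<le> x0" "\<rho> x < \<epsilon>^2" using small[of "\<epsilon>^2"] by auto
    have "dist (U y) q < \<epsilon>" if "y \<le> x" for y
    proof -
      have "norm (U y - q)^2 < \<epsilon>^2" using \<rho>_mono[OF that x(1)] x(2) by (simp add: \<rho>_def power2_norm_eq_inner)
      then show ?thesis unfolding dist_norm by (rule power_less_imp_less_base) (use \<epsilon> in simp)
    qed
    then show "eventually (\<lambda>y. dist (U y) q < \<epsilon>) at_bot" unfolding eventually_at_bot_linorder by blast
  qed
qed

end

section \<open>Geometry of the sublevel sets and dilations\<close>

text \<open>The set is the intersection of the \<open>Cm \<alpha>\<close>, which inherits convexity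
  and compactness. The delicate case is a point outside it with W \<le> 0: it must lie in all small
  \<open>Cp \<alpha>\<close>, and there convexity leaves only \<open>ap\<close>.\<close>

lemma sublevel_core:
  fixes W :: "'a::euclidean_space \<Rightarrow> real" and Cm Cp :: "real \<Rightarrow> 'a set"
  assumes alpha0: "0 < alpha0"
    and sub: "\<And>\<alpha>. 0 < \<alpha> \<Longrightarrow> \<alpha> \<le> alpha0 \<Longrightarrow> {u. W u \<le> \<alpha>} = Cm \<alpha> \<union> Cp \<alpha> \<and> Cm \<alpha> \<inter> Cp \<alpha> = {}
        \<and> compact (Cm \<alpha>) \<and> convex (Cm \<alpha>) \<and> compact (Cp \<alpha>) \<and> convex (Cp \<alpha>) \<and> am \<in> Cm \<alpha> \<and> ap \<in> Cp \<alpha>"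
    and R: "0 < R" and pos: "\<And>u. u \<noteq> ap \<Longrightarrow> norm (u - ap) < R \<Longrightarrow> 0 < W u"
  shows "\<exists>K. convex K \<and> compact K \<and> K \<subseteq> Cm alpha0 \<and> ap \<notin> K
    \<and> (\<forall>u\<in>K. W u \<le> 0) \<and> (\<forall>u. u \<notin> K \<longrightarrow> u \<noteq> ap \<longrightarrow> 0 < W u)"
proof -
  note sub' = sub[THEN conjunct1] sub[THEN conjunct2, THEN conjunct1]
  have conv: "convex (Cm \<alpha>)" "convex (Cp \<alpha>)" "closed (Cm \<alpha>)" "closed (Cp \<alpha>)" "am \<in> Cm \<alpha>" "ap \<in> Cp \<alpha>"
    if "0 < \<alpha>" "\<alpha> \<le> alpha0" for \<alpha>
    using sub[OF that] by (auto intro: compact_imp_closed)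
  have nested: "Cm \<alpha> \<subseteq> Cm \<beta>" if "0 < \<alpha>" "\<alpha> \<le> \<beta>" "\<beta> \<le> alpha0" for \<alpha> \<beta>
  proof -
    have "Cm \<alpha> \<subseteq> {u. W u \<le> \<alpha>}" using sub'(1)[of \<alpha>] that by auto
    also have "\<dots> \<subseteq> {u. W u \<le> \<beta>}" using that by auto
    also have "\<dots> = Cm \<beta> \<union> Cp \<beta>" using sub'(1)[of \<beta>] that by auto
    finally have s: "Cm \<alpha> \<subseteq> Cm \<beta> \<union> Cp \<beta>" .
    \<comment> \<open>A connected set covered by two disjoint closed sets lies in one of them; as it
      contains \<open>am\<close>, it lies in \<open>Cm \<beta>\<close>.\<close>
    have "connected (Cm \<alpha>)" using conv(1)[of \<alpha>] that by (intro convex_connected) auto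
    then have "Cm \<beta> \<inter> Cm \<alpha> = {} \<or> Cp \<beta> \<inter> Cm \<alpha> = {}"
      by (rule connected_closedD) (use s conv(3,4)[of \<beta>] sub'(2)[of \<beta>] that in auto)
    moreover have "am \<in> Cm \<beta> \<inter> Cm \<alpha>" using conv(5) that by auto
    ultimately show ?thesis using s by auto
  qed
  define K where "K = (\<Inter>\<alpha>\<in>{0<..alpha0}. Cm \<alpha>)"
  have KC: "K \<subseteq> Cm \<alpha>" if "0 < \<alpha>" "\<alpha> \<le> alpha0" for \<alpha> using that by (auto simp: K_def)
  have "convex K" unfolding K_def by (intro convex_INT) (use conv in auto)
  moreover have "compact K"
  proof -
    have "closed K" unfolding K_def by (intro closed_INT) (use conv in auto)
    then have "compact (Cm alpha0 \<inter> K)" using sub[OF alpha0 order_refl] by (intro compact_Int_closed) auto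
    then show ?thesis using KC[OF alpha0 order_refl] by (simp add: Int_absorb1)
  qed
  moreover have "ap \<notin> K" using KC[OF alpha0 order_refl] sub[OF alpha0 order_refl] by auto
  moreover have "W u \<le> 0" if "u \<in> K" for u
  proof (rule ccontr)
    assume "\<not> W u \<le> 0"
    define \<alpha> where "\<alpha> = min alpha0 (W u / 2)"
    have \<alpha>: "0 < \<alpha>" "\<alpha> \<le> alpha0" "\<alpha> < W u" using \<open>\<not> W u \<le> 0\<close> alpha0 by (auto simp: \<alpha>_def min_def)
    have "u \<in> {u. W u \<le> \<alpha>}" unfolding sub'(1)[OF \<alpha>(1,2)] using KC[OF \<alpha>(1,2)] that by auto
    then show False using \<alpha> by simp
  qed
  moreover have "0 < W u" if "u \<notin> K" "u \<noteq> ap" for u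
  proof (rule ccontr)
    assume neg: "\<not> 0 < W u"
    obtain \<alpha>1 where \<alpha>1: "0 < \<alpha>1" "\<alpha>1 \<le> alpha0" "u \<notin> Cm \<alpha>1" using \<open>u \<notin> K\<close> by (auto simp: K_def)
    \<comment> \<open>Missing \<open>Cm \<alpha>1\<close> means missing every smaller one, by
      nestedness.\<close>
    have uCp: "u \<in> Cp \<alpha>" if "0 < \<alpha>" "\<alpha> \<le> \<alpha>1" for \<alpha>
    proof -
      have "u \<in> {u. W u \<le> \<alpha>}" using neg that by simp
      then have "u \<in> Cm \<alpha> \<union> Cp \<alpha>" using sub'(1)[of \<alpha>] that \<alpha>1 by simp
      then show ?thesis using nested[OF that] \<alpha>1 by auto
    qed
    text \<open>The segment from \<open>ap\<close> to \<open>u\<close> would lie in every small sublevel set, against positivity near \<open>ap\<close>.\<close>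
    define t where "t = min 1 (R / (2 * norm (u - ap)))"
    have n: "0 < norm (u - ap)" using \<open>u \<noteq> ap\<close> by simp
    have t: "0 < t" "t \<le> 1" "t * norm (u - ap) < R"
    proof -
      show "0 < t" "t \<le> 1" using n R by (auto simp: t_def)
      have "t * norm (u - ap) \<le> R / (2 * norm (u - ap)) * norm (u - ap)" using n by (intro mult_right_mono) (auto simp: t_def)
      also have "\<dots> = R / 2" using n by simp
      finally show "t * norm (u - ap) < R" using R by simp
    qed
    define v where "v = (1 - t) *\<^sub>R ap + t *\<^sub>R u"
    have vd: "v - ap = t *\<^sub>R (u - ap)" by (simp add: v_def algebra_simps)
    have "0 < W v"
    proof (rule pos)
      show "v \<noteq> ap" using vd t \<open>u \<noteq> ap\<close> by auto
      show "norm (v - ap) < R" using t by (simp add: vd)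
    qed
    define \<alpha> where "\<alpha> = min \<alpha>1 (W v / 2)"
    have \<alpha>: "0 < \<alpha>" "\<alpha> \<le> \<alpha>1" "\<alpha> < W v" using \<open>0 < W v\<close> \<alpha>1 by (auto simp: \<alpha>_def min_def)
    have "\<alpha> \<le> alpha0" using \<alpha> \<alpha>1 by simp
    note C = conv[OF \<alpha>(1) this] sub'(1)[OF \<alpha>(1) this]
    have "v \<in> Cp \<alpha>" unfolding v_def using C(2) C(6) uCp[OF \<alpha>(1,2)] t by (intro convexD) auto
    then have "v \<in> {u. W u \<le> \<alpha>}" unfolding C(7) by blast
    then show False using \<alpha> by simp
  qed
  ultimately show ?thesis using KC[OF alpha0 order_refl] by blast
qed

lemma radial_increasing_imp_pos:
  fixes W :: "'a::real_normed_vector \<Rightarrow> real"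
  assumes W: "continuous_on UNIV W" "W a = 0"
    and deriv: "\<And>\<xi> s. norm \<xi> = 1 \<Longrightarrow> 0 < s \<Longrightarrow> s < R \<Longrightarrow> \<exists>d>0. ((\<lambda>s. W (a + s *\<^sub>R \<xi>)) has_real_derivative d) (at s)"
    and u: "u \<noteq> a" "norm (u - a) < R"
  shows "0 < W u"
proof -
  define \<rho> where "\<rho> = norm (u - a)"
  define \<xi> where "\<xi> = (1 / \<rho>) *\<^sub>R (u - a)"
  have \<rho>: "0 < \<rho>" using u by (simp add: \<rho>_def)
  have \<xi>: "norm \<xi> = 1" "a + \<rho> *\<^sub>R \<xi> = u" using \<rho> by (simp_all add: \<xi>_def \<rho>_def)
  have "W (a + 0 *\<^sub>R \<xi>) < W (a + \<rho> *\<^sub>R \<xi>)"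
  proof (rule DERIV_pos_imp_increasing_open[OF \<rho>])
    show "\<exists>y. ((\<lambda>s. W (a + s *\<^sub>R \<xi>)) has_real_derivative y) (at s) \<and> 0 < y" if "0 < s" "s < \<rho>" for s
      using deriv[OF \<xi>(1) that(1)] that(2) u by (auto simp: \<rho>_def)
    show "continuous_on {0..\<rho>} (\<lambda>s. W (a + s *\<^sub>R \<xi>))"
      by (intro continuous_on_compose2[OF W(1)] continuous_intros) auto
  qed
  then show ?thesis using W(2) \<xi>(2) by simp
qed

text \<open>Rewrites monotonicity along rays as the sign of the radial term that drives |U - am|^2
  in the differential equation.\<close>

lemma radial_derivative_pos:
  fixes W :: "'a::real_inner \<Rightarrow> real"
  assumes W: "(W has_derivative (\<lambda>h. g \<bullet> h)) (at u)" and u: "u \<noteq> a"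
    and deriv: "\<And>\<xi> s. norm \<xi> = 1 \<Longrightarrow> 0 < s \<Longrightarrow> a + s *\<^sub>R \<xi> = u \<Longrightarrow>
      \<exists>d>0. ((\<lambda>s. W (a + s *\<^sub>R \<xi>)) has_real_derivative d) (at s)"
  shows "0 < g \<bullet> (u - a)"
proof -
  define \<rho> where "\<rho> = norm (u - a)"
  define \<xi> where "\<xi> = (1 / \<rho>) *\<^sub>R (u - a)"
  have \<rho>: "0 < \<rho>" using u by (simp add: \<rho>_def)
  have \<xi>: "norm \<xi> = 1" "a + \<rho> *\<^sub>R \<xi> = u" using \<rho> by (simp_all add: \<xi>_def \<rho>_def)
  obtain d where d: "0 < d" "((\<lambda>s. W (a + s *\<^sub>R \<xi>)) has_real_derivative d) (at \<rho>)" using deriv[OF \<xi>(1) \<rho> \<xi>(2)] by blast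
  have "((\<lambda>s. W (a + s *\<^sub>R \<xi>)) has_derivative (\<lambda>h. g \<bullet> (h *\<^sub>R \<xi>))) (at \<rho>)"
    by (rule has_derivative_compose[of "\<lambda>s. a + s *\<^sub>R \<xi>", simplified \<xi>]) (auto intro!: derivative_eq_intros W simp: \<xi>)
  then have "((\<lambda>s. W (a + s *\<^sub>R \<xi>)) has_real_derivative g \<bullet> \<xi>) (at \<rho>)"
    by (simp add: has_field_derivative_def mult_commute_abs mult.commute)
  with d have "0 < g \<bullet> \<xi>" using DERIV_unique by blast
  then show ?thesis using \<rho> by (simp add: \<xi>_def zero_less_divide_iff)
qed

section \<open>Locally H1 curves and the energy \<open>Ec\<close> under dilation\<close>

lemma H1loc_C1:
  assumes "\<And>x. (V has_vector_derivative V' x) (at x)" "continuous_on UNIV V'"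
  shows "H1loc V V'"
  unfolding H1loc_def
proof (intro allI impI conjI)
  fix a b :: real assume ab: "a \<le> b"
  have c: "continuous_on {a..b} V'" using assms(2) by (rule continuous_on_subset) simp
  show "V' absolutely_integrable_on {a..b}" by (rule absolutely_integrable_continuous_real[OF c])
  show "(V' has_integral V b - V a) {a..b}"
    using assms(1) ab by (intro fundamental_theorem_of_calculus) (auto intro: has_vector_derivative_at_within)
  show "(\<lambda>x. (norm (V' x))\<^sup>2) integrable_on {a..b}"
    by (intro integrable_continuous_real continuous_intros c)
qed

lemma H1loc_continuous:
  assumes "H1loc V V'" shows "continuous_on UNIV V"
proof -
  have "isCont V x" for x
  proof -
    have hi: "(V' has_integral V y - V (x - 1)) {x - 1..y}" if "x - 1 \<le> y" for y
      using assms that by (simp add: H1loc_def)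
    have "V' integrable_on {x-1..x+1}" using hi[of "x+1"] by auto
    then have "continuous_on {x-1..x+1} (\<lambda>y. V (x-1) + integral {x-1..y} V')"
      by (intro continuous_intros indefinite_integral_continuous_1)
    then have "continuous_on {x-1..x+1} V"
    proof (rule continuous_on_eq)
      show "V (x-1) + integral {x-1..y} V' = V y" if "y \<in> {x-1..x+1}" for y
        using integral_unique[OF hi[of y]] that by simp
    qed
    then show ?thesis by (rule continuous_on_interior) simp
  qed
  then show ?thesis by (simp add: continuous_at_imp_continuous_on)
qed

text \<open>\<open>H1loc\<close> makes V' Lebesgue measurable, while the variational problem works
  with Borel functions and \<open>lborel\<close>. A Borel version is chosen coordinate by
  coordinate.\<close>

lemma H1loc_borel_derivative:
  assumes V: "H1loc V V'"
  obtains G where "G \<in> borel_measurable borel" "AE x in lborel. V' x = G x"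
    "\<And>a b. a \<le> b \<Longrightarrow> V b - V a = (LINT x:{a..b}|lborel. G x)"
proof -
  have si: "set_integrable lebesgue {a..b} V'" if "a \<le> b" for a b using V that by (simp add: H1loc_def)
  have m: "V' \<in> borel_measurable lebesgue"
  proof (rule borel_measurable_LIMSEQ_metric)
    show "(\<lambda>x. indicator {- real n..real n} x *\<^sub>R V' x) \<in> borel_measurable lebesgue" for n
      using si[of "- real n" "real n"] by (auto simp: set_integrable_def)
    show "(\<lambda>n. indicator {- real n..real n} x *\<^sub>R V' x) \<longlonglongrightarrow> V' x" for x
    proof (rule tendsto_eventually)
      obtain N where "\<bar>x\<bar> \<le> real N" using real_arch_simple by blast
      then show "\<forall>\<^sub>F n in sequentially. indicator {- real n..real n} x *\<^sub>R V' x = V' x"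
        unfolding eventually_sequentially by (intro exI[of _ N]) (auto simp: indicator_def)
    qed
  qed
  have "\<forall>b\<in>Basis. \<exists>g\<in>borel_measurable lborel. AE x in lborel. V' x \<bullet> b = g x"
    by (intro ballI completion_ex_borel_measurable_real) (use m in measurable)
  then obtain g where g: "\<And>b. b \<in> Basis \<Longrightarrow> g b \<in> borel_measurable lborel" "\<And>b. b \<in> Basis \<Longrightarrow> AE x in lborel. V' x \<bullet> b = g b x"
    by metis
  define G where "G x = (\<Sum>b\<in>Basis. g b x *\<^sub>R b)" for x
  have Gm[measurable]: "G \<in> borel_measurable borel" unfolding G_def using g(1) by (intro borel_measurable_sum borel_measurable_scaleR) auto
  have "AE x in lborel. \<forall>b\<in>Basis. V' x \<bullet> b = g b x" using g(2) by (intro AE_finite_allI) auto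
  then have ae: "AE x in lborel. V' x = G x"
  proof eventually_elim
    case (elim x)
    have "V' x = (\<Sum>b\<in>Basis. (V' x \<bullet> b) *\<^sub>R b)" by (simp add: euclidean_representation)
    also have "\<dots> = G x" unfolding G_def using elim by (intro sum.cong) auto
    finally show ?case .
  qed
  have "V b - V a = (LINT x:{a..b}|lborel. G x)" if ab: "a \<le> b" for a b
  proof -
    have "(V' has_integral V b - V a) {a..b}" using V ab by (simp add: H1loc_def)
    then have "V b - V a = integral {a..b} V'" by (simp add: integral_unique)
    also have "\<dots> = (LINT x:{a..b}|lebesgue. V' x)" by (rule set_lebesgue_integral_eq_integral(2)[OF si[OF ab], symmetric])
    also have "\<dots> = (LINT x:{a..b}|lebesgue. G x)"
      unfolding set_lebesgue_integral_def
    proof (rule integral_cong_AE)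
      show "AE x in lebesgue. indicat_real {a..b} x *\<^sub>R V' x = indicat_real {a..b} x *\<^sub>R G x"
        using AE_completion[OF ae] by eventually_elim simp
      show "(\<lambda>x. indicat_real {a..b} x *\<^sub>R G x) \<in> borel_measurable lebesgue" by (rule measurable_completion) simp
    qed (use si[OF ab] in \<open>auto simp: set_integrable_def\<close>)
    also have "\<dots> = (LINT x:{a..b}|lborel. G x)"
      unfolding set_lebesgue_integral_def by (rule integral_completion) simp
    finally show ?thesis .
  qed
  with Gm ae that show thesis by blast
qed

lemma Ec_cong_AE:
  assumes "AE x in lborel. V' x = G x" shows "Ec W c V V' = Ec W c V G"
proof -
  have "(\<integral>\<^sup>+ x. ennreal (((norm (V' x))^2 / 2 + Wplus W (V x)) * exp (c * x)) \<partial>lborel)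
    = (\<integral>\<^sup>+ x. ennreal (((norm (G x))^2 / 2 + Wplus W (V x)) * exp (c * x)) \<partial>lborel)"
    by (rule nn_integral_cong_AE) (use assms in \<open>auto elim!: eventually_mono\<close>)
  then show ?thesis by (simp add: Ec_def)
qed

lemma Ec_eq_integral:
  assumes i1: "integrable lborel (\<lambda>x. norm (G x)^2 * exp (c * x))" and i2: "integrable lborel (\<lambda>x. W (V x) * exp (c * x))"
  shows "Ec W c V G = ereal ((LINT x|lborel. norm (G x)^2 * exp (c * x)) / 2 + (LINT x|lborel. W (V x) * exp (c * x)))"
proof -
  have e: "((norm (G x))^2 / 2 + Wplus W (V x)) * exp (c * x) = (norm (G x)^2 * exp (c * x)) / 2 + max (W (V x) * exp (c * x)) 0"
    "Wminus W (V x) * exp (c * x) = max (- (W (V x) * exp (c * x))) 0" for x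
    by (auto simp: Wplus_def Wminus_def max_def algebra_simps mult_le_0_iff zero_le_mult_iff not_le mult_less_0_iff)
  let ?p = "\<lambda>x. (norm (G x)^2 * exp (c * x)) / 2 + max (W (V x) * exp (c * x)) 0"
  let ?m = "\<lambda>x. max (- (W (V x) * exp (c * x))) 0"
  have ip: "integrable lborel ?p" and im: "integrable lborel ?m" using i1 i2 by auto
  have "Ec W c V G = ereal (integral\<^sup>L lborel ?p) - ereal (integral\<^sup>L lborel ?m)"
    unfolding Ec_def e
    by (subst nn_integral_eq_integral[OF ip], simp, subst nn_integral_eq_integral[OF im], simp)
      (simp add: enn2ereal_ennreal Bochner_Integration.integral_nonneg)
  also have "\<dots> = ereal (LINT x|lborel. ?p x - ?m x)" using ip im by simp
  also have "(LINT x|lborel. ?p x - ?m x) = (LINT x|lborel. (norm (G x)^2 * exp (c * x)) / 2 + W (V x) * exp (c * x))"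
    by (rule Bochner_Integration.integral_cong) (auto simp: max_def)
  also have "\<dots> = (LINT x|lborel. norm (G x)^2 * exp (c * x)) / 2 + (LINT x|lborel. W (V x) * exp (c * x))"
    using i1 i2 by simp
  finally show ?thesis .
qed

text \<open>The energy is a positive part minus a negative part. With the negative part finite, an
  infinite positive part would make the energy infinite, so a negative energy has both parts
  finite.\<close>

lemma Ec_negD:
  assumes [measurable]: "G \<in> borel_measurable borel" "V \<in> borel_measurable borel" "W \<in> borel_measurable borel"
    and im: "integrable lborel (\<lambda>x. Wminus W (V x) * exp (c * x))" and neg: "Ec W c V G < 0"
  shows "integrable lborel (\<lambda>x. norm (G x)^2 * exp (c * x))" "integrable lborel (\<lambda>x. W (V x) * exp (c * x))"
proof -
  let ?p = "\<lambda>x. ((norm (G x))^2 / 2 + Wplus W (V x)) * exp (c * x)"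
  have [measurable]: "(\<lambda>x. Wplus W (V x)) \<in> borel_measurable borel" unfolding Wplus_def by measurable
  have p0: "0 \<le> Wplus W u" "0 \<le> Wminus W u" for u by (auto simp: Wplus_def Wminus_def)
  have "(\<integral>\<^sup>+ x. ennreal (?p x) \<partial>lborel) < \<infinity>"
  proof (rule ccontr)
    assume "\<not> (\<integral>\<^sup>+ x. ennreal (?p x) \<partial>lborel) < \<infinity>"
    then have "(\<integral>\<^sup>+ x. ennreal (?p x) \<partial>lborel) = \<infinity>" by (simp add: less_top[symmetric])
    moreover have "(\<integral>\<^sup>+ x. ennreal (Wminus W (V x) * exp (c * x)) \<partial>lborel) = ennreal (LINT x|lborel. Wminus W (V x) * exp (c * x))"
      by (rule nn_integral_eq_integral[OF im]) (simp add: p0)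
    ultimately have "Ec W c V G = \<infinity> - ereal (LINT x|lborel. Wminus W (V x) * exp (c * x))"
      by (simp add: Ec_def enn2ereal_ennreal Bochner_Integration.integral_nonneg p0)
    then show False using neg by simp
  qed
  then have ip: "integrable lborel ?p"
    by (intro integrableI_nonneg) (auto simp: p0)
  have "integrable lborel (\<lambda>x. norm (G x)^2 / 2 * exp (c * x))"
    by (rule Bochner_Integration.integrable_bound[OF ip]) (auto intro!: mult_right_mono simp: p0 abs_mult add_nonneg_nonneg)
  from integrable_mult_right[OF this, of 2] show "integrable lborel (\<lambda>x. norm (G x)^2 * exp (c * x))" by simp
  have "integrable lborel (\<lambda>x. Wplus W (V x) * exp (c * x))"
    by (rule Bochner_Integration.integrable_bound[OF ip]) (auto intro!: mult_right_mono simp: p0 abs_mult add_nonneg_nonneg)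
  from Bochner_Integration.integrable_diff[OF this im]
  have i: "integrable lborel (\<lambda>x. Wplus W (V x) * exp (c * x) - Wminus W (V x) * exp (c * x))" .
  have "Wplus W (V x) * exp (c * x) - Wminus W (V x) * exp (c * x) = W (V x) * exp (c * x)" for x
    by (simp add: Wplus_def Wminus_def max_def)
  then show "integrable lborel (\<lambda>x. W (V x) * exp (c * x))" using i by (simp only:)
qed

text \<open>The derivative contributes c^2 and the change of variables 1 / c. The dependence on the
  speed is then explicit, so one curve can be tested at all speeds.\<close>

lemma Ec_dilation:
  assumes c: "0 < c" and i1: "integrable lborel (\<lambda>x. norm (G x)^2 * exp x)" and i2: "integrable lborel (\<lambda>x. W (U x) * exp x)"
  shows "Ec W c (\<lambda>x. U (c * x)) (\<lambda>x. c *\<^sub>R G (c * x))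
    = ereal ((c^2 / 2 * (LINT x|lborel. norm (G x)^2 * exp x) + (LINT x|lborel. W (U x) * exp x)) / c)"
proof -
  have e: "norm (c *\<^sub>R G (c * x))^2 * exp (c * x) = c^2 * (norm (G (0 + c * x))^2 * exp (0 + c * x))" for x
    by (simp add: power_mult_distrib)
  have j1: "integrable lborel (\<lambda>x. norm (G (0 + c * x))^2 * exp (0 + c * x))"
    using lborel_integrable_real_affine[OF i1, of c 0] c by simp
  have j2: "integrable lborel (\<lambda>x. W (U (c * x)) * exp (c * x))"
    using lborel_integrable_real_affine[OF i2, of c 0] c by simp
  have "Ec W c (\<lambda>x. U (c * x)) (\<lambda>x. c *\<^sub>R G (c * x)) = ereal ((LINT x|lborel. c^2 * (norm (G (0 + c * x))^2 * exp (0 + c * x))) / 2 + (LINT x|lborel. W (U (c * x)) * exp (c * x)))"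
    by (subst Ec_eq_integral) (use j1 j2 in \<open>simp_all only: e integrable_mult_right\<close>)
  moreover have "(LINT x|lborel. norm (G x)^2 * exp x) = c * (LINT x|lborel. norm (G (0 + c * x))^2 * exp (0 + c * x))"
    using lborel_integral_real_affine[of c "\<lambda>x. norm (G x)^2 * exp x" 0] c by simp
  moreover have "(LINT x|lborel. W (U x) * exp x) = c * (LINT x|lborel. W (U (c * x)) * exp (c * x))"
    using lborel_integral_real_affine[of c "\<lambda>x. W (U x) * exp x" 0] c by simp
  ultimately show ?thesis using c by (simp add: field_simps power2_eq_square)
qed

lemma eventually_bounded_below_not_integrable:
  fixes f :: "real \<Rightarrow> real"
  assumes "integrable lborel f" and k: "0 < k" and lower: "eventually (\<lambda>y. k \<le> f y) at_top"
  shows False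
proof -
  obtain Y where Y: "\<And>y. Y \<le> y \<Longrightarrow> k \<le> f y" using lower unfolding eventually_at_top_linorder by blast
  \<comment> \<open>k n exceeds the integral of |f| by exactly k.\<close>
  define n where "n = (LINT x|lborel. norm (f x)) / k + 1"
  have n: "0 < n" unfolding n_def using k by (intro add_nonneg_pos divide_nonneg_pos Bochner_Integration.integral_nonneg) auto
  have "k * n = (LINT x:{Y..Y+n}|lborel. k)" using n by (simp add: set_lebesgue_integral_def mult.commute)
  also have "\<dots> \<le> (LINT x|lborel. norm (f x))"
    unfolding set_lebesgue_integral_def
  proof (rule Bochner_Integration.integral_mono)
    show "integrable lborel (\<lambda>x. indicat_real {Y..Y + n} x *\<^sub>R k)"
      using borel_integrable_atLeastAtMost'[of Y "Y+n" "\<lambda>_. k"] by (simp add: set_integrable_def)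
    show "indicat_real {Y..Y + n} x *\<^sub>R k \<le> norm (f x)" for x using Y[of x] k by (auto simp: indicator_def)
  qed (use assms in simp)
  also have "\<dots> < k * n" using k by (simp add: n_def distrib_left)
  finally show False by simp
qed

text \<open>\<open>V\<close> is assumed to stay near \<open>p\<close>, not to converge to it. Finite
  kinetic energy gives the rescaled \<open>V\<close> some limit p + d; if d were nonzero,
  \<open>W\<close> would be positive there and W (V) exp (c x) could not be integrable.\<close>

lemma (in well_potential) dilated_competitor:
  assumes c: "0 < c" and [measurable]: "G0 \<in> borel_measurable borel"
    and V: "\<And>a b. a \<le> b \<Longrightarrow> V b - V a = (LINT x:{a..b}|lborel. G0 x)"
    and near: "\<And>x. L \<le> x \<Longrightarrow> norm (V x - p) \<le> r" and pos: "\<And>u. u \<noteq> p \<Longrightarrow> norm (u - p) \<le> r \<Longrightarrow> 0 < W u"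
    and i1: "integrable lborel (\<lambda>x. norm (G0 x)^2 * exp (c * x))" and i2: "integrable lborel (\<lambda>x. W (V x) * exp (c * x))"
    and neg: "(LINT x|lborel. norm (G0 x)^2 * exp (c * x)) / 2 + (LINT x|lborel. W (V x) * exp (c * x)) < 0"
  shows "c^2 \<in> critical_values"
proof -
  define G where "G = (\<lambda>y. (1 / c) *\<^sub>R G0 (0 + (1/c) * y))"
  have [measurable]: "G \<in> borel_measurable borel" unfolding G_def by measurable
  have c1: "1 / c \<noteq> 0" using c by simp
  have e1: "norm (G y)^2 * exp y = (1 / c^2) * (norm (G0 (0 + (1/c) * y))^2 * exp (c * (0 + (1/c) * y)))" for y
    using c by (simp add: G_def power_divide)
  have Gw: "weighted_L2 G"
    unfolding weighted_L2_def e1 using lborel_integrable_real_affine[OF i1 c1, of 0] by simp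
  have kin: "kinetic G = (LINT x|lborel. norm (G0 x)^2 * exp (c * x)) / c"
    unfolding kinetic_def e1 using lborel_integral_real_affine[OF c1, of "\<lambda>x. norm (G0 x)^2 * exp (c * x)" 0] c
    by (simp add: power2_eq_square field_simps)
  have diff: "V (b / c) - V (a / c) = profile p G b - profile p G a" if "a \<le> b" for a b
  proof -
    have "V (b / c) - V (a / c) = (LINT x|lborel. indicator {a/c..b/c} x *\<^sub>R G0 x)"
      using V[of "a / c" "b / c"] that c by (simp add: divide_right_mono set_lebesgue_integral_def)
    also have "\<dots> = (1 / c) *\<^sub>R (LINT y|lborel. indicator {a/c..b/c} (0 + (1/c) * y) *\<^sub>R G0 (0 + (1/c) * y))"
      using lborel_integral_real_affine[OF c1, of "\<lambda>x. indicator {a/c..b/c} x *\<^sub>R G0 x" 0] c by simp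
    also have "\<dots> = (LINT y|lborel. (1 / c) *\<^sub>R (indicator {a/c..b/c} (0 + (1/c) * y) *\<^sub>R G0 (0 + (1/c) * y)))"
      by (rule integral_scaleR_right[symmetric])
    also have "\<dots> = (LINT y|lborel. indicator {a..b} y *\<^sub>R G y)"
      by (rule Bochner_Integration.integral_cong) (use c in \<open>auto simp: G_def indicator_def divide_le_cancel\<close>)
    also have "\<dots> = profile p G b - profile p G a"
      unfolding profile_diff[OF Gw that] by (simp add: set_lebesgue_integral_def)
    finally show ?thesis .
  qed
  \<comment> \<open>After rescaling, \<open>V\<close> and the profile have the same increments, so
    they differ by this constant.\<close>
  define d where "d = V 0 - profile p G 0"
  have Vd: "V (y / c) = profile p G y + d" for y
    using diff[of 0 y] diff[of y 0] by (cases "0 \<le> y") (auto simp: d_def algebra_simps)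
  have lim: "((\<lambda>y. profile p G y + d) \<longlongrightarrow> p + d) at_top" by (intro tendsto_intros profile_tendsto Gw)
  have "norm ((p + d) - p) \<le> r"
  proof (rule tendsto_upperbound)
    show "((\<lambda>y. norm ((profile p G y + d) - p)) \<longlongrightarrow> norm ((p + d) - p)) at_top" by (intro tendsto_intros lim)
    show "\<forall>\<^sub>F y in at_top. norm ((profile p G y + d) - p) \<le> r"
      using eventually_ge_at_top[of "c * L"]
    proof eventually_elim
      case (elim y)
      then have "L \<le> y / c" using c by (simp add: field_simps)
      from near[OF this] show ?case by (simp only: Vd)
    qed
  qed simp
  have i2': "integrable lborel (\<lambda>y. W (profile p G y + d) * exp y)"
    using lborel_integrable_real_affine[OF i2 c1, of 0] c by (simp add: Vd)
  have "d = 0"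
  proof (rule ccontr)
    assume "d \<noteq> 0"
    then have Wp: "0 < W (p + d)" using pos[of "p + d"] \<open>norm ((p + d) - p) \<le> r\<close> by simp
    have "((\<lambda>y. W (profile p G y + d)) \<longlongrightarrow> W (p + d)) at_top"
      by (rule continuous_on_tendsto_compose[OF W_cont lim]) auto
    then have "\<forall>\<^sub>F y in at_top. W (p + d) / 2 < W (profile p G y + d)"
      using Wp by (intro order_tendstoD(1)) auto
    then have "\<forall>\<^sub>F y in at_top. W (p + d) / 2 \<le> W (profile p G y + d) * exp y"
      using eventually_ge_at_top[of 0]
    proof eventually_elim
      case (elim y)
      have "W (p + d) / 2 * 1 \<le> W (profile p G y + d) * exp y"
        using elim Wp by (intro mult_mono) auto
      then show ?case by simp
    qed
    then show False using eventually_bounded_below_not_integrable[OF i2', of "W (p + d) / 2"] Wp by simp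
  qed
  have adm: "admissible G" using Gw i2' \<open>d = 0\<close> by (simp add: admissible_def)
  have pot: "potential G = c * (LINT x|lborel. W (V x) * exp (c * x))"
    unfolding potential_def using lborel_integral_real_affine[OF c1, of "\<lambda>x. W (V x) * exp (c * x)" 0] c \<open>d = 0\<close> by (simp add: Vd field_simps)
  have "c^2 / 2 * kinetic G + potential G = c * ((LINT x|lborel. norm (G0 x)^2 * exp (c * x)) / 2 + (LINT x|lborel. W (V x) * exp (c * x)))"
    unfolding kin pot using c by (simp add: power2_eq_square algebra_simps)
  also have "\<dots> < 0" using neg c by (simp add: mult_pos_neg)
  finally show ?thesis using adm c unfolding critical_values_def by auto
qed

text \<open>From L on the negative part of W (V) vanishes, and before L it is at most - W q, so it
  is integrable against exp (c x); a negative energy then makes both energies finite.\<close>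

lemma negative_energy_critical:
  fixes W :: "real^'n::finite \<Rightarrow> real"
  assumes "well_potential W p q r" and c: "0 < c" and V: "H1loc V V'" and near: "\<And>x. L \<le> x \<Longrightarrow> norm (V x - p) \<le> r"
    and pos: "\<And>u. u \<noteq> p \<Longrightarrow> norm (u - p) \<le> r \<Longrightarrow> 0 < W u" and neg: "Ec W c V V' < 0"
  shows "c^2 \<in> well_potential.critical_values W p"
proof -
  interpret well_potential W p q r by fact
  obtain G where G[measurable]: "G \<in> borel_measurable borel" and ae: "AE x in lborel. V' x = G x"
    and diff: "\<And>a b. a \<le> b \<Longrightarrow> V b - V a = (LINT x:{a..b}|lborel. G x)"
    by (rule H1loc_borel_derivative[OF V]) blast
  have [measurable]: "V \<in> borel_measurable borel" by (rule borel_measurable_continuous_onI[OF H1loc_continuous[OF V]])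
  have [measurable]: "(\<lambda>x. Wminus W (V x)) \<in> borel_measurable borel" unfolding Wminus_def by measurable
  have "integrable lborel (\<lambda>x. indicat_real {..c * L} (0 + c * x) * exp (0 + c * x))"
    by (rule lborel_integrable_real_affine[OF exp_below_integrable(1)]) (use c in simp)
  then have dom: "integrable lborel (\<lambda>x. - W q * (indicat_real {..c * L} (0 + c * x) * exp (0 + c * x)))"
    by (rule integrable_mult_right)
  have im: "integrable lborel (\<lambda>x. Wminus W (V x) * exp (c * x))"
  proof (rule Bochner_Integration.integrable_bound[OF dom])
    show "AE x in lborel. norm (Wminus W (V x) * exp (c * x)) \<le> norm (- W q * (indicat_real {..c * L} (0 + c * x) * exp (0 + c * x)))"
    proof (rule AE_I2)
      fix x
      have "Wminus W (V x) \<le> - W q" using W_min[of "V x"] W_q by (simp add: Wminus_def)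
      then have "Wminus W (V x) * exp (c * x) \<le> - W q * exp (c * x)" by (rule mult_right_mono) simp
      moreover have "Wminus W (V x) = 0" if "L \<le> x" using W_near[OF near[OF that]] by (simp add: Wminus_def)
      moreover have "0 \<le> Wminus W (V x)" by (simp add: Wminus_def)
      ultimately show "norm (Wminus W (V x) * exp (c * x)) \<le> norm (- W q * (indicat_real {..c * L} (0 + c * x) * exp (0 + c * x)))"
        using c W_q by (cases "x \<le> L") (auto simp: abs_mult)
    qed
  qed measurable
  have neg': "Ec W c V G < 0" using neg Ec_cong_AE[OF ae] by metis
  have i1: "integrable lborel (\<lambda>x. norm (G x)^2 * exp (c * x))" by (rule Ec_negD(1)[OF G _ _ im neg']) measurable
  have i2: "integrable lborel (\<lambda>x. W (V x) * exp (c * x))" by (rule Ec_negD(2)[OF G _ _ im neg']) measurable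
  have "(LINT x|lborel. norm (G x)^2 * exp (c * x)) / 2 + (LINT x|lborel. W (V x) * exp (c * x)) < 0"
    using neg' unfolding Ec_eq_integral[OF i1 i2] by (simp add: zero_ereal_def)
  from dilated_competitor[OF c G diff near pos i1 i2 this] show ?thesis .
qed

section \<open>The travelling wave, the identification of its speed, and its energy\<close>

theorem mainTheorem1:
  fixes W :: "real^'n::finite \<Rightarrow> real"
    and DW :: "real^'n \<Rightarrow> real^'n" and D2W :: "real^'n \<Rightarrow> real^'n^'n"
    and am ap :: "real^'n"
    and Cm Cp :: "real \<Rightarrow> (real^'n) set"
    and alpha0 c0 R0 r0 :: real
  assumes W_C2: "C2_with UNIV W DW D2W"
    and am_min: "\<forall>u. W am \<le> W u"
    and ap_locmin: "\<exists>e>0. \<forall>u. dist u ap < e \<longrightarrow> W ap \<le> W u"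
    and W_am: "W am < 0" and W_ap: "W ap = 0"
    and alpha0_pos: "alpha0 > 0"
    and sublevels: "\<forall>alpha\<in>{0<..alpha0}.
          {u. W u = alpha} = frontier (Cm alpha) \<union> frontier (Cp alpha)
        \<and> {u. W u \<le> alpha} = Cm alpha \<union> Cp alpha
        \<and> Cm alpha \<inter> Cp alpha = {}
        \<and> compact (Cm alpha) \<and> convex (Cm alpha) \<and> C2_boundary (Cm alpha)
        \<and> compact (Cp alpha) \<and> convex (Cp alpha) \<and> C2_boundary (Cp alpha)
        \<and> am \<in> Cm alpha \<and> ap \<in> Cp alpha"
    and c0_pos: "c0 > 0"
    and normal_cond: "\<forall>p\<in>frontier (connected_component_set {u. W u \<le> 0} am).
          \<exists>nu. outward_unit_normal (connected_component_set {u. W u \<le> 0} am) p nu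
               \<and> DW p \<bullet> nu \<ge> c0"
    and hess_cond: "\<forall>p\<in>frontier (connected_component_set {u. W u \<le> 0} am).
          \<forall>xi. xi \<bullet> (D2W p *v xi) \<ge> c0 * (norm xi)^2"
    and radial_star: "\<forall>xi. norm xi = 1 \<longrightarrow> (\<forall>r>0. am + r *\<^sub>R xi \<in> Cm alpha0 \<longrightarrow>
          (\<exists>d>0. ((\<lambda>s. W (am + s *\<^sub>R xi)) has_real_derivative d) (at r)))"
    and R0_pos: "R0 > 0"
    and radial: "\<forall>xi. norm xi = 1 \<longrightarrow> (\<forall>r\<in>{0<..<R0}.
          (\<exists>d>0. ((\<lambda>s. W (am + s *\<^sub>R xi)) has_real_derivative d) (at r))
        \<and> (\<exists>d>0. ((\<lambda>s. W (ap + s *\<^sub>R xi)) has_real_derivative d) (at r)))"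
    and r0: "0 < r0" "r0 < R0"
    and r0_ap: "\<forall>u. norm (u - ap) \<le> r0 \<longrightarrow> W u \<ge> 0"
    and r0_am: "\<forall>u. norm (u - am) \<le> r0 \<longrightarrow> W u < 0"
  shows "\<exists>U U' U'' c. c > 0
     \<and> (\<forall>x. (U has_vector_derivative U' x) (at x))
     \<and> (\<forall>x. (U' has_vector_derivative U'' x) (at x))
     \<and> continuous_on UNIV U''
     \<and> (\<forall>x. U'' x - DW (U x) = - c *\<^sub>R U' x)
     \<and> (U \<longlongrightarrow> am) at_bot \<and> (U \<longlongrightarrow> ap) at_top
     \<and> ereal c = cstar W am ap r0
     \<and> Ec W c U U' = 0"
proof -
  have D: "(W has_derivative (\<lambda>h. DW u \<bullet> h)) (at u)" "(DW has_derivative (\<lambda>h. D2W u *v h)) (at u)" for u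
    using W_C2 by (auto simp: C2_with_def)
  have W_cont: "continuous_on UNIV W" and DW_cont: "continuous_on UNIV DW"
    using D by (meson continuous_at_imp_continuous_on has_derivative_continuous)+
  have pos: "0 < W u" if "u \<noteq> ap" "norm (u - ap) < R0" for u
    by (rule radial_increasing_imp_pos[OF W_cont W_ap _ that]) (use radial in auto)
  have sub: "{u. W u \<le> \<alpha>} = Cm \<alpha> \<union> Cp \<alpha> \<and> Cm \<alpha> \<inter> Cp \<alpha> = {} \<and> compact (Cm \<alpha>) \<and> convex (Cm \<alpha>)
      \<and> compact (Cp \<alpha>) \<and> convex (Cp \<alpha>) \<and> am \<in> Cm \<alpha> \<and> ap \<in> Cp \<alpha>" if "0 < \<alpha>" "\<alpha> \<le> alpha0" for \<alpha>
  proof -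
    have "\<alpha> \<in> {0<..alpha0}" using that by simp
    from bspec[OF sublevels this] show ?thesis by (elim conjE) (intro conjI; assumption)
  qed
  have "\<exists>K. convex K \<and> compact K \<and> K \<subseteq> Cm alpha0 \<and> ap \<notin> K
    \<and> (\<forall>u\<in>K. W u \<le> 0) \<and> (\<forall>u. u \<notin> K \<longrightarrow> u \<noteq> ap \<longrightarrow> 0 < W u)"
    by (rule sublevel_core[OF alpha0_pos sub R0_pos pos])
  then obtain K where K: "convex K" "compact K" "K \<subseteq> Cm alpha0" "ap \<notin> K"
    "\<And>u. u \<in> K \<Longrightarrow> W u \<le> 0" "\<And>u. u \<notin> K \<Longrightarrow> u \<noteq> ap \<Longrightarrow> 0 < W u"
    by metis
  interpret star_well W ap am r0 DW K
  proof unfold_locales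
    \<comment> \<open>\<open>K\<close> lies in \<open>Cm alpha0\<close>, where the hypothesis on
      rays from \<open>am\<close> applies.\<close>
    show "0 < DW u \<bullet> (u - am)" if "u \<in> K" "u \<noteq> am" for u
      by (rule radial_derivative_pos[OF D(1) that(2)]) (use radial_star that(1) K(3) in blast)
  qed (use W_cont DW_cont am_min W_am W_ap r0 r0_ap K D in auto)
  obtain M G where M: "0 < M" "Sup critical_values = M" and G: "admissible G" "potential G < 0"
    and zero: "M / 2 * kinetic G + potential G = 0" and least: "\<And>H. admissible H \<Longrightarrow> 0 \<le> M / 2 * kinetic H + potential H"
    by (rule minimiser_exists) blast
  have min: "minimiser M G" using M G zero least by (simp add: minimiser_def)
  have Gw: "weighted_L2 G" using G by (simp add: admissible_def)
  define U where "U = profile ap G"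
  obtain U' U'' where d1: "\<And>x. (U has_vector_derivative U' x) (at x)" and d2: "\<And>x. (U' has_vector_derivative U'' x) (at x)"
    and eq: "\<And>x. M *\<^sub>R (U'' x + U' x) = DW (U x)" and ae: "AE x in lborel. G x = U' x"
    unfolding U_def by (rule minimiser_euler_lagrange[OF min]) blast
  have U'c: "continuous_on UNIV U'" and Uc: "continuous_on UNIV U"
    using d1 d2 by (meson continuous_at_imp_continuous_on has_vector_derivative_continuous)+
  have U''eq: "U'' x = (1 / M) *\<^sub>R DW (U x) - U' x" for x
    using arg_cong[OF eq[of x], of "\<lambda>v. (1 / M) *\<^sub>R v"] M(1) by (simp add: algebra_simps)
  have top: "(U \<longlongrightarrow> ap) at_top" unfolding U_def by (rule profile_tendsto[OF Gw])
  obtain x0 where x0: "U x0 \<in> K" using minimiser_enters_K[OF G(2)] by (auto simp: U_def)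
  have bot: "(U \<longlongrightarrow> am) at_bot"
  proof (rule solution_tendsto_q[OF M(1) d1 d2 eq])
    show "U x \<in> K" if "x \<le> x0" for x
      using minimiser_stays_in_K[OF min _ that] x0 by (simp add: U_def)
  qed
  have e: "AE x in lborel. norm (G x)^2 * exp x = norm (U' x)^2 * exp x" using ae by eventually_elim simp
  note [measurable] = weighted_L2_measurable[OF Gw]
  have [measurable]: "U' \<in> borel_measurable borel" using U'c by (rule borel_measurable_continuous_onI)
  have i1: "integrable lborel (\<lambda>x. norm (U' x)^2 * exp x)"
  proof -
    have "integrable lborel (\<lambda>x. norm (G x)^2 * exp x)" using Gw by (simp add: weighted_L2_def)
    then show ?thesis by (rule integrable_cong_AE_imp) (use e in \<open>auto elim: eventually_mono\<close>)
  qed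
  have kin: "(LINT x|lborel. norm (U' x)^2 * exp x) = kinetic G"
    unfolding kinetic_def by (rule integral_cong_AE) (use e in \<open>auto elim: eventually_mono\<close>)
  have i2: "integrable lborel (\<lambda>x. W (U x) * exp x)" and pot: "(LINT x|lborel. W (U x) * exp x) = potential G"
    using G(1) by (auto simp: admissible_def potential_def U_def)
  have energy: "Ec W l (\<lambda>x. U (l * x)) (\<lambda>x. l *\<^sub>R U' (l * x)) = ereal ((l^2 / 2 * kinetic G + potential G) / l)" if "0 < l" for l
    using Ec_dilation[of l U' W U, OF that i1 i2] by (simp only: kin pot)
  have dil: "((\<lambda>x. f (l * x)) has_vector_derivative l *\<^sub>R f' (l * x)) (at x)"
    if "\<And>x. (f has_vector_derivative f' x) (at x)" for f f' :: "real \<Rightarrow> real^'n" and l x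
  proof -
    have "((*) l has_vector_derivative l) (at x)"
      using has_real_derivative_iff_has_vector_derivative[of "(*) l" l "at x"] by (auto intro!: derivative_eq_intros)
    from vector_diff_chain_at[OF this that] show ?thesis by (simp add: o_def)
  qed
  \<comment> \<open>Elements of \<open>critical_values\<close> are squares of speeds, hence the
    root.\<close>
  define c where "c = sqrt M"
  have c: "0 < c" "c^2 = M" "c * c = M" using M(1) by (simp_all add: c_def)
  have upper: "cstar W am ap r0 \<le> ereal c"
    unfolding cstar_def
  proof (rule Sup_least)
    fix y assume "y \<in> {ereal c | c. c > 0 \<and> (\<exists>L\<ge>1. (INF p\<in>XL am ap r0 L. Ec W c (fst p) (snd p)) < 0)}"
    then obtain l L where l: "y = ereal l" "0 < l" and inf: "(INF p\<in>XL am ap r0 L. Ec W l (fst p) (snd p)) < 0" by blast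
    then obtain V V' where V: "(V, V') \<in> XL am ap r0 L" "Ec W l V V' < 0" by (auto simp: INF_less_iff)
    have "l^2 \<in> critical_values"
    proof (rule negative_energy_critical[OF well_potential_axioms l(2) _ _ _ V(2)])
      show "H1loc V V'" "\<And>x. L \<le> x \<Longrightarrow> norm (V x - ap) \<le> r0" using V(1) by (auto simp: XL_def)
      show "\<And>u. u \<noteq> ap \<Longrightarrow> norm (u - ap) \<le> r0 \<Longrightarrow> 0 < W u" using pos r0 by auto
    qed
    then have "l^2 \<le> c^2" unfolding c(2) M(2)[symmetric] by (rule cSup_upper[OF _ critical_values_bounded])
    then have "l \<le> c" by (rule power2_le_imp_le) (use c(1) in simp)
    then show "y \<le> ereal c" using l by simp
  qed
  have lower: "ereal l \<le> cstar W am ap r0" if l: "0 < l" "l < c" for l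
    unfolding cstar_def
  proof (rule Sup_upper)
    have "eventually (\<lambda>x. norm (U x - ap) < r0) at_top" "eventually (\<lambda>x. norm (U x - am) < r0) at_bot"
      using tendstoD[OF top r0(1)] tendstoD[OF bot r0(1)] by (simp_all add: dist_norm)
    then obtain A B where AB: "\<And>x. A \<le> x \<Longrightarrow> norm (U x - ap) < r0" "\<And>x. x \<le> B \<Longrightarrow> norm (U x - am) < r0"
      unfolding eventually_at_top_linorder eventually_at_bot_linorder by blast
    \<comment> \<open>A and B are thresholds for \<open>U\<close>; dividing by l gives those of the
      dilated curve, and \<open>XL\<close> wants one L \<ge> 1 serving both sides.\<close>
    define L where "L = max 1 (max (A / l) (- B / l))"
    have L: "1 \<le> L" "A \<le> l * L" "- B \<le> l * L"
    proof -
      show "1 \<le> L" by (simp add: L_def)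
      have "A / l \<le> L" "- B / l \<le> L" unfolding L_def by linarith+
      then show "A \<le> l * L" "- B \<le> l * L" using pos_divide_le_eq[OF l(1), of A L] pos_divide_le_eq[OF l(1), of "- B" L] by (simp_all only: mult.commute)
    qed
    have "((\<lambda>x. U (l * x)), (\<lambda>x. l *\<^sub>R U' (l * x))) \<in> XL am ap r0 L"
      unfolding XL_def
    proof (clarsimp, intro conjI allI impI)
      show "H1loc (\<lambda>x. U (l * x)) (\<lambda>x. l *\<^sub>R U' (l * x))"
        by (intro H1loc_C1 dil d1 continuous_intros continuous_on_compose2[OF U'c]) auto
      show "norm (U (l * x) - ap) \<le> r0" if "L \<le> x" for x
      proof -
        have "l * L \<le> l * x" using that l(1) by (intro mult_left_mono) auto
        then show ?thesis using less_imp_le[OF AB(1)[OF order_trans[OF L(2)]]] by blast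
      qed
      show "norm (U (l * x) - am) \<le> r0" if "x \<le> - L" for x
      proof -
        have "l * x \<le> l * (- L)" using that l(1) by (intro mult_left_mono) auto
        then have "l * x \<le> B" using L(3) by simp
        then show ?thesis by (rule less_imp_le[OF AB(2)])
      qed
    qed
    moreover have "Ec W l (\<lambda>x. U (l * x)) (\<lambda>x. l *\<^sub>R U' (l * x)) < 0"
    proof -
      have k: "0 < kinetic G" by (rule kinetic_pos[OF G])
      \<comment> \<open>Below the critical speed the kinetic term is strictly smaller, because the
        kinetic energy does not vanish, so the energy drops below its critical value 0.\<close>
      have "l^2 < M" using l c(1) unfolding c(2)[symmetric] by (intro power_strict_mono) auto
      then have "l^2 / 2 * kinetic G < M / 2 * kinetic G" using k by (intro mult_strict_right_mono) auto
      then have "l^2 / 2 * kinetic G + potential G < 0" using zero by linarith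
      then show ?thesis unfolding energy[OF l(1)] using l(1) by (simp add: divide_neg_pos zero_ereal_def)
    qed
    ultimately have "(INF p\<in>XL am ap r0 L. Ec W l (fst p) (snd p)) < 0"
      by (intro INF_less_iff[THEN iffD2] bexI[of _ "((\<lambda>x. U (l * x)), (\<lambda>x. l *\<^sub>R U' (l * x)))"]) auto
    then show "ereal l \<in> {ereal c | c. c > 0 \<and> (\<exists>L\<ge>1. (INF p\<in>XL am ap r0 L. Ec W c (fst p) (snd p)) < 0)}"
      using l(1) L(1) by blast
  qed
  have speed: "ereal c = cstar W am ap r0"
  proof (rule antisym[OF _ upper], rule ccontr)
    assume "\<not> ereal c \<le> cstar W am ap r0"
    \<comment> \<open>The maximum with 0 makes the intermediate speed positive, as
      \<open>lower\<close> requires.\<close>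
    then have "max (cstar W am ap r0) 0 < ereal c" using c(1) by (simp add: not_le zero_ereal_def)
    then obtain l where l: "max (cstar W am ap r0) 0 < ereal l" "ereal l < ereal c" using ereal_dense2 by blast
    then have "cstar W am ap r0 < ereal l" "0 < l" "l < c" by (simp_all add: zero_ereal_def)
    then show False using leD[OF lower[of l]] by blast
  qed
  show ?thesis
  proof (intro exI conjI allI)
    show "0 < c" by (rule c)
    show "((\<lambda>x. U (c * x)) has_vector_derivative c *\<^sub>R U' (c * x)) (at x)" for x by (rule dil[OF d1])
    show "((\<lambda>x. c *\<^sub>R U' (c * x)) has_vector_derivative c *\<^sub>R (c *\<^sub>R U'' (c * x))) (at x)" for x
      by (rule bounded_linear.has_vector_derivative[OF bounded_linear_scaleR_right dil[OF d2]])
    show "continuous_on UNIV (\<lambda>x. c *\<^sub>R (c *\<^sub>R U'' (c * x)))"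
      unfolding U''eq by (intro continuous_intros continuous_on_compose2[OF DW_cont] continuous_on_compose2[OF Uc] continuous_on_compose2[OF U'c]) auto
    show "c *\<^sub>R (c *\<^sub>R U'' (c * x)) - DW (U (c * x)) = - c *\<^sub>R (c *\<^sub>R U' (c * x))" for x
      unfolding eq[symmetric] by (simp add: c(3) scaleR_add_right)
    show "((\<lambda>x. U (c * x)) \<longlongrightarrow> am) at_bot"
      by (rule filterlim_compose[OF bot]) (use c(1) in \<open>simp add: filterlim_tendsto_pos_mult_at_bot[OF tendsto_const _ filterlim_ident]\<close>)
    show "((\<lambda>x. U (c * x)) \<longlongrightarrow> ap) at_top"
      by (rule filterlim_compose[OF top]) (use c(1) in \<open>simp add: filterlim_tendsto_pos_mult_at_top[OF tendsto_const _ filterlim_ident]\<close>)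
    show "ereal c = cstar W am ap r0" by (rule speed)
    show "Ec W c (\<lambda>x. U (c * x)) (\<lambda>x. c *\<^sub>R U' (c * x)) = 0"
      unfolding energy[OF c(1)] c(2) zero by simp
  qed
qed

end
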